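(* For each sufficiently large $\lambda$ let $\omega^\lambda$ be a maximizer of $E$ over $K_\lambda$, and write $\omega_i^\lambda=\omega^\lambda I_{B_i}$. Then for $i=1,2$, $$\frac1{\kappa_i}\int_D x\,\omega_i^\lambda(x)\,dx\longrightarrow\bar x_i\qquad\text{as }\lambda\to+\infty.$$
   Context: $D\subset\mathbb R^2$ is a bounded simply connected domain with smooth boundary; $G$ is the Green function of $-\Delta$ in $D$ with zero Dirichlet boundary condition, written $G(x,y)=\frac1{2\pi}\ln\frac1{|x-y|}-h(x,y)$, where $h$ is the regular part. Real numbers $\kappa_1>0$ and $\kappa_2<0$ are fixed, and the Kirchhoff–Routh function is $H(x_1,x_2)=-2\kappa_1\kappa_2G(x_1,x_2)+\sum_{i=1}^2\kappa_i^2h(x_i,x_i)$ for $x_1,x_2\in D$, $x_1\ne x_2$. The point $(\bar x_1,\bar x_2)\in D\times D$, $\bar x_1\neq\bar x_2$, is a strict local minimum point of $H$. A number $\delta>0$ is fixed so small that, writing $B_i=B_\delta(\bar x_i)$: $\overline{B_i}\subset D$ for $i=1,2$; $\overline{B_1}\cap\overline{B_2}=\varnothing$; and $(\bar x_1,\bar x_2)$ is the unique minimum point of $H$ in $\overline{B_1}\times\overline{B_2}$. For $\lambda>0$, $K_\lambda$ is the set of all $\omega=\omega_1+\omega_2$ with $\omega_i\in L^\infty(D)$, $0\le \mathrm{sgn}(\kappa_i)\omega_i\le\lambda$ a.e., $\int_D\omega_i=\kappa_i$, and $\omega_i$ supported in $B_i$ (meaning $\omega_i=0$ a.e. in $D\setminus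 B_i$), $i=1,2$. The kinetic energy is $E(\omega)=\frac12\int_D\int_DG(x,y)\omega(x)\omega(y)\,dx\,dy$. A maximizer $\omega^\lambda$ of $E$ over $K_\lambda$ exists whenever $K_\lambda\neq\varnothing$. $I_A$ denotes the characteristic function of $A$. Put $\psi^\lambda(x)=\int_DG(x,y)\omega^\lambda(y)\,dy$. If $\lambda\pi\delta^2>\max(|\kappa_1|,|\kappa_2|)$, every maximizer $\omega^\lambda$ of $E$ over $K_\lambda$ satisfies $\omega^\lambda I_{B_i}=\mathrm{sgn}(\kappa_i)\lambda I_{\Omega_i}$ a.e. with $\Omega_i=\{\mathrm{sgn}(\kappa_i)\psi^\lambda>\mu_i^\lambda\}\cap B_i$ for uniquely determined real numbers $\mu_i^\lambda$, $i=1,2$. The number $\delta$ is moreover chosen so small that $\mu_1^\lambda>0$ and $\mu_2^\lambda>0$ for every maximizer $\omega^\lambda$ and all sufficiently large $\lambda$ (such a choice is possible). *)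

theory Defs
  imports "HOL-Analysis.Analysis"
begin

section \<open>Planar domains with smooth boundary\<close>

text \<open>Near each of its points the boundary is, in suitable Cartesian coordinates, the graph of a
  \<open>C\<^sup>\<infinity>\<close> function of one variable, and the set lies on one side of that graph.\<close>

definition smooth_boundary :: "(real ^ 2) set \<Rightarrow> bool" where
  "smooth_boundary D \<longleftrightarrow>
     (\<forall>p \<in> frontier D. \<exists>r > 0. \<exists>e1 e2. norm e1 = 1 \<and> norm e2 = 1 \<and> e1 \<bullet> e2 = 0 \<and>
        (\<exists>\<gamma> :: real \<Rightarrow> real. (\<forall>n t. (deriv ^^ n) \<gamma> differentiable (at t)) \<and>
           D \<inter> ball p r = {x \<in> ball p r. \<gamma> (x \<bullet> e1) < x \<bullet> e2}))"

definition smooth_planar_domain :: "(real ^ 2) set \<Rightarrow> bool" where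
  "smooth_planar_domain D \<longleftrightarrow>
     D \<noteq> {} \<and> open D \<and> bounded D \<and> simply_connected D \<and> smooth_boundary D"

section \<open>Green function of the negative Laplacian\<close>

definition harmonic_on :: "('a::euclidean_space \<Rightarrow> real) \<Rightarrow> 'a set \<Rightarrow> bool" where
  "harmonic_on u S \<longleftrightarrow>
     (\<exists>(u' :: 'a \<Rightarrow> 'a \<Rightarrow>\<^sub>L real) (u'' :: 'a \<Rightarrow> 'a \<Rightarrow>\<^sub>L ('a \<Rightarrow>\<^sub>L real)).
        (\<forall>x \<in> S. (u has_derivative blinfun_apply (u' x)) (at x)) \<and>
        (\<forall>x \<in> S. (u' has_derivative blinfun_apply (u'' x)) (at x)) \<and>
        continuous_on S u'' \<and>
        (\<forall>x \<in> S. (\<Sum>b \<in> Basis. blinfun_apply (blinfun_apply (u'' x) b) b) = 0))"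

text \<open>\<open>G\<close> is the Green function of the negative Laplacian in \<open>D\<close> with zero Dirichlet boundary
  values, and \<open>h\<close> is its regular part. By the maximum principle this determines \<open>h\<close> on
  \<open>closure D \<times> D\<close>, and \<open>G\<close> there off the diagonal. The value of \<open>G\<close> on the diagonal is left open.\<close>

definition green_function ::
    "(real ^ 2) set \<Rightarrow> (real ^ 2 \<Rightarrow> real ^ 2 \<Rightarrow> real) \<Rightarrow> (real ^ 2 \<Rightarrow> real ^ 2 \<Rightarrow> real) \<Rightarrow> bool" where
  "green_function D G h \<longleftrightarrow>
     (\<forall>y \<in> D.
        (\<forall>x \<in> closure D - {y}. G x y = 1 / (2 * pi) * ln (1 / norm (x - y)) - h x y) \<and>
        harmonic_on (\<lambda>x. h x y) D \<and>
        continuous_on (closure D) (\<lambda>x. h x y) \<and>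
        (\<forall>x \<in> frontier D. G x y = 0))"

definition kirchhoff_routh ::
    "(real ^ 2 \<Rightarrow> real ^ 2 \<Rightarrow> real) \<Rightarrow> (real ^ 2 \<Rightarrow> real ^ 2 \<Rightarrow> real) \<Rightarrow> real \<Rightarrow> real
      \<Rightarrow> (real ^ 2) \<times> (real ^ 2) \<Rightarrow> real" where
  "kirchhoff_routh G h \<kappa>1 \<kappa>2 =
     (\<lambda>(x1, x2). - 2 * \<kappa>1 * \<kappa>2 * G x1 x2 + (\<kappa>1\<^sup>2 * h x1 x1 + \<kappa>2\<^sup>2 * h x2 x2))"

section \<open>Energy maximization\<close>

text \<open>Elements of \<open>L\<^sup>\<infinity>(D)\<close> are represented by functions on the plane whose values outside
  \<open>D\<close> are irrelevant; equality of elements is equality almost everywhere in \<open>D\<close>.\<close>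

definition L_infinity :: "(real ^ 2) set \<Rightarrow> (real ^ 2 \<Rightarrow> real) set" where
  "L_infinity D =
     {f \<in> borel_measurable (lebesgue_on D). \<exists>C. AE x in lebesgue_on D. \<bar>f x\<bar> \<le> C}"

definition vortex_component ::
    "(real ^ 2) set \<Rightarrow> real \<Rightarrow> real \<Rightarrow> (real ^ 2) set \<Rightarrow> (real ^ 2 \<Rightarrow> real) set" where
  "vortex_component D l \<kappa> B =
     {f \<in> L_infinity D.
        (AE x in lebesgue_on D. 0 \<le> sgn \<kappa> * f x \<and> sgn \<kappa> * f x \<le> l) \<and>
        integral\<^sup>L (lebesgue_on D) f = \<kappa> \<and>
        (AE x in lebesgue_on D. x \<notin> B \<longrightarrow> f x = 0)}"

definition admissible ::
    "(real ^ 2) set \<Rightarrow> real \<Rightarrow> real \<Rightarrow> (real ^ 2) set \<Rightarrow> real \<Rightarrow> (real ^ 2) set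
      \<Rightarrow> (real ^ 2 \<Rightarrow> real) set" where
  "admissible D l \<kappa>1 B1 \<kappa>2 B2 =
     {\<omega> \<in> L_infinity D.
        \<exists>\<omega>1 \<in> vortex_component D l \<kappa>1 B1. \<exists>\<omega>2 \<in> vortex_component D l \<kappa>2 B2.
          AE x in lebesgue_on D. \<omega> x = \<omega>1 x + \<omega>2 x}"

definition kinetic_energy ::
    "(real ^ 2) set \<Rightarrow> (real ^ 2 \<Rightarrow> real ^ 2 \<Rightarrow> real) \<Rightarrow> (real ^ 2 \<Rightarrow> real) \<Rightarrow> real" where
  "kinetic_energy D G \<omega> =
     1 / 2 * (LINT y|lebesgue_on D. LINT x|lebesgue_on D. G x y * \<omega> x * \<omega> y)"

definition energy_maximizer ::
    "(real ^ 2) set \<Rightarrow> (real ^ 2 \<Rightarrow> real ^ 2 \<Rightarrow> real) \<Rightarrow> (real ^ 2 \<Rightarrow> real) set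
      \<Rightarrow> (real ^ 2 \<Rightarrow> real) \<Rightarrow> bool" where
  "energy_maximizer D G K \<omega> \<longleftrightarrow>
     \<omega> \<in> K \<and> (\<forall>\<omega>' \<in> K. kinetic_energy D G \<omega>' \<le> kinetic_energy D G \<omega>)"

definition stream_function ::
    "(real ^ 2) set \<Rightarrow> (real ^ 2 \<Rightarrow> real ^ 2 \<Rightarrow> real) \<Rightarrow> (real ^ 2 \<Rightarrow> real) \<Rightarrow> real ^ 2 \<Rightarrow> real" where
  "stream_function D G \<omega> x = (LINT y|lebesgue_on D. G x y * \<omega> y)"

text \<open>The part of \<open>\<omega>\<close> in \<open>B\<close> is the vortex patch cut out by the level \<open>\<mu>\<close> of the stream
  function. A maximizer has exactly one such level in each of its two balls once \<open>l\<close> is large.\<close>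

definition patch_level ::
    "(real ^ 2) set \<Rightarrow> (real ^ 2 \<Rightarrow> real ^ 2 \<Rightarrow> real) \<Rightarrow> real \<Rightarrow> real \<Rightarrow> (real ^ 2) set
      \<Rightarrow> (real ^ 2 \<Rightarrow> real) \<Rightarrow> real \<Rightarrow> bool" where
  "patch_level D G l \<kappa> B \<omega> \<mu> \<longleftrightarrow>
     (AE x in lebesgue_on D.
        \<omega> x * indicator B x =
        sgn \<kappa> * l * indicator ({z. sgn \<kappa> * stream_function D G \<omega> z > \<mu>} \<inter> B) x)"

end

(* Split the energy of a maximizer into the logarithmic self-energies of its two components, which
   are invariant under translation, and a remainder with continuous kernels, which tends to
   H(a_1, a_2) / 2 up to sign when the components concentrate at a_1 and a_2. Comparison with two
   discs shows that each self-energy is at least kappa_i^2 ln(lambda) / (8 pi) - O(1) in E. Since a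
   density bounded by lambda cannot exceed this order, all but O(1 / ln lambda) of the mass of a
   component lies in a ball of fixed small radius. Cutting off the rest, restoring the mass by a
   slight dilation and moving the result to the minimum point of H costs only o(1) of self-energy,
   so optimality forces H(a_1, a_2) <= H(xbar_1, xbar_2) + o(1), and uniqueness of the minimum
   gives a_i -> xbar_i. No rearrangement inequality is needed. The comparison with H needs the
   symmetry of G, which comes from the Riemann map. *)

theory Submission
  imports Defs "HOL-Complex_Analysis.Complex_Analysis"
begin

section \<open>The weak maximum principle\<close>

text \<open>The delicate point is the order in \<open>ln l\<close>. A core of radius about
  \<open>1 / sqrt l\<close> contributes \<open>ln l / 2\<close> per unit of mass placed near it, so
  discarding a mass m of order \<open>1 / ln l\<close> might change the self-energy by a constant
  and swamp the comparison with H. Two radii prevent this: mass beyond \<open>r\<close> stays at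
  distance at least \<open>r / 2\<close> from the core inside \<open>r / 2\<close>, so their
  interaction is bounded by O(m), and its interaction with the mass outside \<open>r / 2\<close> is
  bounded by O(m + m^2 ln l). Both bounds tend to 0.

  \<open>green_function\<close> poses, for each pole, a boundary value problem in the first argument
  alone; symmetry and joint continuity must be derived. Writing G as minus the logarithm of the
  modulus of a Blaschke factor of the Riemann map, divided by 2 pi, makes symmetry visible and
  replaces Green's identity, which would call for derivatives of G up to the boundary. Joint
  continuity of h comes from comparing the boundary values for two nearby poles. Both arguments rest
  on the weak maximum principle.\<close>

lemma second_derivative_nonpos_at_max:
  fixes f f' :: "real \<Rightarrow> real"
  assumes "r > 0"
    and f: "\<And>t. \<bar>t\<bar> < r \<Longrightarrow> (f has_real_derivative f' t) (at t)"
    and f': "(f' has_real_derivative c) (at 0)"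
    and max: "\<And>t. \<bar>t\<bar> < r \<Longrightarrow> f t \<le> f 0"
  shows "c \<le> 0"
proof (rule ccontr)
  assume "\<not> c \<le> 0"
  then have "c > 0" by simp
  have "f' 0 = 0"
    using DERIV_local_max[of f "f' 0" 0 r] f[of 0] max \<open>r > 0\<close> by simp
  obtain d where d: "d > 0" "\<And>h. 0 < h \<Longrightarrow> h < d \<Longrightarrow> f' 0 < f' h"
    using DERIV_pos_inc_right[OF f' \<open>c > 0\<close>] by auto
  define h where "h = min d r / 2"
  have h: "0 < h" "h < d" "h < r"
    using d(1) \<open>r > 0\<close> by (auto simp: h_def)
  obtain z where z: "0 < z" "z < h" "f h - f 0 = (h - 0) * f' z"
    using MVT2[of 0 h f f'] f h by fastforce
  have "f' z > 0"
    using d(2)[of z] z h \<open>f' 0 = 0\<close> by simp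
  then have "f h - f 0 > 0"
    using z(3) h(1) by simp
  with max[of h] h show False by simp
qed

text \<open>Only the second derivatives along the coordinate axes are required: this is all the maximum
  principle uses, and the real part of a holomorphic function has it without second Frechet
  derivatives.\<close>

definition coordinate_harmonic_on :: "('a::euclidean_space \<Rightarrow> real) \<Rightarrow> 'a set \<Rightarrow> bool" where
  "coordinate_harmonic_on u S \<longleftrightarrow> continuous_on S u \<and>
     (\<exists>d e. \<forall>x\<in>S. (\<forall>b\<in>Basis. ((\<lambda>t. u (x + t *\<^sub>R b)) has_real_derivative d b x) (at 0) \<and>
        ((\<lambda>t. d b (x + t *\<^sub>R b)) has_real_derivative e b x) (at 0)) \<and> (\<Sum>b\<in>Basis. e b x) = 0)"

lemma harmonic_on_imp_coordinate_harmonic_on: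
  assumes "harmonic_on u S"
  shows "coordinate_harmonic_on u S"
proof -
  obtain u' u'' where u': "\<And>x. x \<in> S \<Longrightarrow> (u has_derivative blinfun_apply (u' x)) (at x)"
    and u'': "\<And>x. x \<in> S \<Longrightarrow> (u' has_derivative blinfun_apply (u'' x)) (at x)"
    and lap: "\<And>x. x \<in> S \<Longrightarrow> (\<Sum>b\<in>Basis. blinfun_apply (blinfun_apply (u'' x) b) b) = 0"
    using assms unfolding harmonic_on_def by blast
  have cont: "continuous_on S u"
    using u' by (meson continuous_at_imp_continuous_on has_derivative_continuous)
  have "((\<lambda>t. u (x + t *\<^sub>R b)) has_real_derivative blinfun_apply (u' x) b) (at 0)"
    if "x \<in> S" for x b
  proof -
    have "((\<lambda>t. u (x + t *\<^sub>R b)) has_derivative (\<lambda>t. blinfun_apply (u' x) (t *\<^sub>R b))) (at 0)"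
      by (rule has_derivative_compose[where g = u, simplified])
         (use u'[OF that] in \<open>auto intro!: derivative_eq_intros\<close>)
    moreover have "(\<lambda>t. blinfun_apply (u' x) (t *\<^sub>R b)) = (*) (blinfun_apply (u' x) b)"
      by (simp add: fun_eq_iff blinfun.scaleR_right)
    ultimately show ?thesis
      by (simp only: has_field_derivative_def)
  qed
  moreover have "((\<lambda>t. blinfun_apply (u' (x + t *\<^sub>R b)) b) has_real_derivative
      blinfun_apply (blinfun_apply (u'' x) b) b) (at 0)" if "x \<in> S" for x b
  proof -
    have "((\<lambda>t. u' (x + t *\<^sub>R b)) has_derivative (\<lambda>t. blinfun_apply (u'' x) (t *\<^sub>R b))) (at 0)"
      by (rule has_derivative_compose[where g = u', simplified])
         (use u''[OF that] in \<open>auto intro!: derivative_eq_intros\<close>)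
    then have "((\<lambda>t. blinfun_apply (u' (x + t *\<^sub>R b)) b) has_derivative
        (\<lambda>t. blinfun_apply (blinfun_apply (u'' x) (t *\<^sub>R b)) b)) (at 0)"
      by (rule bounded_linear.has_derivative[OF blinfun.bounded_linear_left])
    moreover have "(\<lambda>t. blinfun_apply (blinfun_apply (u'' x) (t *\<^sub>R b)) b) = (*) (blinfun_apply (blinfun_apply (u'' x) b) b)"
      by (simp add: fun_eq_iff blinfun.scaleR_right blinfun.scaleR_left)
    ultimately show ?thesis
      by (simp only: has_field_derivative_def)
  qed
  ultimately show ?thesis
    unfolding coordinate_harmonic_on_def using cont lap
    by (intro conjI exI[of _ "\<lambda>b x. blinfun_apply (u' x) b"]
        exI[of _ "\<lambda>b x. blinfun_apply (blinfun_apply (u'' x) b) b"]) auto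
qed

lemma coordinate_harmonic_on_diff:
  assumes "coordinate_harmonic_on u S" "coordinate_harmonic_on v S"
  shows "coordinate_harmonic_on (\<lambda>x. u x - v x) S"
proof -
  obtain d e where d: "\<And>x b. x \<in> S \<Longrightarrow> b \<in> Basis \<Longrightarrow> ((\<lambda>t. u (x + t *\<^sub>R b)) has_real_derivative d b x) (at 0)"
    "\<And>x b. x \<in> S \<Longrightarrow> b \<in> Basis \<Longrightarrow> ((\<lambda>t. d b (x + t *\<^sub>R b)) has_real_derivative e b x) (at 0)"
    "\<And>x. x \<in> S \<Longrightarrow> (\<Sum>b\<in>Basis. e b x) = 0"
    using assms(1) unfolding coordinate_harmonic_on_def by blast
  obtain d' e' where d': "\<And>x b. x \<in> S \<Longrightarrow> b \<in> Basis \<Longrightarrow> ((\<lambda>t. v (x + t *\<^sub>R b)) has_real_derivative d' b x) (at 0)"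
    "\<And>x b. x \<in> S \<Longrightarrow> b \<in> Basis \<Longrightarrow> ((\<lambda>t. d' b (x + t *\<^sub>R b)) has_real_derivative e' b x) (at 0)"
    "\<And>x. x \<in> S \<Longrightarrow> (\<Sum>b\<in>Basis. e' b x) = 0"
    using assms(2) unfolding coordinate_harmonic_on_def by blast
  show ?thesis
    unfolding coordinate_harmonic_on_def
  proof (intro conjI exI ballI)
    show "continuous_on S (\<lambda>x. u x - v x)"
      using assms unfolding coordinate_harmonic_on_def by (intro continuous_intros) auto
  next
    fix x b assume *: "x \<in> S" "b \<in> (Basis :: 'a set)"
    show "((\<lambda>t. u (x + t *\<^sub>R b) - v (x + t *\<^sub>R b)) has_real_derivative d b x - d' b x) (at 0)"
      by (intro DERIV_diff d d' *)
    show "((\<lambda>t. d b (x + t *\<^sub>R b) - d' b (x + t *\<^sub>R b)) has_real_derivative e b x - e' b x) (at 0)"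
      by (intro DERIV_diff d d' *)
  next
    fix x assume "x \<in> S"
    then show "(\<Sum>b\<in>Basis. e b x - e' b x) = 0"
      by (simp add: sum_subtractf d d')
  qed
qed

text \<open>At a maximum every axis-wise second derivative is at most 0, but the quadratic term
  raises each of them by \<open>2 * \<eta>\<close>, so their sum is positive.\<close>

lemma strictly_subharmonic_no_max:
  fixes u :: "'a::euclidean_space \<Rightarrow> real"
  assumes "open S" "coordinate_harmonic_on u S" "\<eta> > 0" "z \<in> S"
  shows "\<exists>x\<in>S. u z + \<eta> * (norm z)\<^sup>2 < u x + \<eta> * (norm x)\<^sup>2"
proof (rule ccontr)
  assume "\<not> ?thesis"
  then have max: "u x + \<eta> * (norm x)\<^sup>2 \<le> u z + \<eta> * (norm z)\<^sup>2" if "x \<in> S" for x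
    using that by force
  obtain d e where d: "\<And>x b. x \<in> S \<Longrightarrow> b \<in> Basis \<Longrightarrow> ((\<lambda>t. u (x + t *\<^sub>R b)) has_real_derivative d b x) (at 0)"
    and e: "\<And>x b. x \<in> S \<Longrightarrow> b \<in> Basis \<Longrightarrow> ((\<lambda>t. d b (x + t *\<^sub>R b)) has_real_derivative e b x) (at 0)"
    and lap: "\<And>x. x \<in> S \<Longrightarrow> (\<Sum>b\<in>Basis. e b x) = 0"
    using assms(2) unfolding coordinate_harmonic_on_def by blast
  obtain r where r: "r > 0" "ball z r \<subseteq> S"
    using assms open_contains_ball by blast
  have "e b z + 2 * \<eta> \<le> 0" if b: "b \<in> Basis" for b
  proof (rule second_derivative_nonpos_at_max[OF r(1)])
    fix t :: real assume t: "\<bar>t\<bar> < r"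
    have inS: "z + t *\<^sub>R b \<in> S"
      using r t b by (intro subsetD[OF r(2)]) (simp add: dist_norm)
    \<comment> \<open>\<open>coordinate_harmonic_on\<close> provides derivatives at parameter 0
      only; the derivative at \<open>t\<close> is the one at 0 for the base point moved along the
      line.\<close>
    have "((\<lambda>s. u (z + (t + s) *\<^sub>R b)) has_real_derivative d b (z + t *\<^sub>R b)) (at 0)"
      using d[OF inS b] by (simp add: algebra_simps)
    then have 1: "((\<lambda>s. u (z + s *\<^sub>R b)) has_real_derivative d b (z + t *\<^sub>R b)) (at t)"
      using DERIV_shift[of "\<lambda>s. u (z + s *\<^sub>R b)" "d b (z + t *\<^sub>R b)" 0 t] by (simp add: add.commute)
    have nrm: "(norm (z + s *\<^sub>R b))\<^sup>2 = (norm z)\<^sup>2 + 2 * s * (z \<bullet> b) + s\<^sup>2" for s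
      using b unfolding power2_norm_eq_inner
      by (simp add: inner_add_left inner_add_right inner_commute[of b z] power2_eq_square
          distrib_left)
    show "((\<lambda>s. u (z + s *\<^sub>R b) + \<eta> * (norm (z + s *\<^sub>R b))\<^sup>2) has_real_derivative
        d b (z + t *\<^sub>R b) + \<eta> * (2 * (z \<bullet> b) + 2 * t)) (at t)"
      unfolding nrm by (rule derivative_eq_intros 1 refl | simp)+
    show "u (z + t *\<^sub>R b) + \<eta> * (norm (z + t *\<^sub>R b))\<^sup>2 \<le> u (z + 0 *\<^sub>R b) + \<eta> * (norm (z + 0 *\<^sub>R b))\<^sup>2"
      using max[OF inS] by simp
  next
    show "((\<lambda>t. d b (z + t *\<^sub>R b) + \<eta> * (2 * (z \<bullet> b) + 2 * t)) has_real_derivative e b z + 2 * \<eta>) (at 0)"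
      by (rule derivative_eq_intros e[OF assms(4) b] refl | simp)+
  qed
  then have "(\<Sum>b\<in>(Basis::'a set). e b z + 2 * \<eta>) \<le> 0"
    by (intro sum_nonpos) auto
  moreover have "(\<Sum>b\<in>(Basis::'a set). e b z + 2 * \<eta>) > 0"
    using lap[OF assms(4)] assms(3) by (simp add: sum.distrib)
  ultimately show False by simp
qed

text \<open>Boundary values enter only as an upper bound for limits from inside, which suits
  functions defined just on S. That bound keeps a superlevel set of the perturbed function away from
  the frontier, so it is compact and a maximum is attained inside, contrary to strict
  subharmonicity.\<close>

lemma weak_maximum_principle:
  fixes u :: "'a::euclidean_space \<Rightarrow> real"
  assumes S: "open S" "bounded S" and u: "coordinate_harmonic_on u S"
    and bd: "\<And>z e. z \<in> frontier S \<Longrightarrow> e > 0 \<Longrightarrow> \<forall>\<^sub>F x in at z within S. u x < c + e"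
    and x0: "x0 \<in> S"
  shows "u x0 \<le> c"
proof (rule ccontr)
  assume "\<not> u x0 \<le> c"
  define e where "e = (u x0 - c) / 2"
  have e: "e > 0" "u x0 = c + 2 * e"
    using \<open>\<not> u x0 \<le> c\<close> by (auto simp: e_def field_simps)
  obtain R where R: "R > 0" "\<And>x. x \<in> S \<Longrightarrow> norm x \<le> R"
    using S(2) bounded_pos by blast
  \<comment> \<open>With this choice the perturbation is at most \<open>e\<close> on S, half of the
    excess \<open>u x0 - c\<close>. Points of the superlevel set therefore satisfy
    \<open>u x \<ge> c + e\<close>, which the boundary hypothesis excludes near the
    frontier.\<close>
  define \<eta> where "\<eta> = e / R\<^sup>2"
  have \<eta>: "\<eta> > 0" "\<And>x. x \<in> S \<Longrightarrow> \<eta> * (norm x)\<^sup>2 \<le> e"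
  proof -
    show "\<eta> > 0" using e R by (simp add: \<eta>_def)
    fix x assume "x \<in> S"
    then have "\<eta> * (norm x)\<^sup>2 \<le> \<eta> * R\<^sup>2"
      using \<open>\<eta> > 0\<close> R by (intro mult_left_mono power_mono) auto
    then show "\<eta> * (norm x)\<^sup>2 \<le> e" using R by (simp add: \<eta>_def)
  qed
  define v where "v x = u x + \<eta> * (norm x)\<^sup>2" for x
  have contv: "continuous_on S v"
    using u unfolding v_def coordinate_harmonic_on_def by (intro continuous_intros) auto
  define A where "A = {x\<in>S. v x0 \<le> v x}"
  have "closed A"
    unfolding closed_limpt
  proof (intro allI impI)
    fix z assume z: "z islimpt A"
    have "z \<in> closure S"
      using z by (metis (no_types, lifting) A_def Un_iff closure_def islimpt_subset mem_Collect_eq subsetI)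
    have nt: "at z within A \<noteq> bot"
      using z trivial_limit_within by blast
    have sub: "A \<subseteq> S" by (auto simp: A_def)
    have "z \<in> S"
    proof (rule ccontr)
      assume "z \<notin> S"
      then have "z \<in> frontier S"
        using \<open>z \<in> closure S\<close> S(1) by (simp add: frontier_def interior_open)
      then have "\<forall>\<^sub>F x in at z within S. u x < c + e"
        using bd e by blast
      then have "\<forall>\<^sub>F x in at z within A. u x < c + e"
        using sub by (meson at_le filter_leD)
      moreover have "\<forall>\<^sub>F x in at z within A. x \<in> A"
        by (simp add: eventually_at_topological) blast
      ultimately have "\<forall>\<^sub>F x in at z within A. False"
      proof eventually_elim
        case (elim x)
        then have "u x0 \<le> v x0" "v x0 \<le> v x" "v x \<le> u x + e"
          using \<eta> x0 by (auto simp: A_def v_def)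
        with elim e show ?case by simp
      qed
      then show False using nt by simp
    qed
    moreover have "v x0 \<le> v z"
    proof (rule tendsto_lowerbound[OF _ _ nt])
      show "(v \<longlongrightarrow> v z) (at z within A)"
        using contv \<open>z \<in> S\<close> sub by (meson continuous_on_def tendsto_within_subset)
      show "\<forall>\<^sub>F x in at z within A. v x0 \<le> v x"
        by (auto simp: eventually_at_topological A_def)
    qed
    ultimately show "z \<in> A" by (simp add: A_def)
  qed
  moreover have "bounded A"
    using S(2) by (rule bounded_subset) (auto simp: A_def)
  ultimately have "compact A" by (simp add: compact_eq_bounded_closed)
  moreover have "A \<noteq> {}" using x0 by (auto simp: A_def)
  moreover have "continuous_on A v"
    using contv by (rule continuous_on_subset) (auto simp: A_def)
  ultimately obtain z where z: "z \<in> A" "\<And>x. x \<in> A \<Longrightarrow> v x \<le> v z"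
    using continuous_attains_sup[of A v] by blast
  have "z \<in> S" using z by (simp add: A_def)
  then obtain x where "x \<in> S" "v z < v x"
    using strictly_subharmonic_no_max[OF S(1) u \<eta>(1)] unfolding v_def by blast
  moreover from this have "x \<in> A" using z(1) by (auto simp: A_def)
  ultimately show False using z(2)[of x] by simp
qed

lemma harmonic_on_diff_le:
  fixes u v :: "'a::euclidean_space \<Rightarrow> real"
  assumes S: "open S" "bounded S" and h: "harmonic_on u S" "harmonic_on v S"
    and c: "continuous_on (closure S) u" "continuous_on (closure S) v"
    and bd: "\<And>x. x \<in> frontier S \<Longrightarrow> u x - v x \<le> c" and x: "x \<in> closure S"
  shows "u x - v x \<le> c"
proof (cases "x \<in> S")
  case False
  then show ?thesis using x S bd by (simp add: frontier_def interior_open)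
next
  case True
  show ?thesis
  proof (rule weak_maximum_principle[OF S _ _ True])
    show "coordinate_harmonic_on (\<lambda>x. u x - v x) S"
      by (intro coordinate_harmonic_on_diff harmonic_on_imp_coordinate_harmonic_on h)
    fix z and e :: real assume z: "z \<in> frontier S" "e > 0"
    have "z \<in> closure S"
      using z by (simp add: frontier_def)
    then have "((\<lambda>x. u x - v x) \<longlongrightarrow> u z - v z) (at z within closure S)"
      using continuous_on_diff[OF c] by (simp only: continuous_on_def)
    then have "((\<lambda>x. u x - v x) \<longlongrightarrow> u z - v z) (at z within S)"
      by (rule tendsto_within_subset) (rule closure_subset)
    then show "\<forall>\<^sub>F x in at z within S. u x - v x < c + e"
      using bd[OF z(1)] z(2) by (intro order_tendstoD(2)) auto
  qed
qed

section \<open>Symmetry and continuity of the Green function\<close>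

definition plane_complex :: "real ^ 2 \<Rightarrow> complex" where
  "plane_complex x = Complex (x $ 1) (x $ 2)"

lemma linear_plane_complex: "linear plane_complex"
  by (rule linearI) (auto simp: plane_complex_def complex_eq_iff)

lemma norm_plane_complex [simp]: "cmod (plane_complex x) = norm x"
  by (simp add: plane_complex_def cmod_def norm_vec_def L2_set_def sum_2)

lemma plane_complex_diff: "plane_complex (x - y) = plane_complex x - plane_complex y"
  using linear_plane_complex by (rule linear_diff)

lemma bounded_linear_plane_complex: "bounded_linear plane_complex"
  using linear_plane_complex by (simp add: linear_conv_bounded_linear)

lemma bij_plane_complex: "bij plane_complex"
proof (rule bijI)
  show "inj plane_complex"
    by (auto simp: inj_def plane_complex_def vec_eq_iff forall_2)
  show "surj plane_complex"
    unfolding surj_def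
  proof
    fix z :: complex
    show "\<exists>x. z = plane_complex x"
      by (rule exI[of _ "vector [Re z, Im z]"]) (simp add: plane_complex_def)
  qed
qed

lemma plane_complex_eq_iff [simp]: "plane_complex x = plane_complex y \<longleftrightarrow> x = y"
  using bij_plane_complex by (auto simp: bij_def inj_def)

lemma linear_inv_plane_complex: "linear (inv plane_complex)"
  using bij_plane_complex linear_plane_complex
  by (intro linearI inv_f_eq) (auto simp: bij_def linear_add linear_scale surj_f_inv_f)

lemma open_plane_complex_image: "open S \<Longrightarrow> open (plane_complex ` S)"
  using linear_plane_complex bij_plane_complex by (intro open_surjective_linear_image) (auto simp: bij_def)

lemma simply_connected_plane_complex_image:
  assumes "simply_connected S" shows "simply_connected (plane_complex ` S)"
proof -
  have "S homeomorphic plane_complex ` S"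
    using linear_plane_complex bij_plane_complex
    by (intro linear_homeomorphic_image) (auto simp: bij_def)
  then show ?thesis using assms homeomorphic_simply_connected_eq by blast
qed

lemma sum_Basis_plane: "(\<Sum>b\<in>(Basis :: (real ^ 2) set). F b) = F (axis 1 1) + F (axis 2 1)"
proof -
  have 1: "(Basis :: (real ^ 2) set) = {axis 1 1, axis 2 1}"
    by (auto simp: Basis_vec_def UNIV_2)
  have 2: "axis 1 1 \<noteq> (axis 2 1 :: real ^ 2)"
    by (simp add: axis_eq_axis)
  show ?thesis
    unfolding 1 by (subst sum.insert) (use 2 in auto)
qed

text \<open>Differentiating along \<open>b\<close> multiplies the complex derivative by
  \<open>plane_complex b\<close>. The two axes become 1 and i, whose squares cancel in the
  Laplacian.\<close>

lemma coordinate_harmonic_on_Re_holomorphic: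
  assumes S: "open S" and f: "f holomorphic_on plane_complex ` S"
  shows "coordinate_harmonic_on (\<lambda>x. Re (f (plane_complex x))) S"
proof -
  let ?c = plane_complex
  have oc: "open (?c ` S)" using S by (rule open_plane_complex_image)
  \<comment> \<open>The factor \<open>k\<close> lets one computation serve both orders: it is 1 for
    the first derivative and \<open>plane_complex b\<close> for the second.\<close>
  have along: "((\<lambda>t. Re (k * g (?c (x + t *\<^sub>R b)))) has_real_derivative Re (k * ?c b * deriv g (?c x))) (at 0)"
    if g: "g holomorphic_on ?c ` S" and x: "x \<in> S" for g x b k
  proof -
    have "(g has_field_derivative deriv g (?c x)) (at (?c x + of_real 0 * ?c b))"
      using holomorphic_derivI[OF g oc] x by simp
    then have "((\<lambda>t. k * g (?c x + of_real t * ?c b)) has_vector_derivative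
        k * (1 * ?c b * deriv g (?c x))) (at (0::real))"
      by (intro derivative_intros field_vector_diff_chain_at[where g = g, unfolded o_def]
            has_vector_derivative_mult_right)
         (auto intro!: derivative_eq_intros)
    moreover have "?c (x + t *\<^sub>R b) = ?c x + of_real t * ?c b" for t
      by (simp add: linear_add[OF linear_plane_complex] linear_scale[OF linear_plane_complex]
          scaleR_conv_of_real[of t "?c b"])
    ultimately show ?thesis
      using bounded_linear.has_vector_derivative[OF bounded_linear_Re]
      by (simp only: has_real_derivative_iff_has_vector_derivative mult.assoc mult_1_left)
  qed
  have f': "deriv f holomorphic_on ?c ` S"
    using f oc by (rule holomorphic_deriv)
  show ?thesis
    unfolding coordinate_harmonic_on_def
  proof (intro conjI exI ballI)
    show "continuous_on S (\<lambda>x. Re (f (?c x)))"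
      by (intro continuous_on_Re continuous_on_compose2[OF holomorphic_on_imp_continuous_on[OF f]]
          linear_continuous_on bounded_linear_plane_complex) auto
  next
    fix x b assume *: "x \<in> S" "b \<in> (Basis :: (real ^ 2) set)"
    show "((\<lambda>t. Re (f (?c (x + t *\<^sub>R b)))) has_real_derivative Re (?c b * deriv f (?c x))) (at 0)"
      using along[OF f, of x 1 b] * by simp
    show "((\<lambda>t. Re (?c b * deriv f (?c (x + t *\<^sub>R b)))) has_real_derivative
        Re (?c b * ?c b * deriv (deriv f) (?c x))) (at 0)"
      using along[OF f', of x "?c b" b] * by simp
  next
    fix x assume "x \<in> S"
    show "(\<Sum>b\<in>Basis. Re (?c b * ?c b * deriv (deriv f) (?c x))) = 0"
      unfolding sum_Basis_plane by (simp add: plane_complex_def axis_def)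
  qed
qed

section \<open>Blaschke factors and boundary behaviour of the Riemann map\<close>

lemma blaschke_norm_identity:
  "(cmod (1 - cnj a * w))\<^sup>2 - (cmod (w - a))\<^sup>2 = (1 - (cmod a)\<^sup>2) * (1 - (cmod w)\<^sup>2)"
  unfolding cmod_power2 by (simp add: power2_eq_square algebra_simps)

text \<open>Only the modulus of \<open>f\<close> is known to converge. By the norm identity, 1 minus
  the squared modulus of the Blaschke factor is a multiple of 1 minus the squared modulus of
  \<open>f\<close>, and the denominator stays above \<open>(1 - cmod a)\<^sup>2\<close>.\<close>

lemma tendsto_blaschke_norm:
  assumes a: "cmod a < 1" and w: "((\<lambda>x. cmod (f x)) \<longlongrightarrow> 1) F"
    and le: "\<forall>\<^sub>F x in F. cmod (f x) < 1"
  shows "((\<lambda>x. cmod ((f x - a) / (1 - cnj a * f x))) \<longlongrightarrow> 1) F"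
proof -
  have *: "1 - (1 - (cmod w)\<^sup>2) / (1 - cmod a)\<^sup>2 \<le> (cmod ((w - a) / (1 - cnj a * w)))\<^sup>2 \<and>
      (cmod ((w - a) / (1 - cnj a * w)))\<^sup>2 \<le> 1" if w: "cmod w < 1" for w
  proof -
    have "cmod (cnj a * w) \<le> cmod a"
      using w by (simp add: norm_mult mult_left_le)
    then have le: "1 - cmod a \<le> cmod (1 - cnj a * w)"
      using norm_triangle_ineq2[of 1 "cnj a * w"] by simp
    have pos: "(1 - cmod a)\<^sup>2 > 0" "(cmod (1 - cnj a * w))\<^sup>2 > 0"
      using le a by auto
    have eq: "(cmod ((w - a) / (1 - cnj a * w)))\<^sup>2 =
        1 - (1 - (cmod a)\<^sup>2) * (1 - (cmod w)\<^sup>2) / (cmod (1 - cnj a * w))\<^sup>2"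
      using blaschke_norm_identity[of a w] pos(2)
      by (simp add: norm_divide power_divide field_simps)
    have nn: "0 \<le> 1 - (cmod a)\<^sup>2" "1 - (cmod a)\<^sup>2 \<le> 1" "0 \<le> 1 - (cmod w)\<^sup>2"
      using a w by (auto simp: power_le_one)
    have "(1 - (cmod a)\<^sup>2) * (1 - (cmod w)\<^sup>2) / (cmod (1 - cnj a * w))\<^sup>2
        \<le> 1 * (1 - (cmod w)\<^sup>2) / (1 - cmod a)\<^sup>2"
      using nn pos le a by (intro frac_le mult_right_mono power_mono mult_nonneg_nonneg) auto
    moreover have "0 \<le> (1 - (cmod a)\<^sup>2) * (1 - (cmod w)\<^sup>2) / (cmod (1 - cnj a * w))\<^sup>2"
      using nn by simp
    ultimately show ?thesis unfolding eq by simp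
  qed
  have "((\<lambda>x. (cmod ((f x - a) / (1 - cnj a * f x)))\<^sup>2) \<longlongrightarrow> 1) F"
  proof (rule tendsto_sandwich)
    have "((\<lambda>x. 1 - (1 - (cmod (f x))\<^sup>2) / (1 - cmod a)\<^sup>2) \<longlongrightarrow> 1 - (1 - 1\<^sup>2) / (1 - cmod a)\<^sup>2) F"
      by (intro tendsto_diff tendsto_divide tendsto_const tendsto_power w) (use a in auto)
    then show "((\<lambda>x. 1 - (1 - (cmod (f x))\<^sup>2) / (1 - cmod a)\<^sup>2) \<longlongrightarrow> 1) F"
      by simp
    show "\<forall>\<^sub>F x in F. 1 - (1 - (cmod (f x))\<^sup>2) / (1 - cmod a)\<^sup>2 \<le> (cmod ((f x - a) / (1 - cnj a * f x)))\<^sup>2"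
      using le by eventually_elim (use * in blast)
    show "\<forall>\<^sub>F x in F. (cmod ((f x - a) / (1 - cnj a * f x)))\<^sup>2 \<le> 1"
      using le by eventually_elim (use * in blast)
  qed simp
  from tendsto_real_sqrt[OF this] show ?thesis by simp
qed

text \<open>Properness: the image of a smaller closed disc under \<open>g\<close> is a compact
  subset of S, so a frontier point has a neighbourhood that misses it, and there \<open>f\<close>
  leaves the disc. Continuity of \<open>f\<close> up to the boundary is not claimed, only
  convergence of its modulus.\<close>

lemma homeomorphism_tends_to_boundary:
  fixes S :: "'a::t2_space set" and f :: "'a \<Rightarrow> complex"
  assumes S: "open S" and f: "\<And>z. z \<in> S \<Longrightarrow> f z \<in> ball 0 1 \<and> g (f z) = z"
    and g: "continuous_on (ball 0 1) g" "g ` ball 0 1 \<subseteq> S"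
    and z: "z \<in> frontier S"
  shows "((\<lambda>z. cmod (f z)) \<longlongrightarrow> 1) (at z within S)"
proof (rule order_tendstoI)
  fix r :: real assume r: "r < 1"
  have "compact (g ` cball 0 r)"
    using r by (intro compact_continuous_image continuous_on_subset[OF g(1)] compact_cball) auto
  then have "closed (g ` cball 0 r)" by (simp add: compact_imp_closed)
  moreover have "z \<notin> g ` cball 0 r"
  proof -
    have "cball 0 r \<subseteq> ball (0 :: complex) 1" using r by auto
    then have "g ` cball 0 r \<subseteq> S" using g(2) by blast
    moreover have "z \<notin> S" using z S by (simp add: frontier_def interior_open)
    ultimately show ?thesis by blast
  qed
  ultimately have "\<forall>\<^sub>F w in nhds z. w \<in> - g ` cball 0 r"
    by (intro eventually_nhds_in_open) auto
  then have "\<forall>\<^sub>F w in at z within S. w \<notin> g ` cball 0 r"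
    by (auto simp: eventually_at_filter elim: eventually_mono)
  moreover have "\<forall>\<^sub>F w in at z within S. w \<in> S"
    by (auto simp: eventually_at_filter)
  ultimately show "\<forall>\<^sub>F w in at z within S. r < cmod (f w)"
  proof eventually_elim
    case (elim w)
    then show ?case using f[of w] by (metis imageI linorder_not_less mem_cball_0)
  qed
next
  fix r :: real assume r: "1 < r"
  have "\<forall>\<^sub>F w in at z within S. w \<in> S"
    by (auto simp: eventually_at_filter)
  then show "\<forall>\<^sub>F w in at z within S. cmod (f w) < r"
    by eventually_elim (use f r in force)
qed

text \<open>The Blaschke factor \<open>m\<close> has a simple zero at the pole and no other.
  Dividing it out leaves a zero-free function on a simply connected set, which has a holomorphic
  logarithm \<open>L\<close>; so \<open>ln (cmod m)\<close> minus the logarithm of the distance to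
  the pole extends harmonically across the pole. Comparing its multiple with \<open>h\<close> gives
  a harmonic function with boundary limit 0.\<close>

lemma green_function_conformal:
  assumes D: "open D" "bounded D" "simply_connected D" "D \<noteq> {}" and green: "green_function D G h"
  obtains \<phi> :: "real ^ 2 \<Rightarrow> complex" where
    "\<And>x y. x \<in> D \<Longrightarrow> y \<in> D \<Longrightarrow> x \<noteq> y \<Longrightarrow>
       G x y = - ln (cmod ((\<phi> x - \<phi> y) / (1 - cnj (\<phi> y) * \<phi> x))) / (2 * pi)"
proof -
  let ?c = plane_complex
  let ?S = "?c ` D"
  have S: "open ?S" "simply_connected ?S"
    using D by (auto intro: open_plane_complex_image simply_connected_plane_complex_image)
  have "?S \<noteq> UNIV"
  proof
    assume "?S = UNIV"
    then have "D = UNIV"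
      using bij_plane_complex by (metis bij_betw_def inj_image_eq_iff)
    then show False using D(2) not_bounded_UNIV by auto
  qed
  then obtain f g where f: "f holomorphic_on ?S" and g: "g holomorphic_on ball 0 1"
    and fg: "\<And>z. z \<in> ?S \<Longrightarrow> f z \<in> ball 0 1 \<and> g (f z) = z"
    and gf: "\<And>z. z \<in> ball 0 1 \<Longrightarrow> g z \<in> ?S \<and> f (g z) = z"
    using Riemann_mapping_theorem[of ?S] S D(4) by blast
  have inj: "inj_on f ?S" using fg by (metis inj_onI)
  have inj_c: "inj ?c" using bij_plane_complex by (simp add: bij_def)
  show thesis
  proof (rule that[of "f \<circ> ?c"])
    fix x y assume x: "x \<in> D" and y: "y \<in> D" and "x \<noteq> y"
    define a where "a = f (?c y)"
    define m where "m z = (f z - a) / (1 - cnj a * f z)" for z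
    \<comment> \<open>The value at the pole is the one that removes the singularity of the
      difference quotient. It is nonzero because an injective holomorphic map has nonvanishing
      derivative.\<close>
    define k where "k z = (if z = ?c y then deriv f (?c y) else (f z - f (?c y)) / (z - ?c y)) / (1 - cnj a * f z)" for z
    have a: "cmod a < 1" using fg[of "?c y"] y by (simp add: a_def)
    have den: "1 - cnj a * f z \<noteq> 0" if "z \<in> ?S" for z
    proof
      assume "1 - cnj a * f z = 0"
      then have "cmod (cnj a * f z) = 1" by (metis eq_iff_diff_eq_0 norm_one)
      moreover have "cmod a * cmod (f z) < 1"
        using fg[OF that] a by (metis mem_ball_0 mult_less_cancel_left2 mult_zero_left norm_ge_zero
            order.strict_trans less_le mult_le_one zero_less_one not_less mult.commute mult_left_le)
      ultimately show False by (simp add: norm_mult)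
    qed
    have k: "k holomorphic_on ?S"
      unfolding k_def using den
      by (intro holomorphic_intros pole_lemma_open f S(1)) auto
    have "k z \<noteq> 0" if "z \<in> ?S" for z
      using den[OF that] holomorphic_injective_imp_regular[OF f S(1) inj] y inj that
      by (auto simp: k_def inj_on_eq_iff)
    then obtain L where l: "L holomorphic_on ?S" "\<And>z. z \<in> ?S \<Longrightarrow> k z = exp (L z)"
      using simply_connected_eq_holomorphic_log[OF S(1)] S(2) k by metis
    have Re_l: "Re (L (?c z)) = ln (cmod (m (?c z))) - ln (norm (z - y))" if "z \<in> D" "z \<noteq> y" for z
    proof -
      have "Re (L (?c z)) = ln (cmod (k (?c z)))"
        using l(2)[of "?c z"] that by simp
      also have "cmod (k (?c z)) = cmod (m (?c z)) / norm (z - y)"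
        using that
        by (simp add: k_def m_def a_def norm_divide norm_mult flip: plane_complex_diff)
      also have "ln \<dots> = ln (cmod (m (?c z))) - ln (norm (z - y))"
      proof -
        have "m (?c z) \<noteq> 0"
          using den[of "?c z"] that y inj by (auto simp: m_def a_def inj_on_eq_iff)
        then show ?thesis using that by (simp add: ln_div)
      qed
      finally show ?thesis .
    qed
    define u where "u z = h z y - Re (L (?c z) / (2 * pi))" for z
    \<comment> \<open>This is \<open>- u\<close>. The maximum principle is one-sided, so it is run
      for both signs to obtain \<open>u x = 0\<close>.\<close>
    define u' where "u' z = Re (L (?c z) / (2 * pi)) - h z y" for z
    have G: "\<And>z. z \<in> closure D \<Longrightarrow> z \<noteq> y \<Longrightarrow> G z y = 1 / (2 * pi) * ln (1 / norm (z - y)) - h z y"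
      and harm: "harmonic_on (\<lambda>z. h z y) D" and cont: "continuous_on (closure D) (\<lambda>z. h z y)"
      and G0: "\<And>z. z \<in> frontier D \<Longrightarrow> G z y = 0"
      using green y unfolding green_function_def by auto
    have u_eq: "u z = - G z y - ln (cmod (m (?c z))) / (2 * pi)" if "z \<in> D" "z \<noteq> y" for z
      using that G[of z] Re_l[OF that] closure_subset[of D]
      by (auto simp: u_def ln_div diff_divide_distrib)
    have ch: "coordinate_harmonic_on u D" "coordinate_harmonic_on u' D"
      unfolding u_def u'_def using l(1)
      by (intro coordinate_harmonic_on_diff harmonic_on_imp_coordinate_harmonic_on harm
          coordinate_harmonic_on_Re_holomorphic[of D "\<lambda>z. L z / (2 * pi)"] D(1) holomorphic_intros; simp)+
    have lim: "(u \<longlongrightarrow> 0) (at z within D)" if z: "z \<in> frontier D" for z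
    proof -
      have "z \<noteq> y" using z y D(1) by (auto simp: frontier_def interior_open)
      have ev: "\<forall>\<^sub>F w in at z within D. w \<in> D \<and> w \<noteq> y"
        using \<open>z \<noteq> y\<close> by (auto simp: eventually_at_filter intro!: eventually_mono[OF t1_space_nhds[of z y]])
      \<comment> \<open>\<open>green_function\<close> prescribes the value of \<open>G\<close> at
        the frontier point. That this is also the limit from inside follows from continuity of
        \<open>h\<close> and of the logarithm away from the pole.\<close>
      have "((\<lambda>w. 1 / (2 * pi) * ln (1 / norm (w - y)) - h w y) \<longlongrightarrow> 1 / (2 * pi) * ln (1 / norm (z - y)) - h z y) (at z within D)"
      proof (intro tendsto_intros)
        have "((\<lambda>w. h w y) \<longlongrightarrow> h z y) (at z within closure D)"
          using cont z by (simp add: continuous_on_def frontier_def)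
        then show "((\<lambda>w. h w y) \<longlongrightarrow> h z y) (at z within D)"
          by (rule tendsto_within_subset) (rule closure_subset)
      qed (use \<open>z \<noteq> y\<close> in auto)
      also have "1 / (2 * pi) * ln (1 / norm (z - y)) - h z y = 0"
        using G[of z] G0[OF z] z \<open>z \<noteq> y\<close> by (simp add: frontier_def)
      finally have 1: "((\<lambda>w. G w y) \<longlongrightarrow> 0) (at z within D)"
        by (rule Lim_transform_eventually) (use ev G closure_subset[of D] in \<open>auto elim!: eventually_mono\<close>)
      have "((\<lambda>w. cmod (f (?c w))) \<longlongrightarrow> 1) (at z within D)"
      proof (rule homeomorphism_tends_to_boundary[where g = "inv ?c \<circ> g"])
        show "f (?c w) \<in> ball 0 1 \<and> (inv ?c \<circ> g) (f (?c w)) = w" if "w \<in> D" for w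
          using fg[of "?c w"] that inj_c by simp
        show "continuous_on (ball 0 1) (inv ?c \<circ> g)"
          using linear_inv_plane_complex
          by (intro continuous_on_compose holomorphic_on_imp_continuous_on g linear_continuous_on)
             (simp add: linear_conv_bounded_linear)
        show "(inv ?c \<circ> g) ` ball 0 1 \<subseteq> D"
          using gf inj_c by fastforce
      qed (use D z in auto)
      then have "((\<lambda>w. cmod (m (?c w))) \<longlongrightarrow> 1) (at z within D)"
        unfolding m_def
        by (intro tendsto_blaschke_norm a) (use fg in \<open>auto simp: eventually_at_filter\<close>)
      then have "((\<lambda>w. - G w y - ln (cmod (m (?c w))) / (2 * pi)) \<longlongrightarrow> - 0 - ln 1 / (2 * pi)) (at z within D)"
        by (intro tendsto_diff tendsto_minus tendsto_divide tendsto_const tendsto_ln 1) auto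
      then have "((\<lambda>w. - G w y - ln (cmod (m (?c w))) / (2 * pi)) \<longlongrightarrow> 0) (at z within D)"
        by simp
      then show ?thesis
        by (rule Lim_transform_eventually) (use ev u_eq in \<open>auto elim!: eventually_mono\<close>)
    qed
    have "u x \<le> 0"
      by (rule weak_maximum_principle[OF D(1,2) ch(1) _ x]) (rule order_tendstoD(2)[OF lim], auto)
    moreover have "u' x \<le> 0"
    proof (rule weak_maximum_principle[OF D(1,2) ch(2) _ x])
      fix z and e :: real assume "z \<in> frontier D" "e > 0"
      then have "\<forall>\<^sub>F w in at z within D. - e < u w"
        using lim[of z] by (intro order_tendstoD(1)) auto
      then show "\<forall>\<^sub>F w in at z within D. u' w < 0 + e"
        by eventually_elim (simp add: u_def u'_def)
    qed
    ultimately have "u x = 0" by (simp add: u_def u'_def)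
    with u_eq[OF x \<open>x \<noteq> y\<close>]
    show "G x y = - ln (cmod (((f \<circ> ?c) x - (f \<circ> ?c) y) / (1 - cnj ((f \<circ> ?c) y) * (f \<circ> ?c) x))) / (2 * pi)"
      by (simp add: m_def a_def)
  qed
qed

text \<open>Exchanging the points changes the sign of the numerator of the Blaschke factor and
  conjugates its denominator.\<close>

lemma green_function_sym:
  assumes D: "open D" "bounded D" "simply_connected D" "D \<noteq> {}" and green: "green_function D G h"
    and "x \<in> D" "y \<in> D" "x \<noteq> y"
  shows "G x y = G y x"
proof -
  obtain \<phi> :: "real ^ 2 \<Rightarrow> complex" where \<phi>: "\<And>x y. x \<in> D \<Longrightarrow> y \<in> D \<Longrightarrow> x \<noteq> y \<Longrightarrow>
       G x y = - ln (cmod ((\<phi> x - \<phi> y) / (1 - cnj (\<phi> y) * \<phi> x))) / (2 * pi)"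
    using green_function_conformal[OF D green] by metis
  have "cmod (1 - cnj (\<phi> y) * \<phi> x) = cmod (cnj (1 - cnj (\<phi> x) * \<phi> y))"
    by (simp add: mult.commute)
  then have "cmod (1 - cnj (\<phi> y) * \<phi> x) = cmod (1 - cnj (\<phi> x) * \<phi> y)"
    by (simp only: complex_mod_cnj)
  then show ?thesis
    using \<phi>[of x y] \<phi>[of y x] assms(6-8) by (simp add: norm_divide norm_minus_commute)
qed

text \<open>For two poles the difference of the regular parts is harmonic in \<open>x\<close>, and
  on the frontier it is the logarithm of a quotient of distances, controlled by
  \<open>ln t \<le> t - 1\<close>. The maximum principle turns this into a Lipschitz bound in
  \<open>y\<close>, uniform in \<open>x\<close>, to be combined with continuity in \<open>x\<close>
  at a fixed pole.\<close>

lemma continuous_on_regular_part: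
  assumes D: "open D" "bounded D" and green: "green_function D G h"
  shows "continuous_on (D \<times> D) (\<lambda>(x, y). h x y)"
proof -
  have harm: "harmonic_on (\<lambda>x. h x y) D" and cont: "continuous_on (closure D) (\<lambda>x. h x y)"
    and G: "x \<in> frontier D \<Longrightarrow> h x y = 1 / (2 * pi) * ln (1 / norm (x - y))" if "y \<in> D" for x y
  proof -
    show "harmonic_on (\<lambda>x. h x y) D" "continuous_on (closure D) (\<lambda>x. h x y)"
      using green that unfolding green_function_def by auto
    assume "x \<in> frontier D"
    then have "x \<in> closure D - {y}"
      using that D(1) by (auto simp: frontier_def interior_open)
    then have "G x y = 1 / (2 * pi) * ln (1 / norm (x - y)) - h x y" "G x y = 0"
      using green that \<open>x \<in> frontier D\<close> unfolding green_function_def by blast+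
    then show "h x y = 1 / (2 * pi) * ln (1 / norm (x - y))" by simp
  qed
  have lip: "h x y - h x y' \<le> norm (y - y') / (2 * pi * r)"
    if r: "r > 0" "\<And>z. z \<in> frontier D \<Longrightarrow> r \<le> norm (z - y)" and "y \<in> D" "y' \<in> D" and x: "x \<in> D" for x y y' r
  proof (rule harmonic_on_diff_le[OF D harm harm cont cont])
    fix z assume z: "z \<in> frontier D"
    have "norm (z - y) > 0" "norm (z - y') > 0"
      using z that D(1) by (auto simp: frontier_def interior_open)
    then have "ln (1 / norm (z - y)) - ln (1 / norm (z - y')) = ln (norm (z - y') / norm (z - y))"
      by (simp add: ln_div)
    also have "\<dots> \<le> norm (z - y') / norm (z - y) - 1"
      using \<open>norm (z - y) > 0\<close> \<open>norm (z - y') > 0\<close> by (intro ln_le_minus_one) auto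
    also have "\<dots> = (norm (z - y') - norm (z - y)) / norm (z - y)"
      using \<open>norm (z - y) > 0\<close> by (simp add: field_simps)
    also have "\<dots> \<le> norm (y - y') / r"
    proof (rule frac_le)
      show "norm (z - y') - norm (z - y) \<le> norm (y - y')"
        using norm_triangle_ineq[of "z - y" "y - y'"] by simp
    qed (use r z in auto)
    finally have "1 / (2 * pi) * (ln (1 / norm (z - y)) - ln (1 / norm (z - y'))) \<le> 1 / (2 * pi) * (norm (y - y') / r)"
      by (intro mult_left_mono) auto
    then show "h z y - h z y' \<le> norm (y - y') / (2 * pi * r)"
      using G[OF \<open>y \<in> D\<close> z] G[OF \<open>y' \<in> D\<close> z] by (simp add: algebra_simps)
  qed (use that closure_subset in auto)
  have "((\<lambda>p. h (fst p) (snd p)) \<longlongrightarrow> h a b) (at (a, b) within D \<times> D)" if ab: "a \<in> D" "b \<in> D" for a b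
  proof -
    \<comment> \<open>The radius is doubled so that every pole within \<open>r\<close> of
      \<open>b\<close> keeps distance at least \<open>r\<close> from the frontier. Then
      \<open>lip\<close> applies with the two poles in either order, which yields the absolute
      value.\<close>
    obtain r where r: "r > 0" "ball b (2 * r) \<subseteq> D"
    proof -
      obtain s where "s > 0" "ball b s \<subseteq> D" using D(1) ab open_contains_ball by blast
      then show thesis by (intro that[of "s / 2"]) auto
    qed
    have far: "r \<le> norm (z - y)" if "z \<in> frontier D" "dist y b < r" for y z
    proof (rule ccontr)
      assume "\<not> r \<le> norm (z - y)"
      then have "dist b z < 2 * r"
        using that dist_triangle[of b z y] by (simp add: dist_norm norm_minus_commute)
      then have "z \<in> D" using r by auto
      then show False using that D(1) by (simp add: frontier_def interior_open)
    qed
    have "((\<lambda>p. h (fst p) b) \<longlongrightarrow> h a b) (at (a, b) within D \<times> D)"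
    proof -
      have "continuous_on (D \<times> D) (\<lambda>p. h (fst p) b)"
        using closure_subset
        by (intro continuous_on_compose2[OF cont[OF \<open>b \<in> D\<close>]] continuous_intros) auto
      then show ?thesis using ab by (auto simp: continuous_on_def)
    qed
    moreover have "((\<lambda>p. h (fst p) (snd p) - h (fst p) b) \<longlongrightarrow> 0) (at (a, b) within D \<times> D)"
    proof (rule Lim_null_comparison)
      have "((\<lambda>p. snd p) \<longlongrightarrow> b) (at (a, b) within D \<times> D)"
        by (auto intro!: tendsto_eq_intros)
      then have "\<forall>\<^sub>F p in at (a, b) within D \<times> D. dist (snd p) b < r"
        using r(1) by (rule tendstoD)
      moreover have "\<forall>\<^sub>F p in at (a, b) within D \<times> D. p \<in> D \<times> D"
        by (auto simp: eventually_at_filter)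
      ultimately show "\<forall>\<^sub>F p in at (a, b) within D \<times> D. norm (h (fst p) (snd p) - h (fst p) b) \<le> norm (snd p - b) / (2 * pi * r)"
      proof eventually_elim
        case (elim p)
        then have "fst p \<in> D" "snd p \<in> D" by auto
        from lip[OF r(1) far this(2) ab(2) this(1)] lip[OF r(1) far ab(2) this(2) this(1)] elim r(1)
        show ?case by (simp add: norm_minus_commute abs_le_iff)
      qed
      show "((\<lambda>p. norm (snd p - b) / (2 * pi * r)) \<longlongrightarrow> 0) (at (a, b) within D \<times> D)"
        using r(1) by (auto intro!: tendsto_eq_intros)
    qed
    ultimately show ?thesis
      using tendsto_add by fastforce
  qed
  then show ?thesis
    by (auto simp: continuous_on_def case_prod_unfold)
qed

section \<open>Interaction energies of bounded densities\<close>

text \<open>Sign and almost-everywhere ambiguity are removed here: both components become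
  nonnegative Borel functions on the whole plane whose bounds hold at every point.\<close>

definition density_on :: "real \<Rightarrow> (real ^ 2) set \<Rightarrow> (real ^ 2 \<Rightarrow> real) \<Rightarrow> bool" where
  "density_on l B f \<longleftrightarrow>
     f \<in> borel_measurable borel \<and> (\<forall>x. 0 \<le> f x \<and> f x \<le> l) \<and> (\<forall>x. x \<notin> B \<longrightarrow> f x = 0)"

abbreviation mass :: "(real ^ 2 \<Rightarrow> real) \<Rightarrow> real" where
  "mass f \<equiv> integral\<^sup>L lborel f"

definition interaction ::
    "(real ^ 2 \<Rightarrow> real ^ 2 \<Rightarrow> real) \<Rightarrow> (real ^ 2 \<Rightarrow> real) \<Rightarrow> (real ^ 2 \<Rightarrow> real) \<Rightarrow> real" where
  "interaction k f g = (\<integral>p. k (fst p) (snd p) * f (fst p) * g (snd p) \<partial>(lborel \<Otimes>\<^sub>M lborel))"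

definition log_plus :: "real \<Rightarrow> real" where
  "log_plus t = max 0 (ln t)"

text \<open>On the diagonal the conventions for division by 0 and \<open>ln 0\<close> make the value
  0; the diagonal is a null set.\<close>

definition log_kernel :: "real ^ 2 \<Rightarrow> real ^ 2 \<Rightarrow> real" where
  "log_kernel x y = ln (1 / norm (x - y))"

text \<open>Kernels with at most a logarithmic singularity, the class for which Fubini applies to
  bounded densities. The growth bound concerns \<open>A\<close> and \<open>B\<close> only, where the
  densities live, while measurability is global.\<close>

definition log_bounded :: "(real ^ 2) set \<Rightarrow> (real ^ 2) set \<Rightarrow> (real ^ 2 \<Rightarrow> real ^ 2 \<Rightarrow> real) \<Rightarrow> bool" where
  "log_bounded A B k \<longleftrightarrow> case_prod k \<in> borel_measurable (lborel \<Otimes>\<^sub>M lborel) \<and>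
     (\<exists>M\<ge>0. \<forall>x\<in>A. \<forall>y\<in>B. \<bar>k x y\<bar> \<le> M * (1 + log_plus (1 / norm (x - y))))"

lemma density_onD:
  assumes "density_on l B f"
  shows "f \<in> borel_measurable borel" "0 \<le> f x" "f x \<le> l" "x \<notin> B \<Longrightarrow> f x = 0"
  using assms by (auto simp: density_on_def)

lemma density_on_mono: "density_on l B f \<Longrightarrow> B \<subseteq> C \<Longrightarrow> density_on l C f"
  by (auto simp: density_on_def)

lemma density_on_restrict:
  assumes "density_on l B f" "S \<in> sets borel"
  shows "density_on l (B \<inter> S) (\<lambda>x. f x * indicator S x)"
proof -
  have "l \<ge> 0" using density_onD(2,3)[OF assms(1)] order_trans by blast
  moreover have "(\<lambda>x. f x * indicator S x) \<in> borel_measurable borel"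
    using assms by (intro borel_measurable_times borel_measurable_indicator density_onD(1))
  ultimately show ?thesis
    using density_onD(2-4)[OF assms(1)] by (auto simp: density_on_def indicator_def)
qed

lemma integrable_density:
  assumes "density_on l B f" "bounded B"
  shows "integrable lborel f"
proof -
  obtain R where R: "B \<subseteq> cball 0 R"
    using assms(2) bounded_any_center[of B 0] by (auto simp: subset_iff)
  show ?thesis
  proof (rule integrableI_bounded_set[of "cball 0 R" _ _ l])
    show "AE x in lborel. x \<in> cball 0 R \<longrightarrow> norm (f x) \<le> l"
      using density_onD(2,3)[OF assms(1)] by (intro AE_I2) simp
    show "AE x in lborel. x \<notin> cball 0 R \<longrightarrow> f x = 0"
      using density_onD(4)[OF assms(1)] R by (intro AE_I2) blast
    show "emeasure lborel (cball 0 R :: (real ^ 2) set) < \<infinity>"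
      using emeasure_lborel_cball_finite by blast
  qed (use density_onD(1)[OF assms(1)] in simp_all)
qed

lemma log_plus_nonneg [simp]: "0 \<le> log_plus t"
  unfolding log_plus_def by (rule max.cobounded1)

lemma log_plus_measurable [measurable]: "log_plus \<in> borel_measurable borel"
  unfolding log_plus_def[abs_def] by measurable

text \<open>The right-hand side counts the balls of radii \<open>e * exp (- n)\<close> containing \<open>y\<close>; integrating it needs only the
  areas of balls.\<close>

lemma log_plus_le_count:
  assumes "e > 0"
  shows "ennreal (log_plus (e / norm (x - y))) \<le> (\<Sum>n. indicator (cball x (e * exp (- real n))) y)"
proof (cases "ln (e / norm (x - y)) > 0")
  case False
  then show ?thesis by (simp add: log_plus_def)
next
  case True
  define t where "t = ln (e / norm (x - y))"
  have t: "t > 0" "log_plus (e / norm (x - y)) = t"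
    using True by (auto simp: t_def log_plus_def)
  have "x \<noteq> y" using True by auto
  then have n: "norm (x - y) = e * exp (- t)"
    using assms by (simp add: t_def exp_minus)
  \<comment> \<open>The indices below \<open>N\<close> are exactly those at most \<open>t\<close>,
    so all their balls contain \<open>y\<close>, and the extra \<open>Suc\<close> ensures
    \<open>t \<le> N\<close>.\<close>
  define N where "N = Suc (nat \<lfloor>t\<rfloor>)"
  have N: "real i \<le> t" if "i < N" for i
    using that t by (simp add: N_def less_Suc_eq_le nat_le_iff le_nat_iff le_floor_iff)
  have "t \<le> real N"
    using t unfolding N_def by linarith
  then have "ennreal t \<le> ennreal (real N)"
    by (rule ennreal_leI)
  also have "\<dots> = (\<Sum>n<N. 1)"
    by (simp flip: ennreal_of_nat_eq_real_of_nat)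
  also have "\<dots> = (\<Sum>n<N. indicator (cball x (e * exp (- real n))) y)"
  proof (rule sum.cong)
    fix i assume "i \<in> {..<N}"
    then have "exp (- t) \<le> exp (- real i)" using N by simp
    then have "y \<in> cball x (e * exp (- real i))"
      using mult_left_mono[of "exp (- t)" "exp (- real i)" e] n assms by (simp only: mem_cball dist_norm)
    then show "1 = (indicator (cball x (e * exp (- real i))) y :: ennreal)" by (simp only: indicator_simps)
  qed (rule refl)
  also have "\<dots> \<le> (\<Sum>n. indicator (cball x (e * exp (- real n))) y)"
    by (rule sum_le_suminf) simp_all
  finally show ?thesis unfolding t(2) .
qed

text \<open>The sum of the areas of the discs of radii \<open>exp (- n)\<close>, an upper bound for
  the integral of the positive part of the logarithmic kernel.\<close>

definition log_const :: real where
  "log_const = pi / (1 - exp (- 2))"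

lemma log_const_pos: "log_const > 0"
  by (simp add: log_const_def)

lemma nn_integral_log_plus_le:
  fixes x :: "real ^ 2"
  assumes "e > 0"
  shows "(\<integral>\<^sup>+y. ennreal (log_plus (e / norm (x - y))) \<partial>lborel) \<le> ennreal (log_const * e\<^sup>2)"
proof -
  have "(\<integral>\<^sup>+y. ennreal (log_plus (e / norm (x - y))) \<partial>lborel)
      \<le> (\<integral>\<^sup>+y. (\<Sum>n. indicator (cball x (e * exp (- real n))) y) \<partial>lborel)"
    by (intro nn_integral_mono log_plus_le_count assms)
  also have "\<dots> = (\<Sum>n. \<integral>\<^sup>+y. indicator (cball x (e * exp (- real n))) y \<partial>lborel)"
    by (rule nn_integral_suminf) (simp add: borel_measurable_indicator)
  also have "\<dots> = (\<Sum>n. ennreal (pi * e\<^sup>2 * exp (- 2) ^ n))"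
  proof (rule arg_cong[of _ _ suminf], rule ext)
    fix n
    have "exp (- real n) ^ 2 = exp (real 2 * (- real n))" "exp (- 2) ^ n = exp (real n * (- 2))"
      by (simp_all only: exp_of_nat_mult)
    then have "(e * exp (- real n))\<^sup>2 = e\<^sup>2 * exp (- 2) ^ n"
      by (simp add: power_mult_distrib mult.commute)
    then show "(\<integral>\<^sup>+y. indicator (cball x (e * exp (- real n))) y \<partial>lborel) = ennreal (pi * e\<^sup>2 * exp (- 2) ^ n)"
      using assms by (simp add: emeasure_cball unit_ball_vol_2 mult.assoc)
  qed
  also have "\<dots> = ennreal (\<Sum>n. pi * e\<^sup>2 * exp (- 2) ^ n)"
    by (intro suminf_ennreal2 summable_mult summable_geometric) auto
  also have "(\<Sum>n. pi * e\<^sup>2 * exp (- 2) ^ n) = log_const * e\<^sup>2"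
    by (subst suminf_mult) (simp_all add: suminf_geometric log_const_def summable_geometric)
  finally show ?thesis .
qed

text \<open>The factor \<open>g\<close> is replaced by its bound \<open>l\<close> and
  \<open>y\<close> is integrated out first, which leaves the mass of \<open>f\<close>. For
  \<open>e = 1 / sqrt l\<close> the powers of \<open>l\<close> cancel.\<close>

lemma nn_integral_log_plus_density_le:
  assumes f: "density_on l A f" "bounded A" and g: "density_on l B g" and e: "e > 0"
  shows "(\<integral>\<^sup>+p. ennreal (log_plus (e / norm (fst p - snd p)) * f (fst p) * g (snd p)) \<partial>(lborel \<Otimes>\<^sub>M lborel))
      \<le> ennreal (l * log_const * e\<^sup>2 * mass f)"
proof -
  have [measurable]: "f \<in> borel_measurable borel" "g \<in> borel_measurable borel"
    using density_onD(1)[OF f(1)] density_onD(1)[OF g] by simp_all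
  have l: "l \<ge> 0" using density_onD(2,3)[OF f(1)] order_trans by blast
  have "(\<integral>\<^sup>+p. ennreal (log_plus (e / norm (fst p - snd p)) * f (fst p) * g (snd p)) \<partial>(lborel \<Otimes>\<^sub>M lborel))
      = (\<integral>\<^sup>+x. \<integral>\<^sup>+y. ennreal (log_plus (e / norm (x - y)) * f x * g y) \<partial>lborel \<partial>lborel)"
    by (subst lborel.nn_integral_fst[symmetric]) auto
  also have "\<dots> \<le> (\<integral>\<^sup>+x. \<integral>\<^sup>+y. ennreal (f x * l) * ennreal (log_plus (e / norm (x - y))) \<partial>lborel \<partial>lborel)"
  proof (intro nn_integral_mono)
    fix x y
    have "log_plus (e / norm (x - y)) * f x * g y \<le> f x * l * log_plus (e / norm (x - y))"
      using density_onD(3)[OF g] density_onD(2)[OF f(1)] mult_left_mono[of "g y" l "log_plus (e / norm (x - y)) * f x"]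
      by (simp add: ac_simps)
    then show "ennreal (log_plus (e / norm (x - y)) * f x * g y) \<le> ennreal (f x * l) * ennreal (log_plus (e / norm (x - y)))"
      using l density_onD(2)[OF f(1)] by (subst ennreal_mult[symmetric]) (auto intro: ennreal_leI)
  qed
  also have "\<dots> = (\<integral>\<^sup>+x. ennreal (f x * l) * (\<integral>\<^sup>+y. ennreal (log_plus (e / norm (x - y))) \<partial>lborel) \<partial>lborel)"
    by (intro nn_integral_cong nn_integral_cmult) auto
  also have "\<dots> \<le> (\<integral>\<^sup>+x. ennreal (f x * l) * ennreal (log_const * e\<^sup>2) \<partial>lborel)"
    by (intro nn_integral_mono mult_left_mono nn_integral_log_plus_le e) auto
  also have "\<dots> = (\<integral>\<^sup>+x. ennreal (l * log_const * e\<^sup>2 * f x) \<partial>lborel)"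
  proof (intro nn_integral_cong)
    fix x
    have "ennreal (f x * l) * ennreal (log_const * e\<^sup>2) = ennreal (f x * l * (log_const * e\<^sup>2))"
      using l density_onD(2)[OF f(1), of x] log_const_pos by (intro ennreal_mult[symmetric]) auto
    also have "f x * l * (log_const * e\<^sup>2) = l * log_const * e\<^sup>2 * f x"
      by (simp only: ac_simps)
    finally show "ennreal (f x * l) * ennreal (log_const * e\<^sup>2) = ennreal (l * log_const * e\<^sup>2 * f x)" .
  qed
  also have "\<dots> = ennreal (l * log_const * e\<^sup>2 * mass f)"
  proof (subst nn_integral_eq_integral)
    show "integrable lborel (\<lambda>x. l * log_const * e\<^sup>2 * f x)"
      using integrable_density[OF f] by simp
    show "AE x in lborel. 0 \<le> l * log_const * e\<^sup>2 * f x"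
      using l density_onD(2)[OF f(1)] log_const_pos
      by (intro AE_I2 mult_nonneg_nonneg) auto
  qed simp
  finally show ?thesis .
qed

text \<open>The kernel is dominated by a multiple of \<open>1 + log_plus (1 / norm (x - y))\<close>:
  the constant gives the product of the masses, the logarithm the estimate above with
  \<open>e = 1\<close>.\<close>

lemma integrable_interaction:
  assumes f: "density_on l A f" "bounded A" and g: "density_on l B g" "bounded B"
    and k: "log_bounded A B k"
  shows "integrable (lborel \<Otimes>\<^sub>M lborel) (\<lambda>p. k (fst p) (snd p) * f (fst p) * g (snd p))"
proof -
  have [measurable]: "f \<in> borel_measurable borel" "g \<in> borel_measurable borel"
    using density_onD(1)[OF f(1)] density_onD(1)[OF g(1)] by simp_all
  obtain M where M: "M \<ge> 0" "\<And>x y. x \<in> A \<Longrightarrow> y \<in> B \<Longrightarrow> \<bar>k x y\<bar> \<le> M * (1 + log_plus (1 / norm (x - y)))"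
    and km: "case_prod k \<in> borel_measurable (lborel \<Otimes>\<^sub>M lborel)"
    using k by (auto simp: log_bounded_def)
  have km' [measurable]: "(\<lambda>p. k (fst p) (snd p)) \<in> borel_measurable (lborel \<Otimes>\<^sub>M lborel)"
    using km by (simp add: case_prod_unfold)
  have nn: "0 \<le> f x" "0 \<le> g x" for x
    using density_onD[OF f(1)] density_onD[OF g(1)] by auto
  have "(\<integral>\<^sup>+p. ennreal (norm (k (fst p) (snd p) * f (fst p) * g (snd p))) \<partial>(lborel \<Otimes>\<^sub>M lborel))
     \<le> (\<integral>\<^sup>+p. ennreal M * (ennreal (f (fst p)) * ennreal (g (snd p))
          + ennreal (log_plus (1 / norm (fst p - snd p)) * f (fst p) * g (snd p))) \<partial>(lborel \<Otimes>\<^sub>M lborel))"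
  proof (intro nn_integral_mono)
    fix p :: "(real ^ 2) \<times> (real ^ 2)"
    obtain x y where p: "p = (x, y)" by force
    have "\<bar>k x y\<bar> * f x * g y \<le> (M * (1 + log_plus (1 / norm (x - y)))) * f x * g y"
    proof (cases "x \<in> A \<and> y \<in> B")
      case True
      then show ?thesis using M(2)[of x y] nn by (intro mult_right_mono) auto
    qed (use density_onD(4)[OF f(1), of x] density_onD(4)[OF g(1), of y] in auto)
    also have "\<dots> = M * (f x * g y + log_plus (1 / norm (x - y)) * f x * g y)"
      by (simp add: algebra_simps)
    finally have "ennreal (\<bar>k x y\<bar> * f x * g y) \<le> ennreal (M * (f x * g y + log_plus (1 / norm (x - y)) * f x * g y))"
      by (rule ennreal_leI)
    then show "ennreal (norm (k (fst p) (snd p) * f (fst p) * g (snd p))) \<le> ennreal M * (ennreal (f (fst p)) * ennreal (g (snd p))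
          + ennreal (log_plus (1 / norm (fst p - snd p)) * f (fst p) * g (snd p)))"
      using nn M(1) by (simp add: p abs_mult ennreal_mult ennreal_plus)
  qed
  also have "\<dots> = ennreal M * ((\<integral>\<^sup>+p. ennreal (f (fst p)) * ennreal (g (snd p)) \<partial>(lborel \<Otimes>\<^sub>M lborel))
     + (\<integral>\<^sup>+p. ennreal (log_plus (1 / norm (fst p - snd p)) * f (fst p) * g (snd p)) \<partial>(lborel \<Otimes>\<^sub>M lborel)))"
    by (subst nn_integral_cmult) (auto intro!: arg_cong[of _ _ "\<lambda>t. _ * t"] nn_integral_add)
  also have "(\<integral>\<^sup>+p. ennreal (f (fst p)) * ennreal (g (snd p)) \<partial>(lborel \<Otimes>\<^sub>M lborel)) = ennreal (mass f) * ennreal (mass g)"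
  proof -
    have "(\<integral>\<^sup>+p. ennreal (f (fst p)) * ennreal (g (snd p)) \<partial>(lborel \<Otimes>\<^sub>M lborel))
        = (\<integral>\<^sup>+x. \<integral>\<^sup>+y. ennreal (f x) * ennreal (g y) \<partial>lborel \<partial>lborel)"
      by (subst lborel.nn_integral_fst[symmetric]) auto
    also have "\<dots> = (\<integral>\<^sup>+x. ennreal (f x) * ennreal (mass g) \<partial>lborel)"
      using nn integrable_density[OF g]
      by (intro nn_integral_cong) (auto simp: nn_integral_cmult nn_integral_eq_integral)
    also have "\<dots> = ennreal (mass f) * ennreal (mass g)"
      using nn integrable_density[OF f] by (auto simp: nn_integral_multc nn_integral_eq_integral)
    finally show ?thesis .
  qed
  also have "ennreal M * (ennreal (mass f) * ennreal (mass g)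
     + (\<integral>\<^sup>+p. ennreal (log_plus (1 / norm (fst p - snd p)) * f (fst p) * g (snd p)) \<partial>(lborel \<Otimes>\<^sub>M lborel))) < \<infinity>"
  proof -
    have "(\<integral>\<^sup>+p. ennreal (log_plus (1 / norm (fst p - snd p)) * f (fst p) * g (snd p)) \<partial>(lborel \<Otimes>\<^sub>M lborel)) < \<infinity>"
      by (rule le_less_trans[OF nn_integral_log_plus_density_le[OF f g(1)]]) auto
    then show ?thesis by (simp add: ennreal_mult_less_top flip: ennreal_mult')
  qed
  finally show ?thesis
    by (intro integrableI_bounded) auto
qed

lemma interaction_iterated:
  assumes "density_on l A f" "bounded A" "density_on l B g" "bounded B" "log_bounded A B k"
  shows "interaction k f g = (\<integral>x. \<integral>y. k x y * f x * g y \<partial>lborel \<partial>lborel)"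
    and "interaction k f g = (\<integral>y. \<integral>x. k x y * f x * g y \<partial>lborel \<partial>lborel)"
proof -
  have int: "integrable (lborel \<Otimes>\<^sub>M lborel) (case_prod (\<lambda>x y. k x y * f x * g y))"
    using integrable_interaction[OF assms] by (simp add: case_prod_unfold)
  show "interaction k f g = (\<integral>x. \<integral>y. k x y * f x * g y \<partial>lborel \<partial>lborel)"
    unfolding lborel_pair.integral_fst[OF int] by (simp add: interaction_def case_prod_unfold)
  show "interaction k f g = (\<integral>y. \<integral>x. k x y * f x * g y \<partial>lborel \<partial>lborel)"
    unfolding lborel_pair.integral_snd[OF int] by (simp add: interaction_def case_prod_unfold)
qed

text \<open>Kernel values on the diagonal are conventional, so kernels are compared only off it;
  singletons are null, hence so is the diagonal.\<close>

lemma AE_off_diagonal: "AE p in (lborel :: (real ^ 2) measure) \<Otimes>\<^sub>M lborel. fst p \<noteq> snd p"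
proof (rule lborel_pair.AE_pair_measure)
  have "Measurable.pred (borel \<Otimes>\<^sub>M borel) (\<lambda>p. fst p = (snd p :: real ^ 2))"
    by measurable
  then show "{p \<in> space (lborel \<Otimes>\<^sub>M lborel). fst p \<noteq> (snd p :: real ^ 2)} \<in> sets (lborel \<Otimes>\<^sub>M lborel)"
    by measurable
  show "AE x in lborel. AE y in lborel. fst (x, y) \<noteq> (snd (x, y) :: real ^ 2)"
  proof (rule AE_I2)
    fix x :: "real ^ 2"
    show "AE y in lborel. fst (x, y) \<noteq> snd (x, y)"
      using AE_lborel_singleton[of x] by (rule eventually_mono) auto
  qed
qed

lemma interaction_mono:
  assumes "density_on l A f" "bounded A" "density_on l B g" "bounded B" "log_bounded A B k" "log_bounded A B k'"
    and le: "\<And>x y. x \<in> A \<Longrightarrow> y \<in> B \<Longrightarrow> x \<noteq> y \<Longrightarrow> k x y \<le> k' x y"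
  shows "interaction k f g \<le> interaction k' f g"
  unfolding interaction_def
proof (intro integral_mono_AE integrable_interaction[OF assms(1-4)] assms(5,6))
  show "AE p in lborel \<Otimes>\<^sub>M lborel. k (fst p) (snd p) * f (fst p) * g (snd p) \<le> k' (fst p) (snd p) * f (fst p) * g (snd p)"
    using AE_off_diagonal
  proof (rule eventually_mono)
    fix p :: "(real ^ 2) \<times> (real ^ 2)" assume "fst p \<noteq> snd p"
    then show "k (fst p) (snd p) * f (fst p) * g (snd p) \<le> k' (fst p) (snd p) * f (fst p) * g (snd p)"
      using le[of "fst p" "snd p"] density_onD(2)[OF assms(1), of "fst p"] density_onD(2)[OF assms(3), of "snd p"]
        density_onD(4)[OF assms(1), of "fst p"] density_onD(4)[OF assms(3), of "snd p"]
      by (cases "fst p \<in> A"; cases "snd p \<in> B") (simp_all add: mult_right_mono)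
  qed
qed

lemma interaction_cong_off_diagonal:
  assumes "density_on l A f" "bounded A" "density_on l B g" "bounded B" "log_bounded A B k" "log_bounded A B k'"
    and eq: "\<And>x y. x \<in> A \<Longrightarrow> y \<in> B \<Longrightarrow> x \<noteq> y \<Longrightarrow> k x y = k' x y"
  shows "interaction k f g = interaction k' f g"
  by (intro antisym interaction_mono[OF assms(1-4)] assms(5,6)) (use eq in simp_all)

lemma interaction_sym:
  assumes "density_on l A f" "density_on l B g" "log_bounded A B k"
  shows "interaction k f g = interaction (\<lambda>x y. k y x) g f"
proof -
  have [measurable]: "f \<in> borel_measurable borel" "g \<in> borel_measurable borel"
    using density_onD(1)[OF assms(1)] density_onD(1)[OF assms(2)] by simp_all
  have [measurable]: "(\<lambda>p. k (fst p) (snd p)) \<in> borel_measurable (lborel \<Otimes>\<^sub>M lborel)"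
    using assms by (simp add: case_prod_unfold log_bounded_def)
  show ?thesis
    unfolding interaction_def
    by (subst lborel_pair.integral_product_swap[symmetric]) (auto simp: case_prod_unfold ac_simps)
qed

section \<open>Examples and closure properties of logarithmically bounded kernels\<close>

lemma log_bounded_measurable:
  assumes "log_bounded A B k"
  shows "(\<lambda>p. k (fst p) (snd p)) \<in> borel_measurable (lborel \<Otimes>\<^sub>M lborel)"
  using assms by (simp add: log_bounded_def case_prod_unfold)

lemma log_bounded_bounded:
  assumes "case_prod k \<in> borel_measurable (lborel \<Otimes>\<^sub>M lborel)" "\<And>x y. x \<in> A \<Longrightarrow> y \<in> B \<Longrightarrow> \<bar>k x y\<bar> \<le> M"
  shows "log_bounded A B k"
  unfolding log_bounded_def
proof (intro conjI exI[of _ "max 0 M"] ballI assms(1))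
  fix x y assume "x \<in> A" "y \<in> B"
  then have "\<bar>k x y\<bar> \<le> max 0 M * 1" using assms(2) by (simp add: le_max_iff_disj)
  also have "\<dots> \<le> max 0 M * (1 + log_plus (1 / norm (x - y)))"
    by (intro mult_left_mono) auto
  finally show "\<bar>k x y\<bar> \<le> max 0 M * (1 + log_plus (1 / norm (x - y)))" .
qed simp

lemma log_bounded_const: "log_bounded A B (\<lambda>_ _. c)"
  by (rule log_bounded_bounded[of _ _ _ "\<bar>c\<bar>"]) auto

lemma log_bounded_add:
  assumes k: "log_bounded A B k" and k': "log_bounded A B k'"
  shows "log_bounded A B (\<lambda>x y. k x y + k' x y)"
proof -
  obtain M where M: "M \<ge> 0" "\<And>x y. x \<in> A \<Longrightarrow> y \<in> B \<Longrightarrow> \<bar>k x y\<bar> \<le> M * (1 + log_plus (1 / norm (x - y)))"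
    using k unfolding log_bounded_def by blast
  obtain M' where M': "M' \<ge> 0" "\<And>x y. x \<in> A \<Longrightarrow> y \<in> B \<Longrightarrow> \<bar>k' x y\<bar> \<le> M' * (1 + log_plus (1 / norm (x - y)))"
    using k' unfolding log_bounded_def by blast
  show ?thesis
    unfolding log_bounded_def
  proof (intro conjI exI[of _ "M + M'"] ballI)
    show "(\<lambda>(x, y). k x y + k' x y) \<in> borel_measurable (lborel \<Otimes>\<^sub>M lborel)"
      using log_bounded_measurable[OF k] log_bounded_measurable[OF k'] by (simp add: case_prod_unfold)
    fix x y assume "x \<in> A" "y \<in> B"
    from M(2)[OF this] M'(2)[OF this]
    show "\<bar>k x y + k' x y\<bar> \<le> (M + M') * (1 + log_plus (1 / norm (x - y)))"
      unfolding distrib_right by linarith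
  qed (use M(1) M'(1) in simp)
qed

lemma log_bounded_cmult:
  assumes k: "log_bounded A B k"
  shows "log_bounded A B (\<lambda>x y. c * k x y)"
proof -
  obtain M where M: "M \<ge> 0" "\<And>x y. x \<in> A \<Longrightarrow> y \<in> B \<Longrightarrow> \<bar>k x y\<bar> \<le> M * (1 + log_plus (1 / norm (x - y)))"
    using k unfolding log_bounded_def by blast
  show ?thesis
    unfolding log_bounded_def
  proof (intro conjI exI[of _ "\<bar>c\<bar> * M"] ballI)
    show "(\<lambda>(x, y). c * k x y) \<in> borel_measurable (lborel \<Otimes>\<^sub>M lborel)"
      using log_bounded_measurable[OF k] by (simp add: case_prod_unfold)
    fix x y assume "x \<in> A" "y \<in> B"
    from mult_left_mono[OF M(2)[OF this], of "\<bar>c\<bar>"]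
    show "\<bar>c * k x y\<bar> \<le> \<bar>c\<bar> * M * (1 + log_plus (1 / norm (x - y)))"
      by (simp add: abs_mult mult.assoc)
  qed (use M(1) in simp)
qed

lemma norm_diff_bounded:
  assumes "bounded A" "bounded B"
  obtains d :: real where "d \<ge> 1" "\<And>x y. x \<in> A \<Longrightarrow> y \<in> B \<Longrightarrow> norm (x - y) \<le> d"
proof -
  obtain a b where ab: "\<And>x. x \<in> A \<Longrightarrow> norm x \<le> a" "\<And>x. x \<in> B \<Longrightarrow> norm x \<le> b"
    using assms unfolding bounded_iff by metis
  show thesis
  proof (rule that[of "max 1 (a + b)"])
    fix x y assume "x \<in> A" "y \<in> B"
    then show "norm (x - y) \<le> max 1 (a + b)"
      using norm_triangle_ineq4[of x y] ab(1)[of x] ab(2)[of y] by linarith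
  qed simp
qed

lemma log_plus_mono: "0 < s \<Longrightarrow> s \<le> t \<Longrightarrow> log_plus s \<le> log_plus t"
  by (simp add: log_plus_def max.coboundedI2)

lemma log_bounded_log_kernel:
  assumes "bounded A" "bounded B"
  shows "log_bounded A B log_kernel"
proof -
  obtain d where d: "d \<ge> 1" "\<And>x y. x \<in> A \<Longrightarrow> y \<in> B \<Longrightarrow> norm (x - y) \<le> d"
    using norm_diff_bounded[OF assms] by metis
  show ?thesis
    unfolding log_bounded_def
  proof (intro conjI exI[of _ "1 + ln d"] ballI)
    show "case_prod log_kernel \<in> borel_measurable (lborel \<Otimes>\<^sub>M lborel)"
      unfolding log_kernel_def case_prod_unfold by measurable
    fix x y assume xy: "x \<in> A" "y \<in> B"
    have "\<bar>log_kernel x y\<bar> \<le> ln d + log_plus (1 / norm (x - y))"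
    proof (cases "x = y")
      case False
      then have "ln (norm (x - y)) \<le> ln d" using d(2)[OF xy] by (intro ln_mono) auto
      moreover have "0 \<le> ln d" using d(1) by simp
      ultimately show ?thesis
        using False unfolding log_kernel_def log_plus_def by (auto simp: ln_div max_def)
    qed (use d(1) in \<open>simp add: log_kernel_def\<close>)
    also have "\<dots> \<le> (1 + ln d) * (1 + log_plus (1 / norm (x - y)))"
      using d(1) by (simp add: algebra_simps)
    finally show "\<bar>log_kernel x y\<bar> \<le> (1 + ln d) * (1 + log_plus (1 / norm (x - y)))" .
  qed (use d(1) in simp)
qed

lemma log_bounded_log_plus:
  assumes "bounded A" "bounded B" "c > 0"
  shows "log_bounded A B (\<lambda>x y. log_plus (c * norm (x - y)))"
proof -
  obtain d where d: "d \<ge> 1" "\<And>x y. x \<in> A \<Longrightarrow> y \<in> B \<Longrightarrow> norm (x - y) \<le> d"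
    using norm_diff_bounded[OF assms(1,2)] by metis
  show ?thesis
  proof (rule log_bounded_bounded)
    show "(\<lambda>(x, y). log_plus (c * norm (x - y :: real ^ 2))) \<in> borel_measurable (lborel \<Otimes>\<^sub>M lborel)"
      unfolding case_prod_unfold by measurable
    fix x y assume xy: "x \<in> A" "y \<in> B"
    show "\<bar>log_plus (c * norm (x - y))\<bar> \<le> log_plus (c * d)"
    proof (cases "x = y")
      case False
      then have "log_plus (c * norm (x - y)) \<le> log_plus (c * d)"
        using d(2)[OF xy] \<open>c > 0\<close> by (intro log_plus_mono) auto
      then show ?thesis by simp
    qed (simp add: log_plus_def)
  qed
qed

lemma log_bounded_log_plus_inverse:
  assumes "e > 0"
  shows "log_bounded A B (\<lambda>x y. log_plus (e / norm (x - y)))"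
  unfolding log_bounded_def
proof (intro conjI exI[of _ "1 + log_plus e"] ballI)
  show "(\<lambda>(x, y). log_plus (e / norm (x - y :: real ^ 2))) \<in> borel_measurable (lborel \<Otimes>\<^sub>M lborel)"
    unfolding case_prod_unfold by measurable
  fix x y :: "real ^ 2"
  have "\<bar>log_plus (e / norm (x - y))\<bar> \<le> log_plus e + log_plus (1 / norm (x - y))"
    using assms by (cases "x = y") (auto simp: log_plus_def ln_div)
  also have "\<dots> \<le> (1 + log_plus e) * (1 + log_plus (1 / norm (x - y)))"
    by (simp add: algebra_simps)
  finally show "\<bar>log_plus (e / norm (x - y))\<bar> \<le> (1 + log_plus e) * (1 + log_plus (1 / norm (x - y)))" .
qed simp

section \<open>Linearity, positivity and splitting of interaction energies\<close>

lemma interaction_const: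
  assumes f: "density_on l A f" "bounded A" and g: "density_on l B g" "bounded B"
  shows "interaction (\<lambda>_ _. c) f g = c * mass f * mass g"
  by (simp add: interaction_iterated(1)[OF f g log_bounded_const])

lemma interaction_add:
  assumes f: "density_on l A f" "bounded A" and g: "density_on l B g" "bounded B"
    and k: "log_bounded A B k" "log_bounded A B k'"
  shows "interaction (\<lambda>x y. k x y + k' x y) f g = interaction k f g + interaction k' f g"
  unfolding interaction_def distrib_right
  by (rule Bochner_Integration.integral_add) (intro integrable_interaction[OF f g] k)+

lemma interaction_cmult:
  "interaction (\<lambda>x y. c * k x y) f g = c * interaction k f g"
  unfolding interaction_def mult.assoc by (rule integral_mult_right_zero)

lemma interaction_nonneg:
  assumes "\<And>x y. 0 \<le> k x y" "density_on l A f" "density_on l B g"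
  shows "0 \<le> interaction k f g"
  unfolding interaction_def
  by (intro integral_nonneg_AE AE_I2 mult_nonneg_nonneg assms density_onD(2)[OF assms(2)] density_onD(2)[OF assms(3)])

lemma mass_nonneg: "density_on l A f \<Longrightarrow> 0 \<le> mass f"
  by (intro integral_nonneg_AE AE_I2 density_onD(2))

lemma interaction_split_left:
  assumes f: "density_on l A f" "bounded A" and g: "density_on l B g" "bounded B"
    and k: "log_bounded A B k" and S: "S \<in> sets borel"
  shows "interaction k f g
    = interaction k (\<lambda>x. f x * indicator S x) g + interaction k (\<lambda>x. f x * indicator (- S) x) g"
proof -
  have "interaction k (\<lambda>x. f x * indicator S x) g + interaction k (\<lambda>x. f x * indicator (- S) x) g
    = (\<integral>p. k (fst p) (snd p) * (f (fst p) * indicator S (fst p)) * g (snd p)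
        + k (fst p) (snd p) * (f (fst p) * indicator (- S) (fst p)) * g (snd p) \<partial>(lborel \<Otimes>\<^sub>M lborel))"
    unfolding interaction_def using S
    by (intro Bochner_Integration.integral_add[symmetric] integrable_interaction[OF _ _ g k]
        density_on_mono[OF density_on_restrict[OF f(1)]] f(2)) auto
  also have "\<dots> = interaction k f g"
    unfolding interaction_def by (intro Bochner_Integration.integral_cong) (auto simp: indicator_def)
  finally show ?thesis by simp
qed

lemma mass_split:
  assumes f: "density_on l A f" "bounded A" and S: "S \<in> sets borel"
  shows "mass f = mass (\<lambda>x. f x * indicator S x) + mass (\<lambda>x. f x * indicator (- S) x)"
proof -
  have "mass (\<lambda>x. f x * indicator S x) + mass (\<lambda>x. f x * indicator (- S) x)
    = (\<integral>x. f x * indicator S x + f x * indicator (- S) x \<partial>lborel)"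
    using S by (intro Bochner_Integration.integral_add[symmetric]
        integrable_density[OF density_on_mono[OF density_on_restrict[OF f(1)]] f(2)]) auto
  also have "\<dots> = mass f"
    by (intro Bochner_Integration.integral_cong) (auto simp: indicator_def)
  finally show ?thesis by simp
qed

section \<open>The logarithmic self-energy\<close>

lemma interaction_log_plus_inverse_le:
  assumes f: "density_on l A f" "bounded A" and g: "density_on l B g" "bounded B" and e: "e > 0"
  shows "interaction (\<lambda>x y. log_plus (e / norm (x - y))) f g \<le> l * log_const * e\<^sup>2 * mass f"
proof -
  have l: "l \<ge> 0" using density_onD(2,3)[OF f(1)] order_trans by blast
  have int: "integrable (lborel \<Otimes>\<^sub>M lborel) (\<lambda>p. log_plus (e / norm (fst p - snd p)) * f (fst p) * g (snd p))"
    using integrable_interaction[OF f g log_bounded_log_plus_inverse[OF e]] .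
  have "ennreal (interaction (\<lambda>x y. log_plus (e / norm (x - y))) f g)
      = (\<integral>\<^sup>+p. ennreal (log_plus (e / norm (fst p - snd p)) * f (fst p) * g (snd p)) \<partial>(lborel \<Otimes>\<^sub>M lborel))"
    unfolding interaction_def
    by (intro nn_integral_eq_integral[symmetric] int AE_I2 mult_nonneg_nonneg log_plus_nonneg
        density_onD(2)[OF f(1)] density_onD(2)[OF g(1)])
  also have "\<dots> \<le> ennreal (l * log_const * e\<^sup>2 * mass f)"
    by (rule nn_integral_log_plus_density_le[OF f g(1) e])
  finally show ?thesis
    using l log_const_pos mass_nonneg[OF f(1)] by (simp add: ennreal_le_iff)
qed

lemma interaction_log_kernel_sym:
  assumes "density_on l A f" "bounded A" "density_on l B g" "bounded B"
  shows "interaction log_kernel f g = interaction log_kernel g f"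
proof -
  have "(\<lambda>x y. log_kernel y x) = log_kernel"
    by (simp add: log_kernel_def fun_eq_iff norm_minus_commute)
  then show ?thesis
    using interaction_sym[OF assms(1,3) log_bounded_log_kernel[OF assms(2,4)]] by simp
qed

text \<open>Measured at the natural length \<open>1 / sqrt l\<close> of a density bounded by
  \<open>l\<close>, the kernel is \<open>ln l / 2\<close> plus the logarithm of the inverse rescaled
  distance. The positive part of that logarithm costs only \<open>log_const * mass f\<close>. Its
  negative part measures spreading and is kept on the left, because concentration is read off from
  it.\<close>

lemma interaction_log_kernel_le:
  assumes f: "density_on l A f" "bounded A" and g: "density_on l B g" "bounded B" and l: "l \<ge> 1"
  shows "interaction log_kernel f g + interaction (\<lambda>x y. log_plus (sqrt l * norm (x - y))) f g
    \<le> (log_const + ln l / 2 * mass g) * mass f"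
proof -
  have sl: "sqrt l > 0" "sqrt l \<ge> 1" using l by auto
  have b: "log_bounded A B log_kernel" "log_bounded A B (\<lambda>x y. log_plus (sqrt l * norm (x - y)))"
    "log_bounded A B (\<lambda>x y. log_plus (1 / sqrt l / norm (x - y)))"
    by (intro log_bounded_log_kernel log_bounded_log_plus log_bounded_log_plus_inverse f(2) g(2);
        use sl in simp)+
  have "interaction log_kernel f g + interaction (\<lambda>x y. log_plus (sqrt l * norm (x - y))) f g
      = interaction (\<lambda>x y. log_kernel x y + log_plus (sqrt l * norm (x - y))) f g"
    by (rule interaction_add[OF f g b(1,2), symmetric])
  also have "\<dots> \<le> interaction (\<lambda>x y. ln l / 2 + log_plus (1 / sqrt l / norm (x - y))) f g"
  proof (rule interaction_mono[OF f g])
    fix x y :: "real ^ 2" assume "x \<noteq> y"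
    then show "log_kernel x y + log_plus (sqrt l * norm (x - y)) \<le> ln l / 2 + log_plus (1 / sqrt l / norm (x - y))"
      using sl l by (simp add: log_kernel_def log_plus_def ln_div ln_mult ln_sqrt max_def)
  qed (intro log_bounded_add log_bounded_const b)+
  also have "\<dots> = ln l / 2 * mass f * mass g + interaction (\<lambda>x y. log_plus (1 / sqrt l / norm (x - y))) f g"
    using interaction_add[OF f g log_bounded_const b(3)] interaction_const[OF f g] by simp
  also have "interaction (\<lambda>x y. log_plus (1 / sqrt l / norm (x - y))) f g \<le> l * log_const * (1 / sqrt l)\<^sup>2 * mass f"
    using sl by (intro interaction_log_plus_inverse_le[OF f g]) simp
  also have "l * log_const * (1 / sqrt l)\<^sup>2 * mass f = log_const * mass f"
    using l by (simp add: power_divide)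
  finally show ?thesis by (simp add: algebra_simps)
qed

lemma interaction_log_kernel_le':
  assumes "density_on l A f" "bounded A" "density_on l B g" "bounded B" "l \<ge> 1"
  shows "interaction log_kernel f g \<le> (log_const + ln l / 2 * mass g) * mass f"
  using interaction_log_kernel_le[OF assms] assms
    interaction_nonneg[of "\<lambda>x y. log_plus (sqrt l * norm (x - y))", OF log_plus_nonneg assms(1,3)] by linarith

lemma interaction_log_kernel_ge_const:
  assumes f: "density_on l A f" "bounded A" and g: "density_on l B g" "bounded B"
    and d: "\<And>x y. x \<in> A \<Longrightarrow> y \<in> B \<Longrightarrow> norm (x - y) \<le> d"
  shows "- ln d * mass f * mass g \<le> interaction log_kernel f g"
proof -
  have "- ln d * mass f * mass g = interaction (\<lambda>_ _. - ln d) f g"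
    using interaction_const[OF f g] by simp
  also have "\<dots> \<le> interaction log_kernel f g"
  proof (rule interaction_mono[OF f g log_bounded_const log_bounded_log_kernel[OF f(2) g(2)]])
    fix x y assume xy: "x \<in> A" "y \<in> B" "x \<noteq> y"
    then have "ln (norm (x - y)) \<le> ln d" using d[OF xy(1,2)] by (intro ln_mono) auto
    then show "- ln d \<le> log_kernel x y" using xy by (simp add: log_kernel_def ln_div)
  qed
  finally show ?thesis .
qed

lemma interaction_log_kernel_le_const:
  assumes f: "density_on l A f" "bounded A" and g: "density_on l B g" "bounded B"
    and d: "d > 0" "\<And>x y. x \<in> A \<Longrightarrow> y \<in> B \<Longrightarrow> d \<le> norm (x - y)"
  shows "interaction log_kernel f g \<le> - ln d * mass f * mass g"
proof -
  have "interaction log_kernel f g \<le> interaction (\<lambda>_ _. - ln d) f g"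
  proof (rule interaction_mono[OF f g log_bounded_log_kernel[OF f(2) g(2)] log_bounded_const])
    fix x y assume xy: "x \<in> A" "y \<in> B" "x \<noteq> y"
    then have "ln d \<le> ln (norm (x - y))" using d(2)[OF xy(1,2)] d(1) by (intro ln_mono) auto
    then show "log_kernel x y \<le> - ln d" using xy by (simp add: log_kernel_def ln_div)
  qed
  then show ?thesis using interaction_const[OF f g] by simp
qed

text \<open>If every point saw a mass larger than \<open>c\<close> at distance at least \<open>\<rho>\<close>, the positive part of
  \<open>ln (sqrt l * norm (x - y))\<close> would contribute more than the energy defect allows.\<close>

lemma mass_concentrates:
  assumes f: "density_on l A f" "bounded A" and l: "l \<ge> 1" and \<rho>: "\<rho> > 0" "ln l / 2 + ln \<rho> > 0"
    and E: "ln l / 2 * (mass f)\<^sup>2 - C \<le> interaction log_kernel f f"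
    and c: "C + log_const * mass f < (ln l / 2 + ln \<rho>) * (c * mass f)"
  shows "\<exists>a\<in>A. mass (\<lambda>x. f x * indicator (- ball a \<rho>) x) \<le> c"
proof (rule ccontr)
  assume "\<not> ?thesis"
  then have large: "c \<le> mass (\<lambda>x. f x * indicator (- ball a \<rho>) x)" if "a \<in> A" for a
    using that by force
  \<comment> \<open>\<open>interaction k f f\<close> integrates, over \<open>x\<close>, the mass
    that \<open>x\<close> sees at distance at least \<open>\<rho>\<close>; the negated claim makes
    it at least \<open>c * mass f\<close>.\<close>
  define k where "k x y = (if norm (x - y) < \<rho> then 0 else 1 :: real)" for x y :: "real ^ 2"
  have k: "log_bounded A A k"
  proof (rule log_bounded_bounded)
    show "case_prod k \<in> borel_measurable (lborel \<Otimes>\<^sub>M lborel)"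
      unfolding k_def case_prod_unfold by measurable
    show "\<bar>k x y\<bar> \<le> 1" for x y by (simp add: k_def)
  qed
  have int: "integrable (lborel \<Otimes>\<^sub>M lborel) (case_prod (\<lambda>x y. k x y * f x * f y))"
    using integrable_interaction[OF f f k] by (simp add: case_prod_unfold)
  have sl: "sqrt l > 0" using l by auto
  have inner: "(\<integral>y. k x y * f x * f y \<partial>lborel) = f x * mass (\<lambda>y. f y * indicator (- ball x \<rho>) y)" for x
  proof -
    have "(\<integral>y. k x y * f x * f y \<partial>lborel) = (\<integral>y. f x * (f y * indicator (- ball x \<rho>) y) \<partial>lborel)"
      by (intro Bochner_Integration.integral_cong) (auto simp: k_def indicator_def dist_norm)
    then show ?thesis by simp
  qed
  have "c * mass f = (\<integral>x. f x * c \<partial>lborel)" by simp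
  also have "\<dots> \<le> (\<integral>x. \<integral>y. k x y * f x * f y \<partial>lborel \<partial>lborel)"
  proof (rule integral_mono)
    show "integrable lborel (\<lambda>x. f x * c)" using integrable_density[OF f] by simp
    show "integrable lborel (\<lambda>x. \<integral>y. k x y * f x * f y \<partial>lborel)"
      by (rule lborel_pair.integrable_fst[OF int])
    fix x
    show "f x * c \<le> (\<integral>y. k x y * f x * f y \<partial>lborel)"
      unfolding inner using large[of x] density_onD(2,4)[OF f(1), of x]
      by (cases "x \<in> A") (auto intro: mult_left_mono)
  qed
  also have "\<dots> = interaction k f f"
    by (rule interaction_iterated(1)[OF f f k, symmetric])
  finally have "(ln l / 2 + ln \<rho>) * (c * mass f) \<le> (ln l / 2 + ln \<rho>) * interaction k f f"
    using \<rho> by (intro mult_left_mono) auto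
  also have "\<dots> = interaction (\<lambda>x y. (ln l / 2 + ln \<rho>) * k x y) f f"
    by (rule interaction_cmult[symmetric])
  also have "\<dots> \<le> interaction (\<lambda>x y. log_plus (sqrt l * norm (x - y))) f f"
  proof (rule interaction_mono[OF f f log_bounded_cmult[OF k] log_bounded_log_plus[OF f(2) f(2) sl]])
    fix x y :: "real ^ 2" assume "x \<noteq> y"
    show "(ln l / 2 + ln \<rho>) * k x y \<le> log_plus (sqrt l * norm (x - y))"
    proof (cases "norm (x - y) < \<rho>")
      case False
      then have "ln \<rho> \<le> ln (norm (x - y))" using \<rho> by (intro ln_mono) auto
      then show ?thesis
        using False l sl \<open>x \<noteq> y\<close> by (simp add: k_def log_plus_def ln_mult ln_sqrt)
    qed (simp add: k_def)
  qed
  also have "\<dots> \<le> C + log_const * mass f"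
    using interaction_log_kernel_le[OF f f l] E by (simp add: algebra_simps power2_eq_square)
  finally show False using c by simp
qed

text \<open>For a nonintegrable \<open>F\<close> both integrals have the default value 0, so users
  of this rule check measurability alone.\<close>

lemma lborel_integral_affine:
  fixes F :: "'a::euclidean_space \<Rightarrow> real"
  assumes "F \<in> borel_measurable borel" "c \<noteq> 0"
  shows "(\<integral>x. F (t + c *\<^sub>R x) \<partial>lborel) = integral\<^sup>L lborel F / \<bar>c\<bar> ^ DIM('a)"
proof -
  have "integral\<^sup>L lborel F = integral\<^sup>L (density (distr lborel borel (\<lambda>x. t + c *\<^sub>R x)) (\<lambda>_. ennreal (\<bar>c\<bar> ^ DIM('a)))) F"
    using lborel_affine[OF assms(2), of t] by simp
  also have "\<dots> = \<bar>c\<bar> ^ DIM('a) * (\<integral>x. F (t + c *\<^sub>R x) \<partial>lborel)"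
    using assms by (simp add: integral_density integral_distr)
  finally show ?thesis using assms(2) by simp
qed

text \<open>The map from \<open>x\<close> to \<open>a + s *\<^sub>R (x - b)\<close> has Jacobian
  \<open>s\<^sup>2\<close> and multiplies distances by \<open>s\<close>. Each of the two variables
  thus yields a factor \<open>1 / s\<^sup>2\<close>, and the kernel changes by the constant
  \<open>ln s\<close>.\<close>

lemma dilated_density:
  fixes b :: "real ^ 2"
  assumes q: "density_on l (ball a r) q" and s: "s > 0"
  defines "q' \<equiv> \<lambda>x. q (a + s *\<^sub>R (x - b))"
  shows "density_on l (ball b (r / s)) q'"
    and "mass q' = mass q / s\<^sup>2"
    and "interaction log_kernel q' q' = (interaction log_kernel q q + ln s * (mass q)\<^sup>2) / s ^ 4"
proof -
  have [measurable]: "q \<in> borel_measurable borel" using density_onD(1)[OF q] .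
  have af: "a + s *\<^sub>R (x - b) = (a - s *\<^sub>R b) + s *\<^sub>R x" for x
    by (simp add: algebra_simps)
  have change: "(\<integral>x. F (a + s *\<^sub>R (x - b)) \<partial>lborel) = integral\<^sup>L lborel F / s\<^sup>2"
    if "F \<in> borel_measurable borel" for F :: "real ^ 2 \<Rightarrow> real"
    unfolding af using lborel_integral_affine[OF that, of s] s by simp
  show q': "density_on l (ball b (r / s)) q'"
    unfolding density_on_def
  proof (intro conjI allI impI)
    show "q' \<in> borel_measurable borel" unfolding q'_def by measurable
    fix x
    show "0 \<le> q' x" "q' x \<le> l"
      unfolding q'_def using density_onD(2,3)[OF q] by auto
    assume "x \<notin> ball b (r / s)"
    then have "r / s \<le> norm (x - b)" by (simp add: dist_norm norm_minus_commute)
    then have "r \<le> s * norm (x - b)" using s by (simp add: pos_divide_le_eq mult.commute)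
    then have "a + s *\<^sub>R (x - b) \<notin> ball a r" using s by (simp add: dist_norm)
    then show "q' x = 0" unfolding q'_def using density_onD(4)[OF q] by blast
  qed
  show "mass q' = mass q / s\<^sup>2"
    unfolding q'_def by (rule change) measurable
  \<comment> \<open>As a single logarithm the kernel transforms exactly even on the diagonal, where
    both sides of \<open>eq\<close> are 0. The sum \<open>log_kernel x y + ln s\<close> differs
    there, so it is exchanged for \<open>?k\<close> only under the double integral.\<close>
  let ?k = "\<lambda>x y. ln (s / norm (x - y))"
  have lb: "log_bounded (ball a r) (ball a r) (\<lambda>x y. log_kernel x y + ln s)"
    by (intro log_bounded_add log_bounded_const log_bounded_log_kernel bounded_ball)
  have lb': "log_bounded (ball a r) (ball a r) ?k"
    unfolding log_bounded_def
  proof (intro conjI)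
    show "case_prod ?k \<in> borel_measurable (lborel \<Otimes>\<^sub>M lborel)"
      unfolding case_prod_unfold by measurable
    obtain M where M: "M \<ge> 0" "\<forall>x\<in>ball a r. \<forall>y\<in>ball a r. \<bar>log_kernel x y + ln s\<bar> \<le> M * (1 + log_plus (1 / norm (x - y)))"
      using lb unfolding log_bounded_def by blast
    show "\<exists>M\<ge>0. \<forall>x\<in>ball a r. \<forall>y\<in>ball a r. \<bar>?k x y\<bar> \<le> M * (1 + log_plus (1 / norm (x - y)))"
    proof (intro exI[of _ M] conjI ballI M(1))
      fix x y assume xy: "x \<in> ball a r" "y \<in> ball a r"
      show "\<bar>?k x y\<bar> \<le> M * (1 + log_plus (1 / norm (x - y)))"
      proof (cases "x = y")
        case False
        then have "?k x y = log_kernel x y + ln s"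
          using s by (simp add: log_kernel_def ln_div)
        then show ?thesis using M(2) xy by simp
      qed (use M(1) in simp)
    qed
  qed
  have eq: "log_kernel x y = ?k (a + s *\<^sub>R (x - b)) (a + s *\<^sub>R (y - b))" for x y
  proof -
    have "a + s *\<^sub>R (x - b) - (a + s *\<^sub>R (y - b)) = s *\<^sub>R (x - y)" by (simp add: algebra_simps)
    then show ?thesis unfolding log_kernel_def using s by simp
  qed
  have "interaction log_kernel q' q' = (\<integral>x. \<integral>y. log_kernel x y * q' x * q' y \<partial>lborel \<partial>lborel)"
    by (rule interaction_iterated(1)[OF q' bounded_ball q' bounded_ball
          log_bounded_log_kernel[OF bounded_ball bounded_ball]])
  also have "\<dots> = (\<integral>x. (\<integral>y. ?k (a + s *\<^sub>R (x - b)) y * q (a + s *\<^sub>R (x - b)) * q y \<partial>lborel) / s\<^sup>2 \<partial>lborel)"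
  proof (intro Bochner_Integration.integral_cong refl)
    fix x
    show "(\<integral>y. log_kernel x y * q' x * q' y \<partial>lborel) = (\<integral>y. ?k (a + s *\<^sub>R (x - b)) y * q (a + s *\<^sub>R (x - b)) * q y \<partial>lborel) / s\<^sup>2"
      unfolding eq q'_def by (rule change) measurable
  qed
  also have "\<dots> = (\<integral>x. (\<integral>y. ?k x y * q x * q y \<partial>lborel) / s\<^sup>2 \<partial>lborel) / s\<^sup>2"
    by (rule change) measurable
  also have "(\<integral>x. (\<integral>y. ?k x y * q x * q y \<partial>lborel) / s\<^sup>2 \<partial>lborel) = interaction ?k q q / s\<^sup>2"
    using interaction_iterated(1)[OF q bounded_ball q bounded_ball lb'] by simp
  also have "interaction ?k q q = interaction (\<lambda>x y. log_kernel x y + ln s) q q"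
    by (rule interaction_cong_off_diagonal[OF q bounded_ball q bounded_ball lb' lb])
       (use s in \<open>simp add: log_kernel_def ln_div\<close>)
  also have "\<dots> = interaction log_kernel q q + ln s * (mass q)\<^sup>2"
    using interaction_add[OF q bounded_ball q bounded_ball log_bounded_log_kernel log_bounded_const]
      interaction_const[OF q bounded_ball q bounded_ball]
    by (simp add: power2_eq_square)
  finally show "interaction log_kernel q' q' = (interaction log_kernel q q + ln s * (mass q)\<^sup>2) / s ^ 4"
    by (simp add: power2_eq_square power4_eq_xxxx)
qed

text \<open>Here \<open>p'\<close> is \<open>p\<close> restricted to \<open>ball a r\<close>, dilated by the factor \<open>1 / s\<close> with
  \<open>s\<^sup>2 = mass q / mass p\<close>. The dilation keeps the bound \<open>l\<close>, restores the mass and changes the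
  energy only by \<open>ln s\<close>.\<close>

lemma recentred_competitor:
  assumes p: "density_on l A p" "bounded A" and l: "l \<ge> 1"
    and d: "d \<ge> 1" "\<And>x y. x \<in> A \<Longrightarrow> y \<in> A \<Longrightarrow> norm (x - y) \<le> d"
    and r: "0 < r" "2 * r \<le> 1"
    and m: "mass (\<lambda>x. p x * indicator (- ball a (r / 2)) x) \<le> m" and m_half: "2 * m \<le> mass p" and pos: "mass p > 0"
  obtains p' where "density_on l (ball b (2 * r)) p'" "mass p' = mass p"
    "interaction log_kernel p p - m * (2 * (ln (2 / r) * mass p + log_const + ln l / 2 * m) + ln d * m + mass p)
       \<le> interaction log_kernel p' p'"
proof -
  let ?L = "interaction log_kernel"
  let ?R = "\<lambda>S x. p x * indicator S x"
  \<comment> \<open>Core and outside at radius \<open>r / 2\<close>, kept and removed part at radius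
    \<open>r\<close>. The removed part is at distance at least \<open>r / 2\<close> from
    \<open>c\<close>, so only its interaction with \<open>w\<close> can carry a factor
    \<open>ln l\<close>, and then two factors \<open>m\<close> come with it.\<close>
  define c w q \<eta> where "c = ?R (ball a (r / 2))" and "w = ?R (- ball a (r / 2))"
    and "q = ?R (ball a r)" and "\<eta> = ?R (- ball a r)"
  have dens: "density_on l (A \<inter> ball a (r / 2)) c" "density_on l (A \<inter> - ball a (r / 2)) w"
    "density_on l (A \<inter> ball a r) q" "density_on l (A \<inter> - ball a r) \<eta>"
    unfolding c_def w_def q_def \<eta>_def by (intro density_on_restrict[OF p(1)]; simp)+
  have bd: "bounded (A \<inter> S)" for S using p(2) by auto
  have masses: "mass p = mass c + mass w" "mass p = mass q + mass \<eta>"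
    unfolding c_def w_def q_def \<eta>_def by (intro mass_split[OF p]; simp)+
  have nn: "0 \<le> mass c" "0 \<le> mass w" "0 \<le> mass q" "0 \<le> mass \<eta>"
    using dens by (auto intro: mass_nonneg)
  have \<eta>w: "mass \<eta> \<le> mass w"
  proof (rule integral_mono)
    show "integrable lborel \<eta>" "integrable lborel w" using dens bd integrable_density by blast+
    fix x
    show "\<eta> x \<le> w x"
      using r density_onD(2)[OF p(1), of x] by (auto simp: \<eta>_def w_def indicator_def)
  qed
  have wm: "mass w \<le> m" using m by (simp add: w_def)
  have m0: "0 \<le> m" using wm nn by linarith
  have T: "0 \<le> ln l" using l by simp
  have lr: "0 \<le> ln (2 / r)" using r by simp
  have "?L p p = ?L q p + ?L \<eta> p"
    unfolding q_def \<eta>_def by (rule interaction_split_left[OF p p log_bounded_log_kernel[OF p(2) p(2)]]) simp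
  also have "?L q p = ?L p q"
    by (rule interaction_log_kernel_sym[OF dens(3) bd p])
  also have "?L p q = ?L q q + ?L \<eta> q"
    unfolding q_def \<eta>_def by (rule interaction_split_left[OF p density_on_restrict[OF p(1)] _ log_bounded_log_kernel]) (use p bd in auto)
  also have "?L \<eta> q = ?L \<eta> p - ?L \<eta> \<eta>"
  proof -
    have "?L p \<eta> = ?L q \<eta> + ?L \<eta> \<eta>"
      unfolding q_def \<eta>_def by (rule interaction_split_left[OF p density_on_restrict[OF p(1)] _ log_bounded_log_kernel]) (use p bd in auto)
    then show ?thesis
      using interaction_log_kernel_sym[OF dens(4) bd p] interaction_log_kernel_sym[OF dens(4) bd dens(3) bd] by simp
  qed
  finally have Lp: "?L p p = ?L q q + 2 * ?L \<eta> p - ?L \<eta> \<eta>" by simp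
  have "?L \<eta> p = ?L p \<eta>"
    by (rule interaction_log_kernel_sym[OF dens(4) bd p])
  also have "\<dots> = ?L c \<eta> + ?L w \<eta>"
    unfolding c_def w_def by (rule interaction_split_left[OF p dens(4) bd log_bounded_log_kernel[OF p(2) bd]]) simp
  also have "?L c \<eta> \<le> - ln (r / 2) * mass c * mass \<eta>"
  proof (rule interaction_log_kernel_le_const[OF dens(1) bd dens(4) bd])
    fix x y assume "x \<in> A \<inter> ball a (r / 2)" "y \<in> A \<inter> - ball a r"
    then have "norm (x - a) \<le> r / 2" "r \<le> norm (y - a)"
      by (auto simp: dist_norm norm_minus_commute)
    moreover have "norm (y - a) \<le> norm (x - y) + norm (x - a)"
      using norm_triangle_ineq4[of "x - a" "x - y"] by simp
    ultimately show "r / 2 \<le> norm (x - y)" by linarith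
  qed (use r in simp)
  also have "- ln (r / 2) * mass c * mass \<eta> \<le> ln (2 / r) * mass p * m"
  proof -
    have "- ln (r / 2) = ln (2 / r)" using r by (simp add: ln_div)
    moreover have "mass c \<le> mass p" "mass \<eta> \<le> m" using masses nn \<eta>w wm by linarith+
    ultimately show ?thesis using lr nn pos by (simp only:) (intro mult_mono mult_nonneg_nonneg; simp)
  qed
  also have "?L w \<eta> \<le> (log_const + ln l / 2 * m) * m"
  proof -
    have "?L w \<eta> \<le> (log_const + ln l / 2 * mass \<eta>) * mass w"
      by (rule interaction_log_kernel_le'[OF dens(2) bd dens(4) bd l])
    also have "\<dots> \<le> (log_const + ln l / 2 * m) * m"
      using log_const_pos T nn \<eta>w wm m0
      by (intro mult_mono add_mono mult_nonneg_nonneg add_nonneg_nonneg) auto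
    finally show ?thesis .
  qed
  finally have L\<eta>p: "?L \<eta> p \<le> ln (2 / r) * mass p * m + (log_const + ln l / 2 * m) * m" by simp
  have "- ln d * mass \<eta> * mass \<eta> \<le> ?L \<eta> \<eta>"
    by (rule interaction_log_kernel_ge_const[OF dens(4) bd dens(4) bd]) (use d in auto)
  moreover have "ln d * mass \<eta> * mass \<eta> \<le> ln d * m * m"
    using d(1) nn \<eta>w wm m0 by (intro mult_mono) auto
  ultimately have L\<eta>\<eta>: "- (ln d * m * m) \<le> ?L \<eta> \<eta>" by linarith
  have qball: "density_on l (ball a r) q" using dens(3) by (rule density_on_mono) simp
  \<comment> \<open>\<open>2 * r \<le> 1\<close> bounds the diameter by 1, where the kernel is
    nonnegative. The sign is used when the energy is divided by
    \<open>s ^ 4 \<le> 1\<close>.\<close>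
  have Lq: "0 \<le> ?L q q"
  proof -
    have "- ln 1 * mass q * mass q \<le> ?L q q"
    proof (rule interaction_log_kernel_ge_const[OF qball bounded_ball qball bounded_ball])
      fix x y assume "x \<in> ball a r" "y \<in> ball a r"
      then have "norm (x - a) < r" "norm (y - a) < r" by (auto simp: dist_norm norm_minus_commute)
      then show "norm (x - y) \<le> 1"
        using norm_triangle_ineq4[of "x - a" "y - a"] r by simp
    qed
    then show ?thesis by simp
  qed
  \<comment> \<open>The removed fraction of the mass. Being at most one half it gives
    \<open>s \<ge> 1 / 2\<close>, so the dilated density fits into radius
    \<open>2 * r\<close>.\<close>
  define t where "t = mass \<eta> / mass p"
  have t: "0 \<le> t" "t \<le> 1 / 2" "mass p * t \<le> m"
    using nn \<eta>w wm m_half pos by (auto simp: t_def field_simps)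
  define s where "s = sqrt (1 - t)"
  have s2: "s\<^sup>2 = 1 - t" using t by (simp add: s_def)
  have s: "1 / 2 \<le> s" "s \<le> 1" "s > 0"
  proof -
    have "(1 / 2)\<^sup>2 \<le> s\<^sup>2" unfolding s2 using t by (simp add: power2_eq_square)
    then show "1 / 2 \<le> s" using s_def t by (auto intro: power2_le_imp_le)
    then show "s > 0" by simp
    show "s \<le> 1" using t by (simp add: s_def)
  qed
  have mq: "mass q = mass p * s\<^sup>2" using masses(2) pos by (simp add: s2 t_def field_simps)
  \<comment> \<open>For \<open>t \<le> 1 / 2\<close> one has
    \<open>ln (1 - t) \<ge> - 2 * t\<close>, and the square root in \<open>s\<close> halves this to
    \<open>- ln s \<le> t\<close>.\<close>
  have lns: "- ln s * (mass p)\<^sup>2 \<le> m * mass p"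
  proof -
    have "- t - 2 * t\<^sup>2 \<le> ln (1 - t)"
      using t by (intro ln_one_minus_pos_lower_bound) auto
    moreover have "2 * t\<^sup>2 \<le> t"
      using mult_right_mono[of "2 * t" 1 t] t by (simp add: power2_eq_square)
    moreover have "ln (1 - t) = 2 * ln s" using t by (simp add: s_def ln_sqrt)
    ultimately have "- ln s \<le> t" by linarith
    then have "- ln s * (mass p)\<^sup>2 \<le> t * (mass p)\<^sup>2" by (intro mult_right_mono) auto
    also have "\<dots> \<le> m * mass p"
      using mult_right_mono[OF t(3), of "mass p"] pos by (simp add: power2_eq_square ac_simps)
    finally show ?thesis .
  qed
  show thesis
  proof (rule that)
    let ?p' = "\<lambda>x. q (a + s *\<^sub>R (x - b))"
    show "density_on l (ball b (2 * r)) ?p'"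
    proof (rule density_on_mono[OF dilated_density(1)[OF qball s(3)]])
      have "r / s \<le> 2 * r" using s r by (simp add: divide_le_eq)
      then show "ball b (r / s) \<subseteq> ball b (2 * r)" by auto
    qed
    show "mass ?p' = mass p"
      unfolding dilated_density(2)[OF qball s(3)] using mq s by simp
    have "?L ?p' ?p' = (?L q q + ln s * (mass q)\<^sup>2) / s ^ 4"
      by (rule dilated_density(3)[OF qball s(3)])
    also have "\<dots> = ?L q q / s ^ 4 + ln s * (mass p)\<^sup>2"
      using s by (simp add: mq add_divide_distrib power_mult_distrib power2_eq_square power4_eq_xxxx)
    also have "\<dots> \<ge> ?L q q + ln s * (mass p)\<^sup>2"
    proof -
      have "s ^ 4 \<le> 1" using s by (intro power_le_one) auto
      then have "?L q q * s ^ 4 \<le> ?L q q" using Lq by (simp add: mult_left_le)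
      then show ?thesis using s by (simp add: pos_le_divide_eq)
    qed
    finally have "?L q q + ln s * (mass p)\<^sup>2 \<le> ?L ?p' ?p'" .
    with Lp L\<eta>p L\<eta>\<eta> lns
    show "?L p p - m * (2 * (ln (2 / r) * mass p + log_const + ln l / 2 * m) + ln d * m + mass p) \<le> ?L ?p' ?p'"
      by (simp add: algebra_simps)
  qed
qed

section \<open>Vorticities as differences of densities\<close>

lemma AE_lborel_imp_AE_lebesgue_on:
  assumes "AE x in lborel. P x" "S \<in> sets lebesgue"
  shows "AE x in lebesgue_on S. P x"
  using AE_completion[OF assms(1)] assms(2) by (auto simp: AE_restrict_space_iff)

lemma borel_measurable_lebesgue_onI:
  "f \<in> borel_measurable borel \<Longrightarrow> f \<in> borel_measurable (lebesgue_on S)"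
  by (intro measurable_restrict_space1 measurable_completion) simp

lemma lebesgue_on_integral_eq_lborel:
  fixes f :: "'a::euclidean_space \<Rightarrow> 'b::{banach, second_countable_topology}"
  assumes "f \<in> borel_measurable borel" "S \<in> sets borel" "\<And>x. x \<notin> S \<Longrightarrow> f x = 0"
  shows "integral\<^sup>L (lebesgue_on S) f = integral\<^sup>L lborel f"
proof -
  have "integral\<^sup>L (lebesgue_on S) f = integral\<^sup>L lebesgue (\<lambda>x. indicator S x *\<^sub>R f x)"
    using assms(2) by (intro integral_restrict_space) auto
  also have "(\<lambda>x. indicator S x *\<^sub>R f x) = f"
    using assms(3) by (auto simp: indicator_def)
  also have "integral\<^sup>L lebesgue f = integral\<^sup>L lborel f"
    using assms(1) by (intro integral_completion) simp
  finally show ?thesis .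
qed

text \<open>Completeness of Lebesgue measure transfers measurability from \<open>g\<close> to
  \<open>f\<close>. This serves integrands containing \<open>G\<close>, which are identified almost
  everywhere with measurable ones.\<close>

lemma integral_lebesgue_on_cong_AE:
  fixes f g :: "'a::euclidean_space \<Rightarrow> 'b::euclidean_space"
  assumes S: "S \<in> sets lebesgue" and g: "g \<in> borel_measurable (lebesgue_on S)"
    and ae: "AE x in lebesgue_on S. f x = g x"
  shows "integral\<^sup>L (lebesgue_on S) f = integral\<^sup>L (lebesgue_on S) g"
proof (rule integral_cong_AE[OF _ g ae])
  have "(\<lambda>x. if x \<in> S then f x else 0) \<in> borel_measurable lebesgue"
  proof (rule borel_measurable_AE)
    show "(\<lambda>x. if x \<in> S then g x else 0) \<in> borel_measurable lebesgue"
      using g S by (simp add: borel_measurable_if)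
    have "AE x in lebesgue. x \<in> S \<longrightarrow> f x = g x"
      using ae S by (simp add: AE_restrict_space_iff)
    then show "AE x in lebesgue. (if x \<in> S then g x else 0) = (if x \<in> S then f x else 0)"
      by eventually_elim auto
  qed
  then show "f \<in> borel_measurable (lebesgue_on S)"
    using S by (simp add: borel_measurable_if)
qed

lemma vortex_component_density:
  assumes D: "open D" and B: "B \<subseteq> D" "B \<in> sets borel" and "l \<ge> 0" "\<kappa> \<noteq> 0"
    and f: "f \<in> vortex_component D l \<kappa> B"
  obtains p where "density_on l B p" "mass p = \<bar>\<kappa>\<bar>" "AE x in lebesgue_on D. f x = sgn \<kappa> * p x"
proof -
  have D': "D \<in> sets lebesgue" "D \<in> sets borel" using D by auto
  have fm: "f \<in> borel_measurable (lebesgue_on D)"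
    and f1: "AE x in lebesgue_on D. 0 \<le> sgn \<kappa> * f x \<and> sgn \<kappa> * f x \<le> l"
    and f2: "integral\<^sup>L (lebesgue_on D) f = \<kappa>"
    and f3: "AE x in lebesgue_on D. x \<notin> B \<longrightarrow> f x = 0"
    using f unfolding vortex_component_def L_infinity_def by auto
  have "(\<lambda>x. if x \<in> D then f x else 0) \<in> borel_measurable lebesgue"
    using fm D'(1) by (simp add: borel_measurable_if)
  then obtain g where g: "g \<in> borel_measurable lborel" "AE x in lborel. (if x \<in> D then f x else 0) = g x"
    using completion_ex_borel_measurable_real by blast
  have [measurable]: "g \<in> borel_measurable borel" "B \<in> sets borel" using g(1) B by auto
  \<comment> \<open>Clamping to the interval from 0 to \<open>l\<close> and cutting off outside
    \<open>B\<close> turns the almost-everywhere constraints into pointwise ones without changing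
    the class.\<close>
  define p where "p x = max 0 (min l (sgn \<kappa> * g x)) * indicator B x" for x
  have p: "density_on l B p"
    unfolding density_on_def
  proof (intro conjI allI impI)
    show "p \<in> borel_measurable borel" unfolding p_def by measurable
  qed (use \<open>l \<ge> 0\<close> in \<open>auto simp: p_def indicator_def\<close>)
  have ae: "AE x in lebesgue_on D. f x = sgn \<kappa> * p x"
    using f1 f3 AE_lborel_imp_AE_lebesgue_on[OF g(2) D'(1)] AE_space
  proof eventually_elim
    case (elim x)
    then have "x \<in> D" by simp
    then have gx: "g x = f x" using elim by simp
    have "p x = sgn \<kappa> * f x"
      using elim by (cases "x \<in> B") (auto simp: p_def gx)
    moreover have "sgn \<kappa> * sgn \<kappa> = 1" using \<open>\<kappa> \<noteq> 0\<close> by (simp add: sgn_if)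
    ultimately show ?case by (simp flip: mult.assoc)
  qed
  have "integral\<^sup>L (lebesgue_on D) f = integral\<^sup>L (lebesgue_on D) (\<lambda>x. sgn \<kappa> * p x)"
    using density_onD(1)[OF p]
    by (intro integral_lebesgue_on_cong_AE[OF D'(1) _ ae] borel_measurable_lebesgue_onI) simp
  also have "\<dots> = sgn \<kappa> * mass p"
    using density_onD(1)[OF p] density_onD(4)[OF p] B D'(2)
    by (subst lebesgue_on_integral_eq_lborel) auto
  finally have "\<kappa> = sgn \<kappa> * mass p" using f2 by simp
  then have "mass p = \<bar>\<kappa>\<bar>"
    using \<open>\<kappa> \<noteq> 0\<close> by (auto simp: sgn_if abs_if split: if_splits)
  from that[OF p this ae] show thesis .
qed

lemma density_vortex_component:
  assumes "open D" "B \<subseteq> D" "\<kappa> \<noteq> 0" and p: "density_on l B p" "mass p = \<bar>\<kappa>\<bar>"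
  shows "(\<lambda>x. sgn \<kappa> * p x) \<in> vortex_component D l \<kappa> B"
proof -
  have m: "(\<lambda>x. sgn \<kappa> * p x) \<in> borel_measurable borel"
    using density_onD(1)[OF p(1)] by simp
  have s: "sgn \<kappa> * (sgn \<kappa> * p x) = p x" for x using \<open>\<kappa> \<noteq> 0\<close> by (simp add: sgn_if)
  have "integral\<^sup>L (lebesgue_on D) (\<lambda>x. sgn \<kappa> * p x) = sgn \<kappa> * mass p"
    using density_onD(4)[OF p(1)] assms
    by (subst lebesgue_on_integral_eq_lborel[OF m]) auto
  also have "\<dots> = \<kappa>" by (simp add: p(2) sgn_mult_abs)
  finally show ?thesis
    unfolding vortex_component_def L_infinity_def
    using borel_measurable_lebesgue_onI[OF m] density_onD(2-4)[OF p(1)] \<open>\<kappa> \<noteq> 0\<close>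
    by (auto simp: s abs_mult abs_sgn_eq intro!: exI[of _ l] AE_I2)
qed

lemma admissible_densities:
  assumes D: "open D" and B: "B1 \<subseteq> D" "B2 \<subseteq> D" "B1 \<in> sets borel" "B2 \<in> sets borel"
    and "l \<ge> 0" "\<kappa>1 > 0" "\<kappa>2 < 0" and w: "w \<in> admissible D l \<kappa>1 B1 \<kappa>2 B2"
  obtains p1 p2 where "density_on l B1 p1" "mass p1 = \<kappa>1" "density_on l B2 p2" "mass p2 = - \<kappa>2"
    "AE x in lebesgue_on D. w x = p1 x - p2 x"
proof -
  obtain w1 w2 where w1: "w1 \<in> vortex_component D l \<kappa>1 B1" and w2: "w2 \<in> vortex_component D l \<kappa>2 B2"
    and ae: "AE x in lebesgue_on D. w x = w1 x + w2 x"
    using w unfolding admissible_def by blast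
  obtain p1 where p1: "density_on l B1 p1" "mass p1 = \<bar>\<kappa>1\<bar>" "AE x in lebesgue_on D. w1 x = sgn \<kappa>1 * p1 x"
    by (rule vortex_component_density[OF D B(1,3) \<open>l \<ge> 0\<close> _ w1]) (use \<open>\<kappa>1 > 0\<close> in auto)
  obtain p2 where p2: "density_on l B2 p2" "mass p2 = \<bar>\<kappa>2\<bar>" "AE x in lebesgue_on D. w2 x = sgn \<kappa>2 * p2 x"
    by (rule vortex_component_density[OF D B(2,4) \<open>l \<ge> 0\<close> _ w2]) (use \<open>\<kappa>2 < 0\<close> in auto)
  have "AE x in lebesgue_on D. w x = p1 x - p2 x"
    using ae p1(3) p2(3) by eventually_elim (use \<open>\<kappa>1 > 0\<close> \<open>\<kappa>2 < 0\<close> in simp)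
  then show thesis
    using p1 p2 \<open>\<kappa>1 > 0\<close> \<open>\<kappa>2 < 0\<close> by (intro that) auto
qed

lemma densities_admissible:
  assumes D: "open D" and B: "B1 \<subseteq> D" "B2 \<subseteq> D" and "\<kappa>1 > 0" "\<kappa>2 < 0"
    and p: "density_on l B1 p1" "mass p1 = \<kappa>1" "density_on l B2 p2" "mass p2 = - \<kappa>2"
  shows "(\<lambda>x. p1 x - p2 x) \<in> admissible D l \<kappa>1 B1 \<kappa>2 B2"
proof -
  have v: "(\<lambda>x. sgn \<kappa>1 * p1 x) \<in> vortex_component D l \<kappa>1 B1" "(\<lambda>x. sgn \<kappa>2 * p2 x) \<in> vortex_component D l \<kappa>2 B2"
    using assms by (intro density_vortex_component; simp)+
  have b: "(\<lambda>x. p1 x - p2 x) \<in> L_infinity D"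
    unfolding L_infinity_def
  proof (intro CollectI conjI exI[of _ l])
    show "(\<lambda>x. p1 x - p2 x) \<in> borel_measurable (lebesgue_on D)"
      using density_onD(1)[OF p(1)] density_onD(1)[OF p(3)]
      by (intro borel_measurable_lebesgue_onI borel_measurable_diff)
    show "AE x in lebesgue_on D. \<bar>p1 x - p2 x\<bar> \<le> l"
    proof (rule AE_I2)
      fix x
      show "\<bar>p1 x - p2 x\<bar> \<le> l"
        using density_onD(2,3)[OF p(1), of x] density_onD(2,3)[OF p(3), of x] by linarith
    qed
  qed
  have "AE x in lebesgue_on D. p1 x - p2 x = sgn \<kappa>1 * p1 x + sgn \<kappa>2 * p2 x"
    using \<open>\<kappa>1 > 0\<close> \<open>\<kappa>2 < 0\<close> by simp
  then show ?thesis
    unfolding admissible_def mem_Collect_eq by (rule conjI[OF b bexI[OF bexI[OF _ v(2)] v(1)]])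
qed

lemma interaction_diff_diff:
  assumes p: "density_on l A p" "bounded A" and q: "density_on l B q" "bounded B" and k: "log_bounded (A \<union> B) (A \<union> B) k"
  shows "(\<integral>y. \<integral>x. k x y * (p x - q x) * (p y - q y) \<partial>lborel \<partial>lborel)
    = interaction k p p + interaction k q q - interaction k p q - interaction k q p"
proof -
  let ?I = "\<lambda>f g z. k (fst z) (snd z) * f (fst z) * g (snd z)"
  have p': "density_on l (A \<union> B) p" and q': "density_on l (A \<union> B) q" and b: "bounded (A \<union> B)"
    using p q density_on_mono by auto
  have int: "integrable (lborel \<Otimes>\<^sub>M lborel) (?I p p)" "integrable (lborel \<Otimes>\<^sub>M lborel) (?I q q)"
    "integrable (lborel \<Otimes>\<^sub>M lborel) (?I p q)" "integrable (lborel \<Otimes>\<^sub>M lborel) (?I q p)"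
    by (rule integrable_interaction[OF p' b p' b k] integrable_interaction[OF q' b q' b k]
        integrable_interaction[OF p' b q' b k] integrable_interaction[OF q' b p' b k])+
  have eq: "case_prod (\<lambda>x y. k x y * (p x - q x) * (p y - q y)) = (\<lambda>z. ?I p p z + ?I q q z - ?I p q z - ?I q p z)"
    by (auto simp: fun_eq_iff algebra_simps)
  have "integrable (lborel \<Otimes>\<^sub>M lborel) (case_prod (\<lambda>x y. k x y * (p x - q x) * (p y - q y)))"
    unfolding eq using int by auto
  from lborel_pair.integral_snd[OF this]
  have "(\<integral>y. \<integral>x. k x y * (p x - q x) * (p y - q y) \<partial>lborel \<partial>lborel)
      = (\<integral>z. ?I p p z + ?I q q z - ?I p q z - ?I q p z \<partial>(lborel \<Otimes>\<^sub>M lborel))"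
    unfolding eq by simp
  also have "\<dots> = interaction k p p + interaction k q q - interaction k p q - interaction k q p"
    unfolding interaction_def using int by simp
  finally show ?thesis .
qed

text \<open>\<open>G\<close> agrees with the measurable kernel \<open>k\<close> only off the
  diagonal of \<open>A \<union> B\<close>. Elsewhere the vorticity vanishes almost everywhere, and
  for fixed \<open>y\<close> the diagonal is one point, so \<open>k\<close> can replace
  \<open>G\<close> first in the inner and then in the outer integral.\<close>

lemma kinetic_energy_densities:
  assumes D: "open D" and p: "density_on l A p" "bounded A" and q: "density_on l B q" "bounded B"
    and sub: "A \<union> B \<subseteq> D"
    and k: "log_bounded (A \<union> B) (A \<union> B) k" "\<And>x y. x \<in> A \<union> B \<Longrightarrow> y \<in> A \<union> B \<Longrightarrow> x \<noteq> y \<Longrightarrow> G x y = k x y"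
    and w: "AE x in lebesgue_on D. w x = p x - q x"
  shows "kinetic_energy D G w
    = 1 / 2 * (interaction k p p + interaction k q q - interaction k p q - interaction k q p)"
proof -
  define F where "F x = p x - q x" for x
  have [measurable]: "F \<in> borel_measurable borel"
    unfolding F_def using density_onD(1)[OF p(1)] density_onD(1)[OF q(1)] by simp
  have F0: "F x = 0" if "x \<notin> A \<union> B" for x
    using that density_onD(4)[OF p(1)] density_onD(4)[OF q(1)] by (simp add: F_def)
  have km [measurable]: "(\<lambda>z. k (fst z) (snd z)) \<in> borel_measurable (lborel \<Otimes>\<^sub>M lborel)"
    using log_bounded_measurable[OF k(1)] .
  have D': "D \<in> sets lebesgue" "D \<in> sets borel" using D by auto
  have kx: "(\<lambda>x. k x y) \<in> borel_measurable borel" for y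
    using measurable_compose[of "\<lambda>x. (x, y)" lborel "lborel \<Otimes>\<^sub>M lborel" "\<lambda>z. k (fst z) (snd z)" borel] km by simp
  have meas: "(\<lambda>x. k x y * F x * F y) \<in> borel_measurable borel" for y
    using kx by (intro borel_measurable_times) auto
  have inner: "(LINT x|lebesgue_on D. G x y * w x * w y) = (\<integral>x. k x y * F x * F y \<partial>lborel)"
    if y: "w y = F y" "y \<in> D" for y
  proof (cases "y \<in> A \<union> B")
    case False
    then show ?thesis using F0[OF False] y by simp
  next
    case True
    have "(LINT x|lebesgue_on D. G x y * w x * w y) = (LINT x|lebesgue_on D. k x y * F x * F y)"
    proof (rule integral_lebesgue_on_cong_AE[OF D'(1)])
      have ne: "AE x in lebesgue_on D. x \<noteq> y"
        by (rule AE_lborel_imp_AE_lebesgue_on[OF AE_lborel_singleton D'(1)])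
      show "AE x in lebesgue_on D. G x y * w x * w y = k x y * F x * F y"
        using w ne
      proof eventually_elim
        case (elim x)
        then show ?case
          using k(2)[of x y] True F0[of x] y by (cases "x \<in> A \<union> B") (auto simp: F_def)
      qed
      show "(\<lambda>x. k x y * F x * F y) \<in> borel_measurable (lebesgue_on D)"
        by (rule borel_measurable_lebesgue_onI[OF meas])
    qed
    also have "\<dots> = (\<integral>x. k x y * F x * F y \<partial>lborel)"
      using meas F0 sub D'(2) by (intro lebesgue_on_integral_eq_lborel) auto
    finally show ?thesis .
  qed
  have om: "(\<lambda>y. \<integral>x. k x y * F x * F y \<partial>lborel) \<in> borel_measurable borel"
  proof -
    have "(\<lambda>z. k (snd z) (fst z)) \<in> borel_measurable (lborel \<Otimes>\<^sub>M lborel)"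
      using measurable_compose[OF measurable_pair_swap' km] by (simp add: case_prod_unfold)
    then have "(\<lambda>(y, x). k x y * F x * F y) \<in> borel_measurable (lborel \<Otimes>\<^sub>M lborel)"
      unfolding case_prod_unfold by (intro borel_measurable_times) simp_all
    then show ?thesis
      using lborel.borel_measurable_lebesgue_integral[of "\<lambda>y x. k x y * F x * F y" lborel] by simp
  qed
  have "(LINT y|lebesgue_on D. LINT x|lebesgue_on D. G x y * w x * w y)
      = (LINT y|lebesgue_on D. \<integral>x. k x y * F x * F y \<partial>lborel)"
  proof (rule integral_lebesgue_on_cong_AE[OF D'(1)])
    show "AE y in lebesgue_on D. (LINT x|lebesgue_on D. G x y * w x * w y) = (\<integral>x. k x y * F x * F y \<partial>lborel)"
      using w AE_space by eventually_elim (use inner in \<open>simp add: F_def\<close>)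
    show "(\<lambda>y. \<integral>x. k x y * F x * F y \<partial>lborel) \<in> borel_measurable (lebesgue_on D)"
      using om by (rule borel_measurable_lebesgue_onI)
  qed
  also have "\<dots> = (\<integral>y. \<integral>x. k x y * F x * F y \<partial>lborel \<partial>lborel)"
    using om F0 sub D'(2) by (intro lebesgue_on_integral_eq_lborel) auto
  finally show ?thesis
    unfolding kinetic_energy_def F_def using interaction_diff_diff[OF p q k(1)] by simp
qed

section \<open>Concentration and localization of maximizers\<close>

text \<open>The threshold for \<open>l\<close> depends only on \<open>k\<close>, \<open>C\<close>
  and \<open>\<rho>\<close>; it is found before the density and its support are chosen. The energy
  defect stays bounded while spreading is penalized at rate \<open>ln l\<close>, hence the escaping
  mass is O(1 / ln l).\<close>

lemma mass_concentrates_rate: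
  assumes k: "k > 0" and C: "C \<ge> 0" and \<rho>: "\<rho> > 0"
  shows "\<forall>\<^sub>F l in at_top. \<forall>A f. density_on l A f \<longrightarrow> bounded A \<longrightarrow> mass f = k \<longrightarrow>
    ln l / 2 * k\<^sup>2 - C \<le> interaction log_kernel f f \<longrightarrow>
    (\<exists>a\<in>A. mass (\<lambda>x. f x * indicator (- ball a \<rho>) x) \<le> 8 * (C / k + log_const + 1) / ln l)"
proof -
  have "\<forall>\<^sub>F l in at_top. max 1 (- 4 * ln \<rho>) < ln (l :: real)"
    using filterlim_at_top_dense[THEN iffD1, OF ln_at_top] by blast
  moreover have "\<forall>\<^sub>F l :: real in at_top. 1 \<le> l" by (rule eventually_ge_at_top)
  ultimately show ?thesis
  proof eventually_elim
    case (elim l)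
    show ?case
    proof (intro allI impI)
      fix A f
      assume f: "density_on l A f" "bounded A" and k': "mass f = k"
        and E: "ln l / 2 * k\<^sup>2 - C \<le> interaction log_kernel f f"
      have big: "ln l / 2 + ln \<rho> \<ge> ln l / 4" "ln l > 1" using elim by auto
      \<comment> \<open>A factor 4 of the 8 pays for
        \<open>ln l / 2 + ln \<rho> \<ge> ln l / 4\<close>, which is what
        \<open>ln l > - 4 * ln \<rho>\<close> provides. The remaining 2 is slack for the strict
        inequality.\<close>
      let ?K = "8 * (C / k + log_const + 1)"
      have K0: "?K \<ge> 0" using C k log_const_pos by simp
      have "C + X < 2 * (C + X + k)" if "X > 0" for X :: real
        using that k C by (simp add: distrib_left)
      from this[OF mult_pos_pos[OF log_const_pos k]]
      have "C + log_const * mass f < 2 * (C + log_const * k + k)"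
        unfolding k' .
      also have "\<dots> = ln l / 4 * (?K / ln l * mass f)"
        using big k by (simp add: k' field_simps)
      also have "\<dots> \<le> (ln l / 2 + ln \<rho>) * (?K / ln l * mass f)"
        using big K0 k k' by (intro mult_right_mono) auto
      finally have "C + log_const * mass f < (ln l / 2 + ln \<rho>) * (?K / ln l * mass f)" .
      moreover have "ln l / 2 + ln \<rho> > 0" using big by linarith
      ultimately show "\<exists>a\<in>A. mass (\<lambda>x. f x * indicator (- ball a \<rho>) x) \<le> ?K / ln l"
        using E k' elim by (intro mass_concentrates[OF f _ \<rho>]) auto
    qed
  qed
qed

text \<open>A disc of constant density \<open>l\<close> and mass \<open>k\<close> has radius
  \<open>\<epsilon>\<close> with \<open>pi * l * \<epsilon>\<^sup>2 = k\<close>. Bounding all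
  distances by its diameter already gives the leading term \<open>ln l / 2 * k\<^sup>2\<close>; the
  lower bound on \<open>l\<close> puts \<open>\<epsilon>\<close> below
  \<open>\<delta>\<close>.\<close>

lemma disc_density_exists:
  assumes k: "k > 0" and \<delta>: "\<delta> > 0"
  shows "\<forall>\<^sub>F l in at_top. \<exists>p. density_on l (ball a \<delta>) p \<and> mass p = k \<and>
    ln l / 2 * k\<^sup>2 - k\<^sup>2 * (ln 2 + ln (k / pi) / 2) \<le> interaction log_kernel p p"
proof -
  have "\<forall>\<^sub>F l in at_top. max 0 (k / (pi * \<delta>\<^sup>2)) < l" by (rule eventually_gt_at_top)
  then show ?thesis
  proof eventually_elim
    case (elim l)
    then have l: "l > 0" "k / (pi * \<delta>\<^sup>2) < l" by auto
    define \<epsilon> where "\<epsilon> = sqrt (k / (pi * l))"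
    have \<epsilon>: "\<epsilon> > 0" "pi * l * \<epsilon>\<^sup>2 = k" using k l by (auto simp: \<epsilon>_def)
    have "k / (pi * l) < \<delta>\<^sup>2" using l \<delta> by (simp add: field_simps)
    then have "\<epsilon> < \<delta>" unfolding \<epsilon>_def using \<delta> real_less_lsqrt k l by (simp add: real_less_lsqrt)
    define p where "p x = l * indicator (ball a \<epsilon>) x" for x
    have p: "density_on l (ball a \<epsilon>) p"
      unfolding density_on_def p_def[abs_def] using l by (auto simp: indicator_def)
    have m: "mass p = k"
      using \<epsilon> by (simp add: p_def[abs_def] content_ball unit_ball_vol_2 mult.commute mult.left_commute)
    have "ln (2 * \<epsilon>) = ln 2 + (ln (k / pi) - ln l) / 2"
      using \<epsilon>(1) k l by (simp add: \<epsilon>_def ln_mult ln_sqrt ln_div)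
    then have "ln l / 2 - (ln 2 + ln (k / pi) / 2) = - ln (2 * \<epsilon>)"
      by (simp add: diff_divide_distrib)
    then have "(ln l / 2 - (ln 2 + ln (k / pi) / 2)) * k\<^sup>2 = - ln (2 * \<epsilon>) * mass p * mass p"
      unfolding m power2_eq_square by (simp only: mult.assoc)
    then have "ln l / 2 * k\<^sup>2 - k\<^sup>2 * (ln 2 + ln (k / pi) / 2) = - ln (2 * \<epsilon>) * mass p * mass p"
      by (simp add: algebra_simps)
    also have "\<dots> \<le> interaction log_kernel p p"
    proof (rule interaction_log_kernel_ge_const[OF p bounded_ball p bounded_ball])
      fix x y assume "x \<in> ball a \<epsilon>" "y \<in> ball a \<epsilon>"
      then show "norm (x - y) \<le> 2 * \<epsilon>"
        using dist_triangle[of x y a] by (simp add: dist_norm norm_minus_commute)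
    qed
    finally show ?case
      using m density_on_mono[OF p subset_ball[of \<epsilon> \<delta> a]] \<open>\<epsilon> < \<delta>\<close> by (intro exI[of _ p]) auto
  qed
qed

lemma mass_mono_indicator:
  assumes p: "density_on l A p" "bounded A" and "S \<subseteq> T" "S \<in> sets borel" "T \<in> sets borel"
  shows "mass (\<lambda>x. p x * indicator S x) \<le> mass (\<lambda>x. p x * indicator T x)"
proof (rule integral_mono)
  show "integrable lborel (\<lambda>x. p x * indicator S x)" "integrable lborel (\<lambda>x. p x * indicator T x)"
    using assms(4,5) p(2) by (auto intro!: integrable_density[OF density_on_restrict[OF p(1)]])
  fix x
  show "p x * indicator S x \<le> p x * indicator T x"
    using density_onD(2)[OF p(1), of x] assms(3) by (auto simp: indicator_def)
qed

text \<open>The deviation of \<open>k\<close> from \<open>v\<close> is at most \<open>e\<close> if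
  both points are in their balls and at most \<open>2 * M\<close> otherwise. \<open>U\<close>
  dominates both cases, as \<open>i + j \<ge> 1\<close> once a point has escaped, and each indicator
  integrates to at most \<open>m\<close> times the other mass.\<close>

lemma interaction_near_point:
  assumes p: "density_on l A p" "bounded A" and q: "density_on l B q" "bounded B" and k: "log_bounded A B k"
    and M: "\<And>x y. x \<in> A \<Longrightarrow> y \<in> B \<Longrightarrow> \<bar>k x y\<bar> \<le> M" "\<bar>v\<bar> \<le> M"
    and near: "\<And>x y. x \<in> A \<inter> ball a r \<Longrightarrow> y \<in> B \<inter> ball b r \<Longrightarrow> \<bar>k x y - v\<bar> \<le> e" and e: "e \<ge> 0"
    and m: "mass (\<lambda>x. p x * indicator (- ball a r) x) \<le> m" "mass (\<lambda>x. q x * indicator (- ball b r) x) \<le> m"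
  shows "\<bar>interaction k p q - v * mass p * mass q\<bar> \<le> e * mass p * mass q + 2 * M * m * (mass p + mass q)"
proof -
  have M0: "M \<ge> 0" using M(2) by linarith
  define i j :: "real ^ 2 \<Rightarrow> real ^ 2 \<Rightarrow> real" where
    "i = (\<lambda>x y. indicator (- ball a r) x)" and "j = (\<lambda>x y. indicator (- ball b r) y)"
  define U where "U = (\<lambda>x y. e + 2 * M * (i x y + j x y))"
  have ij: "log_bounded A B i" "log_bounded A B j"
    unfolding i_def j_def case_prod_unfold
    by (rule log_bounded_bounded[of _ _ _ 1]; simp add: case_prod_unfold indicator_def)+
  have U: "log_bounded A B U"
    unfolding U_def by (intro log_bounded_add log_bounded_cmult log_bounded_const ij)
  have "interaction i p q = interaction (\<lambda>_ _. 1) (\<lambda>x. p x * indicator (- ball a r) x) q"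
    unfolding interaction_def i_def by (intro Bochner_Integration.integral_cong) auto
  also have "\<dots> = mass (\<lambda>x. p x * indicator (- ball a r) x) * mass q"
    using p(2) by (subst interaction_const[OF density_on_restrict[OF p(1)] _ q]) auto
  also have "\<dots> \<le> m * mass q"
    using m(1) mass_nonneg[OF q(1)] by (rule mult_right_mono)
  finally have 1: "interaction i p q \<le> m * mass q" .
  have "interaction j p q = interaction (\<lambda>_ _. 1) p (\<lambda>x. q x * indicator (- ball b r) x)"
    unfolding interaction_def j_def by (intro Bochner_Integration.integral_cong) auto
  also have "\<dots> = mass p * mass (\<lambda>x. q x * indicator (- ball b r) x)"
    using q(2) by (subst interaction_const[OF p density_on_restrict[OF q(1)]]) auto
  also have "\<dots> \<le> mass p * m"
    using m(2) mass_nonneg[OF p(1)] by (rule mult_left_mono)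
  finally have 2: "interaction j p q \<le> mass p * m" .
  have "interaction U p q = e * mass p * mass q + 2 * M * (interaction i p q + interaction j p q)"
    unfolding U_def
    by (subst interaction_add[OF p q log_bounded_const], intro log_bounded_cmult log_bounded_add ij)
       (simp add: interaction_const[OF p q] interaction_cmult interaction_add[OF p q ij])
  also have "\<dots> \<le> e * mass p * mass q + 2 * M * (m * mass q + mass p * m)"
    using 1 2 M0 by (intro add_left_mono mult_left_mono add_mono) auto
  finally have IU: "interaction U p q \<le> e * mass p * mass q + 2 * M * m * (mass p + mass q)"
    by (simp add: algebra_simps)
  have dev: "\<bar>k x y - v\<bar> \<le> U x y" if "x \<in> A" "y \<in> B" for x y
  proof (cases "x \<in> ball a r \<and> y \<in> ball b r")
    case True
    then show ?thesis using near[of x y] that by (simp add: U_def i_def j_def)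
  next
    case False
    then have "1 \<le> i x y + j x y" by (auto simp: i_def j_def indicator_def)
    then have "2 * M * 1 \<le> 2 * M * (i x y + j x y)" using M0 by (intro mult_left_mono) auto
    moreover have "\<bar>k x y - v\<bar> \<le> 2 * M" using M(1)[OF that] M(2) by linarith
    ultimately show ?thesis using e by (simp add: U_def)
  qed
  have "interaction k p q \<le> interaction (\<lambda>x y. v + U x y) p q"
  proof (rule interaction_mono[OF p q k log_bounded_add[OF log_bounded_const U]])
    fix x y assume "x \<in> A" "y \<in> B"
    with dev[of x y] show "k x y \<le> v + U x y" by linarith
  qed
  moreover have "interaction (\<lambda>x y. v + (- 1) * U x y) p q \<le> interaction k p q"
  proof (rule interaction_mono[OF p q log_bounded_add[OF log_bounded_const log_bounded_cmult[OF U]] k])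
    fix x y assume "x \<in> A" "y \<in> B"
    with dev[of x y] show "v + (- 1) * U x y \<le> k x y" by linarith
  qed
  ultimately have "\<bar>interaction k p q - v * mass p * mass q\<bar> \<le> interaction U p q"
    using interaction_add[OF p q log_bounded_const U] interaction_const[OF p q] interaction_cmult[of "- 1" U p q]
      interaction_add[OF p q log_bounded_const log_bounded_cmult[OF U, of "- 1"]]
    by (simp add: abs_le_iff)
  with IU show ?thesis by linarith
qed

lemma uniform_modulus:
  fixes k :: "'a::metric_space \<Rightarrow> 'b::metric_space \<Rightarrow> real"
  assumes "continuous_on (A \<times> B) (\<lambda>z. k (fst z) (snd z))" "compact A" "compact B" "e > 0"
  obtains r where "r > 0" "\<And>x a y b. x \<in> A \<Longrightarrow> a \<in> A \<Longrightarrow> y \<in> B \<Longrightarrow> b \<in> B \<Longrightarrow> dist x a < r \<Longrightarrow> dist y b < r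
      \<Longrightarrow> \<bar>k x y - k a b\<bar> \<le> e"
proof -
  have "uniformly_continuous_on (A \<times> B) (\<lambda>z. k (fst z) (snd z))"
    using assms by (intro compact_uniformly_continuous compact_Times)
  then obtain d where d: "d > 0"
    "\<And>z z'. z \<in> A \<times> B \<Longrightarrow> z' \<in> A \<times> B \<Longrightarrow> dist z' z < d \<Longrightarrow> dist (k (fst z') (snd z')) (k (fst z) (snd z)) < e"
    unfolding uniformly_continuous_on_def using assms(4) by metis
  show thesis
  proof (rule that[of "d / 2"])
    fix x a y b
    assume *: "x \<in> A" "a \<in> A" "y \<in> B" "b \<in> B" "dist x a < d / 2" "dist y b < d / 2"
    have "dist (x, y) (a, b) \<le> dist x a + dist y b"
      unfolding dist_prod_def by (simp add: sqrt_sum_squares_le_sum)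
    then show "\<bar>k x y - k a b\<bar> \<le> e"
      using d(2)[of "(a, b)" "(x, y)"] * by (simp add: dist_real_def)
  qed (use d(1) in simp)
qed

text \<open>The displacement is the first moment about \<open>a\<close> divided by \<open>k\<close>:
  mass within \<open>\<tau>\<close> contributes at most \<open>\<tau> * k\<close>, the escaped mass
  at most \<open>d * m\<close>.\<close>

lemma centre_near_point:
  assumes p: "density_on l A p" "bounded A" and k: "mass p = k" "k > 0"
    and d: "\<And>x. x \<in> A \<Longrightarrow> norm (x - a) \<le> d" "d \<ge> 0" and \<tau>: "\<tau> \<ge> 0"
    and m: "mass (\<lambda>x. p x * indicator (- ball a \<tau>) x) \<le> m"
  shows "norm ((1 / k) *\<^sub>R (\<integral>x. p x *\<^sub>R x \<partial>lborel) - a) \<le> \<tau> + d * m / k"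
proof -
  have pm [measurable]: "p \<in> borel_measurable borel" using density_onD(1)[OF p(1)] .
  have ip: "integrable lborel p" by (rule integrable_density[OF p])
  have io: "integrable lborel (\<lambda>x. p x * indicator (- ball a \<tau>) x)"
    using p(2) by (intro integrable_density[OF density_on_restrict[OF p(1)]]) auto
  have bd: "norm (p x *\<^sub>R (x - a)) \<le> \<tau> * p x + d * (p x * indicator (- ball a \<tau>) x)" for x
  proof (cases "x \<in> A")
    case True
    have p0: "0 \<le> p x" using density_onD(2)[OF p(1)] .
    show ?thesis
    proof (cases "x \<in> ball a \<tau>")
      case True
      then have "norm (x - a) \<le> \<tau>" by (simp add: dist_norm norm_minus_commute)
      then show ?thesis
        using mult_left_mono[OF _ p0, of "norm (x - a)" \<tau>] True p0 by (simp add: mult.commute)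
    next
      case False
      then show ?thesis
        using mult_left_mono[OF d(1)[OF \<open>x \<in> A\<close>] p0] p0 \<tau> by (simp add: mult.commute add_increasing)
    qed
  qed (use density_onD(4)[OF p(1)] in simp)
  have ib: "integrable lborel (\<lambda>x. \<tau> * p x + d * (p x * indicator (- ball a \<tau>) x))"
    using ip io by (intro Bochner_Integration.integrable_add integrable_mult_right) auto
  have i1: "integrable lborel (\<lambda>x. p x *\<^sub>R (x - a))"
  proof (rule Bochner_Integration.integrable_bound[OF ib])
    show "AE x in lborel. norm (p x *\<^sub>R (x - a)) \<le> norm (\<tau> * p x + d * (p x * indicator (- ball a \<tau>) x))"
      unfolding real_norm_def by (intro AE_I2 order_trans[OF bd abs_ge_self])
  qed measurable
  have i2: "integrable lborel (\<lambda>x. p x *\<^sub>R a)" using ip by simp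
  have "(\<integral>x. p x *\<^sub>R x \<partial>lborel) = (\<integral>x. p x *\<^sub>R (x - a) + p x *\<^sub>R a \<partial>lborel)"
    by (simp add: scaleR_diff_right)
  also have "\<dots> = (\<integral>x. p x *\<^sub>R (x - a) \<partial>lborel) + k *\<^sub>R a"
    using i1 i2 ip by (subst Bochner_Integration.integral_add) (auto simp: k(1))
  finally have eq: "(1 / k) *\<^sub>R (\<integral>x. p x *\<^sub>R x \<partial>lborel) - a = (1 / k) *\<^sub>R (\<integral>x. p x *\<^sub>R (x - a) \<partial>lborel)"
    using k(2) by (simp add: scaleR_add_right)
  have "norm (\<integral>x. p x *\<^sub>R (x - a) \<partial>lborel) \<le> (\<integral>x. norm (p x *\<^sub>R (x - a)) \<partial>lborel)"
    by (rule integral_norm_bound)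
  also have "\<dots> \<le> (\<integral>x. \<tau> * p x + d * (p x * indicator (- ball a \<tau>) x) \<partial>lborel)"
    using integrable_norm[OF i1] ib bd by (intro integral_mono) auto
  also have "\<dots> = \<tau> * k + d * mass (\<lambda>x. p x * indicator (- ball a \<tau>) x)"
    using ip io by (subst Bochner_Integration.integral_add) (auto simp: k(1))
  also have "\<dots> \<le> \<tau> * k + d * m"
    using m d(2) by (intro add_left_mono mult_left_mono) auto
  finally show ?thesis
    unfolding eq using k(2) by (simp add: field_simps)
qed

section \<open>The variational problem for two vortices of opposite sign\<close>

locale vortex_pair =
  fixes D :: "(real ^ 2) set" and G h :: "real ^ 2 \<Rightarrow> real ^ 2 \<Rightarrow> real"
    and \<kappa>1 \<kappa>2 \<delta> :: real and z1 z2 :: "real ^ 2"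
  assumes open_D: "open D" and bounded_D: "bounded D" and simply_connected_D: "simply_connected D"
    and green: "green_function D G h"
    and \<kappa>1_pos: "\<kappa>1 > 0" and \<kappa>2_neg: "\<kappa>2 < 0" and \<delta>_pos: "\<delta> > 0"
    and sub_D: "cball z1 \<delta> \<subseteq> D" "cball z2 \<delta> \<subseteq> D"
    and disjoint: "cball z1 \<delta> \<inter> cball z2 \<delta> = {}"
    and unique_min: "\<And>p. p \<in> cball z1 \<delta> \<times> cball z2 \<delta> \<Longrightarrow> p \<noteq> (z1, z2) \<Longrightarrow>
      kirchhoff_routh G h \<kappa>1 \<kappa>2 (z1, z2) < kirchhoff_routh G h \<kappa>1 \<kappa>2 p"
begin

abbreviation "B1 \<equiv> ball z1 \<delta>"
abbreviation "B2 \<equiv> ball z2 \<delta>"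
abbreviation "C1 \<equiv> cball z1 \<delta>"
abbreviation "C2 \<equiv> cball z2 \<delta>"

definition "S = C1 \<union> C2"

text \<open>The Green function and its regular part are only controlled inside the domain, so the kernels
  are cut off outside the two balls to make them measurable on the whole plane.\<close>

definition reg :: "real ^ 2 \<Rightarrow> real ^ 2 \<Rightarrow> real" where
  "reg x y = (if x \<in> S \<and> y \<in> S then h x y else 0)"

definition grn :: "real ^ 2 \<Rightarrow> real ^ 2 \<Rightarrow> real" where
  "grn x y = 1 / (2 * pi) * log_kernel x y + (- 1) * reg x y"

definition KR :: "real ^ 2 \<Rightarrow> real ^ 2 \<Rightarrow> real" where
  "KR x y = kirchhoff_routh G h \<kappa>1 \<kappa>2 (x, y)"

text \<open>The part of the energy without logarithmic self-interaction, with its sign reversed so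
  that it approximates the Kirchhoff-Routh function. Since \<open>p2\<close> stands for minus the
  negative component, the mixed term has a plus sign.\<close>

definition remainder :: "(real ^ 2 \<Rightarrow> real) \<Rightarrow> (real ^ 2 \<Rightarrow> real) \<Rightarrow> real" where
  "remainder p1 p2 = interaction reg p1 p1 + interaction reg p2 p2 + 2 * interaction grn p1 p2"

definition feasible :: "real \<Rightarrow> (real ^ 2 \<Rightarrow> real) \<Rightarrow> (real ^ 2 \<Rightarrow> real) \<Rightarrow> bool" where
  "feasible l p1 p2 \<longleftrightarrow> density_on l B1 p1 \<and> mass p1 = \<kappa>1 \<and> density_on l B2 p2 \<and> mass p2 = - \<kappa>2"

text \<open>Twice the kinetic energy of \<open>p1 - p2\<close> for a feasible pair.\<close>

definition energy :: "(real ^ 2 \<Rightarrow> real) \<Rightarrow> (real ^ 2 \<Rightarrow> real) \<Rightarrow> real" where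
  "energy p1 p2 = 1 / (2 * pi) * (interaction log_kernel p1 p1 + interaction log_kernel p2 p2) - remainder p1 p2"

definition optimal :: "real \<Rightarrow> (real ^ 2 \<Rightarrow> real) \<Rightarrow> (real ^ 2 \<Rightarrow> real) \<Rightarrow> bool" where
  "optimal l p1 p2 \<longleftrightarrow> feasible l p1 p2 \<and> (\<forall>p1' p2'. feasible l p1' p2' \<longrightarrow> energy p1' p2' \<le> energy p1 p2)"

lemma S_sub: "S \<subseteq> D" and compact_S: "compact S"
  using sub_D by (auto simp: S_def)

lemma green_eq: "x \<in> D \<Longrightarrow> y \<in> D \<Longrightarrow> x \<noteq> y \<Longrightarrow> G x y = 1 / (2 * pi) * ln (1 / norm (x - y)) - h x y"
  using green closure_subset[of D] unfolding green_function_def by blast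

lemma grn_eq: "x \<in> S \<Longrightarrow> y \<in> S \<Longrightarrow> x \<noteq> y \<Longrightarrow> grn x y = G x y"
  using green_eq[of x y] subsetD[OF S_sub] by (simp add: grn_def reg_def log_kernel_def)

lemma continuous_on_h: "continuous_on (S \<times> S) (\<lambda>z. h (fst z) (snd z))"
  using continuous_on_regular_part[OF open_D bounded_D green] S_sub
  by (auto simp: case_prod_unfold intro: continuous_on_subset)

lemma continuous_on_reg: "continuous_on (S \<times> S) (\<lambda>z. reg (fst z) (snd z))"
  using continuous_on_h by (rule continuous_on_eq) (auto simp: reg_def)

lemma reg_bounded: obtains M where "M \<ge> 0" "\<And>x y. \<bar>reg x y\<bar> \<le> M"
proof -
  have "compact ((\<lambda>z. reg (fst z) (snd z)) ` (S \<times> S))"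
    by (intro compact_continuous_image continuous_on_reg compact_Times compact_S)
  then obtain M where M: "\<And>z. z \<in> S \<times> S \<Longrightarrow> \<bar>reg (fst z) (snd z)\<bar> \<le> M"
    using compact_imp_bounded bounded_iff by (metis (no_types, lifting) image_eqI real_norm_def)
  have "\<bar>reg x y\<bar> \<le> max 0 M" for x y
    using M[of "(x, y)"] by (cases "x \<in> S \<and> y \<in> S") (auto simp: reg_def)
  then show thesis by (intro that[of "max 0 M"]) auto
qed

lemma log_bounded_reg: "log_bounded A B reg"
proof -
  obtain M where "\<And>x y. \<bar>reg x y\<bar> \<le> M" using reg_bounded by metis
  moreover have "case_prod reg \<in> borel_measurable (lborel \<Otimes>\<^sub>M lborel)"
  proof -
    \<comment> \<open>\<open>h\<close> is known to be continuous on the closed set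
      \<open>S \<times> S\<close>, so its extension by 0 is Borel on the whole plane.\<close>
    have "(\<lambda>z. indicator (S \<times> S) z *\<^sub>R h (fst z) (snd z)) \<in> borel_measurable borel"
      using compact_imp_closed[OF compact_Times[OF compact_S compact_S]]
      by (intro borel_measurable_continuous_on_indicator continuous_on_h) auto
    moreover have "(\<lambda>z. indicator (S \<times> S) z *\<^sub>R h (fst z) (snd z)) = case_prod reg"
      by (auto simp: reg_def indicator_def fun_eq_iff)
    ultimately have "case_prod reg \<in> borel_measurable (borel \<Otimes>\<^sub>M borel)"
      by (simp add: borel_prod)
    then show ?thesis by (simp cong: measurable_cong_sets)
  qed
  ultimately show ?thesis by (intro log_bounded_bounded)
qed

lemma log_bounded_grn: "bounded A \<Longrightarrow> bounded B \<Longrightarrow> log_bounded A B grn"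
  unfolding grn_def by (intro log_bounded_add log_bounded_cmult log_bounded_log_kernel log_bounded_reg)

lemma continuous_on_grn: "continuous_on (C1 \<times> C2) (\<lambda>z. grn (fst z) (snd z))"
  unfolding grn_def log_kernel_def
  by (intro continuous_intros continuous_on_subset[OF continuous_on_reg])
     (use disjoint in \<open>auto simp: S_def\<close>)

text \<open>This makes the two mixed interactions in the energy equal; the balls are disjoint, so
  the diagonal never occurs.\<close>

lemma grn_sym:
  assumes "x \<in> C1" "y \<in> C2"
  shows "grn y x = grn x y"
proof -
  have xy: "x \<in> S" "y \<in> S" "x \<noteq> y" using assms disjoint by (auto simp: S_def)
  then have "x \<in> D" "y \<in> D" using S_sub by auto
  then have "G x y = G y x"
    by (intro green_function_sym[OF open_D bounded_D simply_connected_D _ green] xy(3)) auto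
  then show ?thesis using xy by (simp add: grn_eq)
qed

lemma KR_eq:
  assumes "x \<in> C1" "y \<in> C2"
  shows "KR x y = reg x x * \<kappa>1\<^sup>2 + reg y y * \<kappa>2\<^sup>2 + 2 * (grn x y * \<kappa>1 * (- \<kappa>2))"
proof -
  have "x \<in> S" "y \<in> S" "x \<noteq> y" using assms disjoint by (auto simp: S_def)
  then show ?thesis
    by (simp add: KR_def kirchhoff_routh_def reg_def grn_eq)
qed

lemma continuous_on_KR: "continuous_on (C1 \<times> C2) (\<lambda>z. KR (fst z) (snd z))"
proof (rule continuous_on_eq)
  have 1: "continuous_on (C1 \<times> C2) (\<lambda>z. reg (fst z) (fst z))" "continuous_on (C1 \<times> C2) (\<lambda>z. reg (snd z) (snd z))"
    by (rule continuous_on_compose2[OF continuous_on_reg, of _ "\<lambda>z. (fst z, fst z)", simplified]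
          continuous_on_compose2[OF continuous_on_reg, of _ "\<lambda>z. (snd z, snd z)", simplified];
        auto simp: S_def intro!: continuous_intros)+
  show "continuous_on (C1 \<times> C2) (\<lambda>z. reg (fst z) (fst z) * \<kappa>1\<^sup>2 + reg (snd z) (snd z) * \<kappa>2\<^sup>2
      + 2 * (grn (fst z) (snd z) * \<kappa>1 * (- \<kappa>2)))"
    by (intro continuous_intros 1 continuous_on_grn)
qed (simp add: KR_eq mem_Times_iff)

section \<open>From maximizers to optimal pairs of densities\<close>

lemma feasibleD:
  assumes "feasible l p1 p2"
  shows "density_on l B1 p1" "mass p1 = \<kappa>1" "density_on l B2 p2" "mass p2 = - \<kappa>2"
  using assms by (auto simp: feasible_def)

lemma kinetic_energy_eq:
  assumes p: "feasible l p1 p2" and w: "AE x in lebesgue_on D. w x = p1 x - p2 x"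
  shows "kinetic_energy D G w = 1 / 2 * energy p1 p2"
proof -
  note f = feasibleD[OF p]
  have b: "bounded B1" "bounded B2" "bounded (B1 \<union> B2)" by auto
  have BS: "B1 \<union> B2 \<subseteq> S" by (auto simp: S_def)
  have g: "log_bounded (B1 \<union> B2) (B1 \<union> B2) grn" by (intro log_bounded_grn b)
  have "kinetic_energy D G w
    = 1 / 2 * (interaction grn p1 p1 + interaction grn p2 p2 - interaction grn p1 p2 - interaction grn p2 p1)"
    by (rule kinetic_energy_densities[OF open_D f(1) b(1) f(3) b(2) _ g _ w])
       (use BS S_sub grn_eq in \<open>auto simp: subset_iff\<close>)
  moreover have "interaction grn p2 p1 = interaction grn p1 p2"
  proof -
    have "interaction grn p2 p1 = interaction (\<lambda>x y. grn y x) p1 p2"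
      by (rule interaction_sym[OF f(3,1) log_bounded_grn[OF b(2,1)]])
    also have "\<dots> = interaction grn p1 p2"
      unfolding interaction_def
    proof (intro Bochner_Integration.integral_cong refl)
      fix z :: "(real ^ 2) \<times> (real ^ 2)"
      show "grn (snd z) (fst z) * p1 (fst z) * p2 (snd z) = grn (fst z) (snd z) * p1 (fst z) * p2 (snd z)"
        using density_onD(4)[OF f(1), of "fst z"] density_onD(4)[OF f(3), of "snd z"] grn_sym[of "fst z" "snd z"]
        by (cases "fst z \<in> B1 \<and> snd z \<in> B2") auto
    qed
    finally show ?thesis .
  qed
  moreover have "interaction grn p p = 1 / (2 * pi) * interaction log_kernel p p - interaction reg p p"
    if "density_on l A p" "bounded A" for A p
  proof -
    have "interaction grn p p = interaction (\<lambda>x y. 1 / (2 * pi) * log_kernel x y) p p + interaction (\<lambda>x y. (- 1) * reg x y) p p"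
      unfolding grn_def
      by (intro interaction_add[OF that that] log_bounded_cmult log_bounded_log_kernel log_bounded_reg that(2))
    then show ?thesis unfolding interaction_cmult by simp
  qed
  ultimately show ?thesis
    using f(1,3) by (simp add: energy_def remainder_def algebra_simps)
qed

lemma maximizer_optimal:
  assumes "l \<ge> 0" and w: "energy_maximizer D G (admissible D l \<kappa>1 B1 \<kappa>2 B2) w"
  obtains p1 p2 where "optimal l p1 p2" "AE x in lebesgue_on D. w x = p1 x - p2 x"
proof -
  have sub: "B1 \<subseteq> D" "B2 \<subseteq> D" using sub_D ball_subset_cball by blast+
  have adm: "w \<in> admissible D l \<kappa>1 B1 \<kappa>2 B2" using w by (simp add: energy_maximizer_def)
  obtain p1 p2 where p: "density_on l B1 p1" "mass p1 = \<kappa>1" "density_on l B2 p2" "mass p2 = - \<kappa>2"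
    and ae: "AE x in lebesgue_on D. w x = p1 x - p2 x"
    by (rule admissible_densities[OF open_D sub _ _ \<open>l \<ge> 0\<close> \<kappa>1_pos \<kappa>2_neg adm]) auto
  have feas: "feasible l p1 p2" using p by (simp add: feasible_def)
  have "energy p1' p2' \<le> energy p1 p2" if q: "feasible l p1' p2'" for p1' p2'
  proof -
    have "(\<lambda>x. p1' x - p2' x) \<in> admissible D l \<kappa>1 B1 \<kappa>2 B2"
      by (rule densities_admissible[OF open_D sub \<kappa>1_pos \<kappa>2_neg feasibleD[OF q]])
    then have "kinetic_energy D G (\<lambda>x. p1' x - p2' x) \<le> kinetic_energy D G w"
      using w by (simp add: energy_maximizer_def)
    then show ?thesis
      using kinetic_energy_eq[OF q, of "\<lambda>x. p1' x - p2' x"] kinetic_energy_eq[OF feas ae] by simp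
  qed
  with feas ae show thesis by (intro that[of p1 p2]) (auto simp: optimal_def)
qed

text \<open>Here \<open>M\<close> precedes \<open>e\<close>, and \<open>r0\<close> depends on
  \<open>e\<close> alone: the error \<open>M * m\<close> of the escaped mass can be sent to 0 by
  large \<open>l\<close> after \<open>e\<close> is fixed. The estimate is uniform in the centres
  because \<open>reg\<close> and, across the disjoint balls, \<open>grn\<close> are uniformly
  continuous on compact sets.\<close>

lemma remainder_near:
  obtains M where "M \<ge> 0" "\<And>e. e > 0 \<Longrightarrow> \<exists>r0>0. \<forall>r l p1 p2 a1 a2 m. 0 < r \<longrightarrow> r \<le> r0 \<longrightarrow> feasible l p1 p2 \<longrightarrow>
      a1 \<in> C1 \<longrightarrow> a2 \<in> C2 \<longrightarrow> mass (\<lambda>x. p1 x * indicator (- ball a1 r) x) \<le> m \<longrightarrow>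
      mass (\<lambda>x. p2 x * indicator (- ball a2 r) x) \<le> m \<longrightarrow> \<bar>remainder p1 p2 - KR a1 a2\<bar> \<le> e + M * m"
proof -
  define k where "k = - \<kappa>2"
  have k: "k > 0" "\<kappa>2 = - k" using \<kappa>2_neg by (auto simp: k_def)
  obtain Mr where Mr: "Mr \<ge> 0" "\<And>x y. \<bar>reg x y\<bar> \<le> Mr" using reg_bounded by metis
  have "compact ((\<lambda>z. grn (fst z) (snd z)) ` (C1 \<times> C2))"
    by (intro compact_continuous_image continuous_on_grn compact_Times compact_cball)
  then obtain Mg where Mg: "\<And>z. z \<in> C1 \<times> C2 \<Longrightarrow> \<bar>grn (fst z) (snd z)\<bar> \<le> Mg"
    using compact_imp_bounded bounded_iff by (metis (no_types, lifting) image_eqI real_norm_def)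
  have Mg': "\<bar>grn x y\<bar> \<le> Mg" if "x \<in> C1" "y \<in> C2" for x y using Mg[of "(x, y)"] that by simp
  have "\<bar>grn z1 z2\<bar> \<le> Mg" using \<delta>_pos by (intro Mg') auto
  then have Mg0: "Mg \<ge> 0" by linarith
  \<comment> \<open>Adding the three escape errors, with the mixed one counted twice, gives exactly
    this multiple of \<open>m\<close>.\<close>
  define M where "M = 4 * (Mr + Mg) * (\<kappa>1 + k)"
  show thesis
  proof (rule that[of M])
    show "M \<ge> 0" using Mr Mg0 \<kappa>1_pos k by (simp add: M_def)
    fix e :: real assume "e > 0"
    \<comment> \<open>The oscillation errors carry the weights \<open>\<kappa>1\<^sup>2\<close>,
      \<open>k\<^sup>2\<close> and \<open>2 * \<kappa>1 * k\<close>, whose sum is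
      \<open>(\<kappa>1 + k)\<^sup>2\<close>.\<close>
    define e' where "e' = e / (\<kappa>1 + k)\<^sup>2"
    have e': "e' > 0" "e' * (\<kappa>1 + k)\<^sup>2 = e" using \<open>e > 0\<close> \<kappa>1_pos k by (auto simp: e'_def)
    obtain ra where ra: "ra > 0" "\<And>x a y b. x \<in> S \<Longrightarrow> a \<in> S \<Longrightarrow> y \<in> S \<Longrightarrow> b \<in> S \<Longrightarrow>
        dist x a < ra \<Longrightarrow> dist y b < ra \<Longrightarrow> \<bar>reg x y - reg a b\<bar> \<le> e'"
      using uniform_modulus[OF continuous_on_reg compact_S compact_S e'(1)] by metis
    obtain rb where rb: "rb > 0" "\<And>x a y b. x \<in> C1 \<Longrightarrow> a \<in> C1 \<Longrightarrow> y \<in> C2 \<Longrightarrow> b \<in> C2 \<Longrightarrow>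
        dist x a < rb \<Longrightarrow> dist y b < rb \<Longrightarrow> \<bar>grn x y - grn a b\<bar> \<le> e'"
      using uniform_modulus[OF continuous_on_grn compact_cball compact_cball e'(1)] by metis
    show "\<exists>r0>0. \<forall>r l p1 p2 a1 a2 m. 0 < r \<longrightarrow> r \<le> r0 \<longrightarrow> feasible l p1 p2 \<longrightarrow>
      a1 \<in> C1 \<longrightarrow> a2 \<in> C2 \<longrightarrow> mass (\<lambda>x. p1 x * indicator (- ball a1 r) x) \<le> m \<longrightarrow>
      mass (\<lambda>x. p2 x * indicator (- ball a2 r) x) \<le> m \<longrightarrow> \<bar>remainder p1 p2 - KR a1 a2\<bar> \<le> e + M * m"
    proof (intro exI[of _ "min ra rb"] conjI allI impI)
      fix r l p1 p2 a1 a2 m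
      assume r: "0 < r" "r \<le> min ra rb" and f: "feasible l p1 p2" and a: "a1 \<in> C1" "a2 \<in> C2"
        and m: "mass (\<lambda>x. p1 x * indicator (- ball a1 r) x) \<le> m" "mass (\<lambda>x. p2 x * indicator (- ball a2 r) x) \<le> m"
      note p = feasibleD[OF f]
      have "\<bar>interaction reg p1 p1 - reg a1 a1 * mass p1 * mass p1\<bar> \<le> e' * mass p1 * mass p1 + 2 * Mr * m * (mass p1 + mass p1)"
        by (rule interaction_near_point[OF p(1) bounded_ball p(1) bounded_ball log_bounded_reg Mr(2) Mr(2) _ _ m(1) m(1)])
           (use r a e' ra(2) in \<open>auto simp: S_def dist_commute\<close>)
      moreover have "\<bar>interaction reg p2 p2 - reg a2 a2 * mass p2 * mass p2\<bar> \<le> e' * mass p2 * mass p2 + 2 * Mr * m * (mass p2 + mass p2)"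
        by (rule interaction_near_point[OF p(3) bounded_ball p(3) bounded_ball log_bounded_reg Mr(2) Mr(2) _ _ m(2) m(2)])
           (use r a e' ra(2) in \<open>auto simp: S_def dist_commute\<close>)
      moreover have "\<bar>interaction grn p1 p2 - grn a1 a2 * mass p1 * mass p2\<bar> \<le> e' * mass p1 * mass p2 + 2 * Mg * m * (mass p1 + mass p2)"
        by (rule interaction_near_point[OF p(1) bounded_ball p(3) bounded_ball log_bounded_grn[OF bounded_ball bounded_ball] Mg' Mg'[OF a] _ _ m(1) m(2)])
           (use r a e' rb(2) in \<open>auto simp: dist_commute\<close>)
      ultimately have "\<bar>remainder p1 p2 - (reg a1 a1 * \<kappa>1 * \<kappa>1 + reg a2 a2 * k * k + 2 * (grn a1 a2 * \<kappa>1 * k))\<bar>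
          \<le> (e' * \<kappa>1 * \<kappa>1 + 2 * Mr * m * (\<kappa>1 + \<kappa>1)) + (e' * k * k + 2 * Mr * m * (k + k))
            + 2 * (e' * \<kappa>1 * k + 2 * Mg * m * (\<kappa>1 + k))"
        unfolding remainder_def p(2,4) k_def[symmetric] mult_2[of "interaction grn p1 p2"]
          mult_2[of "grn a1 a2 * \<kappa>1 * k"] mult_2[of "e' * \<kappa>1 * k + _"]
        by linarith
      also have "\<dots> = e' * (\<kappa>1 + k)\<^sup>2 + M * m"
        by (simp add: M_def power2_eq_square algebra_simps)
      finally have "\<bar>remainder p1 p2 - (reg a1 a1 * \<kappa>1 * \<kappa>1 + reg a2 a2 * k * k + 2 * (grn a1 a2 * \<kappa>1 * k))\<bar>
          \<le> e + M * m"
        unfolding e'(2) .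
      moreover have "KR a1 a2 = reg a1 a1 * \<kappa>1 * \<kappa>1 + reg a2 a2 * k * k + 2 * (grn a1 a2 * \<kappa>1 * k)"
        by (simp add: KR_eq[OF a] k_def power2_eq_square)
      ultimately show "\<bar>remainder p1 p2 - KR a1 a2\<bar> \<le> e + M * m" by (simp only:)
    qed (use ra rb in simp)
  qed
qed

text \<open>The previous estimate is used crudely, with centres \<open>z1\<close> and
  \<open>z2\<close> and the sum \<open>\<kappa>1 - \<kappa>2\<close> of both masses as the escaped
  mass.\<close>

lemma remainder_bounded: obtains R where "\<And>l p1 p2. feasible l p1 p2 \<Longrightarrow> \<bar>remainder p1 p2\<bar> \<le> R"
proof -
  obtain M where M: "M \<ge> 0" "\<And>e. e > 0 \<Longrightarrow> \<exists>r0>0. \<forall>r l p1 p2 a1 a2 m. 0 < r \<longrightarrow> r \<le> r0 \<longrightarrow> feasible l p1 p2 \<longrightarrow>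
      a1 \<in> C1 \<longrightarrow> a2 \<in> C2 \<longrightarrow> mass (\<lambda>x. p1 x * indicator (- ball a1 r) x) \<le> m \<longrightarrow>
      mass (\<lambda>x. p2 x * indicator (- ball a2 r) x) \<le> m \<longrightarrow> \<bar>remainder p1 p2 - KR a1 a2\<bar> \<le> e + M * m"
    using remainder_near by blast
  obtain r0 where r0: "r0 > 0" "\<forall>r l p1 p2 a1 a2 m. 0 < r \<longrightarrow> r \<le> r0 \<longrightarrow> feasible l p1 p2 \<longrightarrow>
      a1 \<in> C1 \<longrightarrow> a2 \<in> C2 \<longrightarrow> mass (\<lambda>x. p1 x * indicator (- ball a1 r) x) \<le> m \<longrightarrow>
      mass (\<lambda>x. p2 x * indicator (- ball a2 r) x) \<le> m \<longrightarrow> \<bar>remainder p1 p2 - KR a1 a2\<bar> \<le> 1 + M * m"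
    using M(2)[of 1] by auto
  show thesis
  proof (rule that)
    fix l p1 p2 assume f: "feasible l p1 p2"
    note p = feasibleD[OF f]
    have "mass (\<lambda>x. p1 x * indicator (- ball z1 r0) x) \<le> \<kappa>1 - \<kappa>2"
      using mass_mono_indicator[OF p(1) bounded_ball, of "- ball z1 r0" UNIV] p(2) \<kappa>2_neg by simp
    moreover have "mass (\<lambda>x. p2 x * indicator (- ball z2 r0) x) \<le> \<kappa>1 - \<kappa>2"
      using mass_mono_indicator[OF p(3) bounded_ball, of "- ball z2 r0" UNIV] p(4) \<kappa>1_pos by simp
    ultimately have "\<bar>remainder p1 p2 - KR z1 z2\<bar> \<le> 1 + M * (\<kappa>1 - \<kappa>2)"
      using \<delta>_pos by (intro r0(2)[rule_format, OF r0(1) order_refl f]) auto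
    then show "\<bar>remainder p1 p2\<bar> \<le> \<bar>KR z1 z2\<bar> + (1 + M * (\<kappa>1 - \<kappa>2))" by linarith
  qed
qed


text \<open>The disc competitors bound the sum of both self-energies from below, and the upper bound for
  either one then bounds the other.\<close>

lemma self_energy_lower:
  obtains C where "C \<ge> 0" "\<forall>\<^sub>F l in at_top. \<forall>p1 p2. optimal l p1 p2 \<longrightarrow>
      ln l / 2 * \<kappa>1\<^sup>2 - C \<le> interaction log_kernel p1 p1 \<and> ln l / 2 * (- \<kappa>2)\<^sup>2 - C \<le> interaction log_kernel p2 p2"
proof -
  define k where "k = - \<kappa>2"
  have k: "k > 0" using \<kappa>2_neg by (simp add: k_def)
  obtain R where R: "R \<ge> 0" "\<And>l p1 p2. feasible l p1 p2 \<Longrightarrow> \<bar>remainder p1 p2\<bar> \<le> R"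
    using remainder_bounded by (metis abs_ge_self abs_ge_zero order_trans)
  let ?L = "interaction log_kernel"
  define c1 c2 where "c1 = \<kappa>1\<^sup>2 * (ln 2 + ln (\<kappa>1 / pi) / 2)" and "c2 = k\<^sup>2 * (ln 2 + ln (k / pi) / 2)"
  define b1 b2 b3 b4 b5 where "b1 = \<bar>c1\<bar>" and "b2 = \<bar>c2\<bar>" and "b3 = 2 * pi * (2 * R)"
    and "b4 = log_const * \<kappa>1" and "b5 = log_const * k"
  have b: "0 \<le> b1" "c1 \<le> b1" "0 \<le> b2" "c2 \<le> b2" "0 \<le> b3" "0 \<le> b4" "0 \<le> b5"
    using log_const_pos \<kappa>1_pos k R(1) by (simp_all add: b1_def b2_def b3_def b4_def b5_def)
  \<comment> \<open>\<open>b1\<close> and \<open>b2\<close> pay for the discs, \<open>b3\<close> for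
    two remainders after multiplication by \<open>2 * pi\<close>, \<open>b4\<close> and
    \<open>b5\<close> for the upper bounds on the self-energies.\<close>
  define C where "C = b1 + b2 + b3 + b4 + b5"
  show thesis
  proof (rule that[of C])
    show "C \<ge> 0" using b by (simp add: C_def)
    have "\<forall>\<^sub>F l :: real in at_top. 1 \<le> l" by (rule eventually_ge_at_top)
    with disc_density_exists[OF \<kappa>1_pos \<delta>_pos, of z1] disc_density_exists[OF k \<delta>_pos, of z2]
    show "\<forall>\<^sub>F l in at_top. \<forall>p1 p2. optimal l p1 p2 \<longrightarrow>
      ln l / 2 * \<kappa>1\<^sup>2 - C \<le> ?L p1 p1 \<and> ln l / 2 * (- \<kappa>2)\<^sup>2 - C \<le> ?L p2 p2"
    proof eventually_elim
      case (elim l)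
      obtain q1 where q1: "density_on l B1 q1" "mass q1 = \<kappa>1" "ln l / 2 * \<kappa>1\<^sup>2 - c1 \<le> ?L q1 q1"
        using elim(1) unfolding c1_def by blast
      obtain q2 where q2: "density_on l B2 q2" "mass q2 = k" "ln l / 2 * k\<^sup>2 - c2 \<le> ?L q2 q2"
        using elim(2) unfolding c2_def by blast
      have fq: "feasible l q1 q2" using q1 q2 by (simp add: feasible_def k_def)
      show ?case
      proof (intro allI impI)
        fix p1 p2 assume o: "optimal l p1 p2"
        then have f: "feasible l p1 p2" and "energy q1 q2 \<le> energy p1 p2"
          using fq by (auto simp: optimal_def)
        then have "1 / (2 * pi) * (?L q1 q1 + ?L q2 q2) \<le> 1 / (2 * pi) * (?L p1 p1 + ?L p2 p2) + 2 * R"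
          using R(2)[OF fq] R(2)[OF f] unfolding energy_def by linarith
        then have "2 * pi * (1 / (2 * pi) * (?L q1 q1 + ?L q2 q2)) \<le> 2 * pi * (1 / (2 * pi) * (?L p1 p1 + ?L p2 p2) + 2 * R)"
          by (intro mult_left_mono) auto
        then have sum: "?L q1 q1 + ?L q2 q2 \<le> ?L p1 p1 + ?L p2 p2 + b3"
          by (simp add: distrib_left b3_def)
        note p = feasibleD[OF f]
        have "?L p1 p1 \<le> (log_const + ln l / 2 * \<kappa>1) * \<kappa>1"
          using interaction_log_kernel_le'[OF p(1) bounded_ball p(1) bounded_ball elim(3)] p(2) by simp
        then have u1: "?L p1 p1 \<le> b4 + ln l / 2 * \<kappa>1\<^sup>2"
          by (simp add: power2_eq_square algebra_simps b4_def)
        have "?L p2 p2 \<le> (log_const + ln l / 2 * k) * k"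
          using interaction_log_kernel_le'[OF p(3) bounded_ball p(3) bounded_ball elim(3)] p(4) by (simp add: k_def)
        then have u2: "?L p2 p2 \<le> b5 + ln l / 2 * k\<^sup>2"
          by (simp add: power2_eq_square algebra_simps b5_def)
        show "ln l / 2 * \<kappa>1\<^sup>2 - C \<le> ?L p1 p1 \<and> ln l / 2 * (- \<kappa>2)\<^sup>2 - C \<le> ?L p2 p2"
        proof
          \<comment> \<open>The upper bound \<open>u2\<close> cancels the leading term
            \<open>ln l / 2 * k\<^sup>2\<close> coming from the second disc.\<close>
          show "ln l / 2 * \<kappa>1\<^sup>2 - C \<le> ?L p1 p1"
            using sum u2 q1(3) q2(3) b unfolding C_def by linarith
          show "ln l / 2 * (- \<kappa>2)\<^sup>2 - C \<le> ?L p2 p2"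
            using sum u1 q1(3) q2(3) b unfolding C_def k_def[symmetric] by linarith
        qed
      qed
    qed
  qed
qed

text \<open>Off a ball around the minimum point the remaining set is compact, so \<open>KR\<close>
  attains there a value strictly above its minimum; the difference is
  \<open>\<gamma>\<close>.\<close>

lemma KR_gap:
  assumes "\<tau> > 0"
  obtains \<gamma> where "\<gamma> > 0" "\<And>a1 a2. a1 \<in> C1 \<Longrightarrow> a2 \<in> C2 \<Longrightarrow> KR a1 a2 < KR z1 z2 + \<gamma> \<Longrightarrow> dist a1 z1 < \<tau> \<and> dist a2 z2 < \<tau>"
proof -
  define X where "X = (C1 \<times> C2) - ball (z1, z2) \<tau>"
  have X: "compact X" unfolding X_def by (intro compact_diff compact_Times compact_cball open_ball)
  have near: "dist a1 z1 < \<tau> \<and> dist a2 z2 < \<tau>" if "a1 \<in> C1" "a2 \<in> C2" "(a1, a2) \<notin> X" for a1 a2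
  proof -
    have "dist (a1, a2) (z1, z2) < \<tau>" using that by (simp add: X_def dist_commute)
    then show ?thesis
      using dist_fst_le[of "(a1, a2)" "(z1, z2)"] dist_snd_le[of "(a1, a2)" "(z1, z2)"] by simp
  qed
  show thesis
  proof (cases "X = {}")
    case True
    show thesis by (rule that[of 1]) (use near True in simp_all)
  next
    case False
    have "continuous_on X (\<lambda>z. KR (fst z) (snd z))"
      using continuous_on_KR by (rule continuous_on_subset) (auto simp: X_def)
    then obtain z where z: "z \<in> X" "\<And>y. y \<in> X \<Longrightarrow> KR (fst z) (snd z) \<le> KR (fst y) (snd y)"
      using continuous_attains_inf[OF X False] by blast
    have "z \<in> C1 \<times> C2" "z \<noteq> (z1, z2)" using z(1) assms by (auto simp: X_def)
    then have "KR z1 z2 < KR (fst z) (snd z)"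
      using unique_min[of z] by (simp add: KR_def)
    then show thesis
    proof (intro that[of "KR (fst z) (snd z) - KR z1 z2"])
      fix a1 a2 assume "a1 \<in> C1" "a2 \<in> C2" "KR a1 a2 < KR z1 z2 + (KR (fst z) (snd z) - KR z1 z2)"
      moreover from this have "(a1, a2) \<notin> X" using z(2)[of "(a1, a2)"] by auto
      ultimately show "dist a1 z1 < \<tau> \<and> dist a2 z2 < \<tau>" using near by blast
    qed simp
  qed
qed

text \<open>\<open>K\<close> comes from the concentration rate and serves every
  \<open>\<tau>\<close>. The competitor moves the two cores from the unknown points
  \<open>a1\<close>, \<open>a2\<close> to \<open>z1\<close>, \<open>z2\<close>; the self-energies
  nearly cancel, so optimality compares the values of \<open>KR\<close>.\<close>

lemma optimal_localizes:
  obtains K where "K \<ge> 0" "\<And>\<tau>. \<tau> > 0 \<Longrightarrow> \<forall>\<^sub>F l in at_top. \<forall>p1 p2. optimal l p1 p2 \<longrightarrow>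
     (\<exists>a1\<in>B1. \<exists>a2\<in>B2. dist a1 z1 < \<tau> \<and> dist a2 z2 < \<tau> \<and>
        mass (\<lambda>x. p1 x * indicator (- ball a1 \<tau>) x) \<le> K / ln l \<and>
        mass (\<lambda>x. p2 x * indicator (- ball a2 \<tau>) x) \<le> K / ln l)"
proof -
  define k where "k = - \<kappa>2"
  have k: "k > 0" using \<kappa>2_neg by (simp add: k_def)
  let ?L = "interaction log_kernel"
  obtain C where C: "C \<ge> 0" "\<forall>\<^sub>F l in at_top. \<forall>p1 p2. optimal l p1 p2 \<longrightarrow>
      ln l / 2 * \<kappa>1\<^sup>2 - C \<le> ?L p1 p1 \<and> ln l / 2 * k\<^sup>2 - C \<le> ?L p2 p2"
    by (rule self_energy_lower[folded k_def])
  obtain M where M: "M \<ge> 0" "\<And>e. e > 0 \<Longrightarrow> \<exists>r0>0. \<forall>r l p1 p2 a1 a2 m. 0 < r \<longrightarrow> r \<le> r0 \<longrightarrow> feasible l p1 p2 \<longrightarrow>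
      a1 \<in> C1 \<longrightarrow> a2 \<in> C2 \<longrightarrow> mass (\<lambda>x. p1 x * indicator (- ball a1 r) x) \<le> m \<longrightarrow>
      mass (\<lambda>x. p2 x * indicator (- ball a2 r) x) \<le> m \<longrightarrow> \<bar>remainder p1 p2 - KR a1 a2\<bar> \<le> e + M * m"
    using remainder_near by blast
  define K where "K = max (8 * (C / \<kappa>1 + log_const + 1)) (8 * (C / k + log_const + 1))"
  have "8 * (C / \<kappa>1 + log_const + 1) \<ge> 0" using C(1) \<kappa>1_pos log_const_pos by simp
  then have K: "K \<ge> 0" by (simp add: K_def)
  define d where "d = max 1 (2 * \<delta>)"
  have d: "d \<ge> 1" "\<And>x y. x \<in> ball a \<delta> \<Longrightarrow> y \<in> ball a \<delta> \<Longrightarrow> norm (x - y) \<le> d" for a :: "real ^ 2"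
  proof -
    fix x y :: "real ^ 2" assume "x \<in> ball a \<delta>" "y \<in> ball a \<delta>"
    then have "norm (x - y) \<le> 2 * \<delta>"
      using dist_triangle[of x y a] by (simp add: dist_norm norm_minus_commute)
    then show "norm (x - y) \<le> d" by (simp add: d_def)
  qed (simp add: d_def)
  show thesis
  proof (rule that[OF K])
    fix \<tau> :: real assume \<tau>: "\<tau> > 0"
    obtain \<gamma> where \<gamma>: "\<gamma> > 0"
      "\<And>a1 a2. a1 \<in> C1 \<Longrightarrow> a2 \<in> C2 \<Longrightarrow> KR a1 a2 < KR z1 z2 + \<gamma> \<Longrightarrow> dist a1 z1 < \<tau> \<and> dist a2 z2 < \<tau>"
      using KR_gap[OF \<tau>] by blast
    obtain r0 where r0: "r0 > 0" "\<forall>r l p1 p2 a1 a2 m. 0 < r \<longrightarrow> r \<le> r0 \<longrightarrow> feasible l p1 p2 \<longrightarrow>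
      a1 \<in> C1 \<longrightarrow> a2 \<in> C2 \<longrightarrow> mass (\<lambda>x. p1 x * indicator (- ball a1 r) x) \<le> m \<longrightarrow>
      mass (\<lambda>x. p2 x * indicator (- ball a2 r) x) \<le> m \<longrightarrow> \<bar>remainder p1 p2 - KR a1 a2\<bar> \<le> \<gamma> / 4 + M * m"
      using M(2)[of "\<gamma> / 4"] \<gamma>(1) by auto
    \<comment> \<open>The competitor has radius \<open>2 * r\<close>, which must respect
      \<open>r0\<close> and \<open>\<delta>\<close>; \<open>2 * r \<le> 1\<close> is demanded by
      \<open>recentred_competitor\<close>, and \<open>r \<le> \<tau>\<close> turns the mass bound
      outside \<open>r\<close> into the one outside \<open>\<tau>\<close>.\<close>
    define r where "r = min (min (r0 / 2) (1 / 2)) (min (\<delta> / 2) \<tau>)"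
    have r: "r > 0" "2 * r \<le> r0" "2 * r \<le> 1" "2 * r \<le> \<delta>" "r \<le> \<tau>" "r \<le> r0"
      using r0(1) \<delta>_pos \<tau> by (auto simp: r_def)
    define err where "err c l = K / ln l * (2 * (ln (2 / r) * c + log_const + ln l / 2 * (K / ln l)) + ln d * (K / ln l) + c)" for c l
    have m_lim: "((\<lambda>l. K / ln l) \<longlongrightarrow> 0) at_top"
      by (rule real_tendsto_divide_at_top[OF tendsto_const ln_at_top])
    have err_lim: "((\<lambda>l. err c l) \<longlongrightarrow> 0) at_top" for c
    proof -
      \<comment> \<open>In \<open>err\<close>, the self-energy loss for escaped mass
        \<open>K / ln l\<close>, the term \<open>ln l / 2 * (K / ln l)\<close> is the constant
        \<open>K / 2\<close>. The bracket is therefore bounded and the prefactor sends everything to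
        0.\<close>
      have "((\<lambda>l. K / ln l * (2 * (ln (2 / r) * c + log_const + K / 2) + ln d * (K / ln l) + c)) \<longlongrightarrow>
          0 * (2 * (ln (2 / r) * c + log_const + K / 2) + ln d * 0 + c)) at_top"
        by (intro tendsto_intros m_lim)
      then have "((\<lambda>l. K / ln l * (2 * (ln (2 / r) * c + log_const + K / 2) + ln d * (K / ln l) + c)) \<longlongrightarrow> 0) at_top"
        by simp
      moreover have "\<forall>\<^sub>F l in at_top. K / ln l * (2 * (ln (2 / r) * c + log_const + K / 2) + ln d * (K / ln l) + c) = err c l"
        using eventually_gt_at_top[of 1] by eventually_elim (simp add: err_def)
      ultimately show ?thesis by (rule Lim_transform_eventually)
    qed
    have "((\<lambda>l. 1 / (2 * pi) * (err \<kappa>1 l + err k l)) \<longlongrightarrow> 1 / (2 * pi) * (0 + 0)) at_top"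
      by (intro tendsto_intros err_lim)
    then have ev1: "\<forall>\<^sub>F l in at_top. 1 / (2 * pi) * (err \<kappa>1 l + err k l) < \<gamma> / 4"
      using \<gamma>(1) by (intro order_tendstoD(2)) auto
    have "((\<lambda>l. M * (K / ln l)) \<longlongrightarrow> M * 0) at_top" by (intro tendsto_intros m_lim)
    then have ev2: "\<forall>\<^sub>F l in at_top. M * (K / ln l) < \<gamma> / 4"
      using \<gamma>(1) by (intro order_tendstoD(2)) auto
    have ev3: "\<forall>\<^sub>F l in at_top. K / ln l < min (\<kappa>1 / 2) (k / 2)"
      using m_lim \<kappa>1_pos k by (intro order_tendstoD(2)) auto
    have r2: "r / 2 > 0" using r by simp
    have ev4: "\<forall>\<^sub>F l :: real in at_top. 1 < l" by (rule eventually_gt_at_top)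
    show "\<forall>\<^sub>F l in at_top. \<forall>p1 p2. optimal l p1 p2 \<longrightarrow>
     (\<exists>a1\<in>B1. \<exists>a2\<in>B2. dist a1 z1 < \<tau> \<and> dist a2 z2 < \<tau> \<and>
        mass (\<lambda>x. p1 x * indicator (- ball a1 \<tau>) x) \<le> K / ln l \<and>
        mass (\<lambda>x. p2 x * indicator (- ball a2 \<tau>) x) \<le> K / ln l)"
      using ev1 ev2 ev3 ev4 C(2) mass_concentrates_rate[OF \<kappa>1_pos C(1) r2] mass_concentrates_rate[OF k C(1) r2]
    proof eventually_elim
      case (elim l)
      show ?case
      proof (intro allI impI)
        fix p1 p2 assume o: "optimal l p1 p2"
        then have f: "feasible l p1 p2" by (simp add: optimal_def)
        note p = feasibleD[OF f]
        have l: "l \<ge> 1" "ln l > 0" using elim(4) by auto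
        define m where "m = K / ln l"
        have Km: "8 * (C / \<kappa>1 + log_const + 1) / ln l \<le> m" "8 * (C / k + log_const + 1) / ln l \<le> m"
          unfolding m_def using l by (auto simp: K_def intro!: divide_right_mono)
        obtain a1 where a1: "a1 \<in> B1" "mass (\<lambda>x. p1 x * indicator (- ball a1 (r / 2)) x) \<le> m"
          using elim(6)[rule_format, OF p(1) bounded_ball p(2)] elim(5)[rule_format, OF o] Km(1) by fastforce
        obtain a2 where a2: "a2 \<in> B2" "mass (\<lambda>x. p2 x * indicator (- ball a2 (r / 2)) x) \<le> m"
          using elim(7)[rule_format, OF p(3) bounded_ball p(4)[folded k_def]] elim(5)[rule_format, OF o] Km(2) by fastforce
        have off: "mass (\<lambda>x. p1 x * indicator (- ball a1 s) x) \<le> m" "mass (\<lambda>x. p2 x * indicator (- ball a2 s) x) \<le> m"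
          if "r / 2 \<le> s" for s
        proof -
          have sub: "- ball a1 s \<subseteq> - ball a1 (r / 2)" "- ball a2 s \<subseteq> - ball a2 (r / 2)"
            using that by auto
          show "mass (\<lambda>x. p1 x * indicator (- ball a1 s) x) \<le> m"
            by (rule order_trans[OF mass_mono_indicator[OF p(1) bounded_ball sub(1)] a1(2)]) auto
          show "mass (\<lambda>x. p2 x * indicator (- ball a2 s) x) \<le> m"
            by (rule order_trans[OF mass_mono_indicator[OF p(3) bounded_ball sub(2)] a2(2)]) auto
        qed
        have "m < min (\<kappa>1 / 2) (k / 2)" using elim(3) by (simp only: m_def)
        then have half: "2 * m \<le> mass p1" "2 * m \<le> mass p2"
          unfolding p(2,4) k_def[symmetric] by simp_all
        have pos: "mass p1 > 0" "mass p2 > 0"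
          unfolding p(2,4) k_def[symmetric] by (rule \<kappa>1_pos, rule k)
        obtain q1 where q1: "density_on l (ball z1 (2 * r)) q1" "mass q1 = mass p1"
          "?L p1 p1 - m * (2 * (ln (2 / r) * mass p1 + log_const + ln l / 2 * m) + ln d * m + mass p1) \<le> ?L q1 q1"
          by (rule recentred_competitor[OF p(1) bounded_ball l(1) d r(1,3) a1(2) half(1) pos(1), where b = z1])
        obtain q2 where q2: "density_on l (ball z2 (2 * r)) q2" "mass q2 = mass p2"
          "?L p2 p2 - m * (2 * (ln (2 / r) * mass p2 + log_const + ln l / 2 * m) + ln d * m + mass p2) \<le> ?L q2 q2"
          by (rule recentred_competitor[OF p(3) bounded_ball l(1) d r(1,3) a2(2) half(2) pos(2), where b = z2])
        have fq: "feasible l q1 q2"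
          using density_on_mono[OF q1(1) subset_ball[OF r(4)]] density_on_mono[OF q2(1) subset_ball[OF r(4)]]
            q1(2) q2(2) p(2,4) by (simp add: feasible_def)
        have z: "z1 \<in> C1" "z2 \<in> C2" using \<delta>_pos by auto
        have aC: "a1 \<in> C1" "a2 \<in> C2" using a1 a2 by auto
        \<comment> \<open>The competitor has no mass outside radius \<open>2 * r\<close>, so
          \<open>remainder_near\<close> applies to it with escaped mass 0.\<close>
        have zero: "(\<lambda>x. q1 x * indicator (- ball z1 (2 * r)) x) = (\<lambda>x. 0)" "(\<lambda>x. q2 x * indicator (- ball z2 (2 * r)) x) = (\<lambda>x. 0)"
          using density_onD(4)[OF q1(1)] density_onD(4)[OF q2(1)] by (auto simp: fun_eq_iff indicator_def)
        have q_near: "\<bar>remainder q1 q2 - KR z1 z2\<bar> \<le> \<gamma> / 4 + M * 0"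
          using r by (intro r0(2)[rule_format, OF _ r(2) fq z]) (auto simp: zero)
        have p_near: "\<bar>remainder p1 p2 - KR a1 a2\<bar> \<le> \<gamma> / 4 + M * m"
          using off[of r] r by (intro r0(2)[rule_format, OF r(1) r(6) f aC]) auto
        have "?L p1 p1 - err \<kappa>1 l \<le> ?L q1 q1" "?L p2 p2 - err k l \<le> ?L q2 q2"
          using q1(3) q2(3) unfolding p(2,4) err_def m_def[symmetric] k_def[symmetric] by simp_all
        then have "1 / (2 * pi) * (?L p1 p1 + ?L p2 p2 - (err \<kappa>1 l + err k l)) \<le> 1 / (2 * pi) * (?L q1 q1 + ?L q2 q2)"
          by (intro mult_left_mono) auto
        then have "1 / (2 * pi) * (?L p1 p1 + ?L p2 p2) - 1 / (2 * pi) * (err \<kappa>1 l + err k l) \<le> 1 / (2 * pi) * (?L q1 q1 + ?L q2 q2)"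
          by (simp only: right_diff_distrib)
        moreover have "energy q1 q2 \<le> energy p1 p2" using o fq by (simp add: optimal_def)
        ultimately have "remainder p1 p2 \<le> remainder q1 q2 + 1 / (2 * pi) * (err \<kappa>1 l + err k l)"
          unfolding energy_def by linarith
        \<comment> \<open>Four errors of at most \<open>\<gamma> / 4\<close> add up: one oscillation
          error for each pair, the escaped mass of the maximizer, and the self-energy loss. The last
          two are strictly smaller than that.\<close>
        then have "KR a1 a2 < KR z1 z2 + \<gamma>"
          using q_near p_near elim(1,2) unfolding m_def by linarith
        from \<gamma>(2)[OF aC this] have "dist a1 z1 < \<tau>" "dist a2 z2 < \<tau>" by auto
        then show "\<exists>a1\<in>B1. \<exists>a2\<in>B2. dist a1 z1 < \<tau> \<and> dist a2 z2 < \<tau> \<and>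
            mass (\<lambda>x. p1 x * indicator (- ball a1 \<tau>) x) \<le> K / ln l \<and>
            mass (\<lambda>x. p2 x * indicator (- ball a2 \<tau>) x) \<le> K / ln l"
          using off[of \<tau>] r unfolding m_def[symmetric]
          by (intro bexI[OF _ a1(1)] bexI[OF _ a2(1)] conjI) auto
      qed
    qed
  qed
qed

text \<open>The tolerance is split in three: the spread around the concentration point, the escaped
  mass times the diameter \<open>2 * \<delta>\<close>, and the distance of that point from the
  minimum.\<close>

lemma optimal_centres_converge:
  assumes "e > 0"
  shows "\<forall>\<^sub>F l in at_top. \<forall>p1 p2. optimal l p1 p2 \<longrightarrow>
    norm ((1 / \<kappa>1) *\<^sub>R (\<integral>x. p1 x *\<^sub>R x \<partial>lborel) - z1) < e \<and>
    norm ((1 / (- \<kappa>2)) *\<^sub>R (\<integral>x. p2 x *\<^sub>R x \<partial>lborel) - z2) < e"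
proof -
  define k where "k = - \<kappa>2"
  have k: "k > 0" using \<kappa>2_neg by (simp add: k_def)
  obtain K where K: "K \<ge> 0" "\<And>\<tau>. \<tau> > 0 \<Longrightarrow> \<forall>\<^sub>F l in at_top. \<forall>p1 p2. optimal l p1 p2 \<longrightarrow>
     (\<exists>a1\<in>B1. \<exists>a2\<in>B2. dist a1 z1 < \<tau> \<and> dist a2 z2 < \<tau> \<and>
        mass (\<lambda>x. p1 x * indicator (- ball a1 \<tau>) x) \<le> K / ln l \<and>
        mass (\<lambda>x. p2 x * indicator (- ball a2 \<tau>) x) \<le> K / ln l)"
    using optimal_localizes by blast
  have lim: "((\<lambda>l. 2 * \<delta> * (K / ln l) / c) \<longlongrightarrow> 0) at_top" for c
  proof -
    have "((\<lambda>l. K / ln l) \<longlongrightarrow> 0) at_top"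
      by (rule real_tendsto_divide_at_top[OF tendsto_const ln_at_top])
    from tendsto_mult_left[OF this, of "2 * \<delta> / c"] show ?thesis by (simp add: mult.commute)
  qed
  have ev: "\<forall>\<^sub>F l in at_top. 2 * \<delta> * (K / ln l) / c < e / 3" for c
    using lim assms by (intro order_tendstoD(2)) auto
  have e3: "e / 3 > 0" using assms by simp
  from K(2)[OF e3] ev[of \<kappa>1] ev[of k] show ?thesis
  proof eventually_elim
    case (elim l)
    show ?case
    proof (intro allI impI)
      fix p1 p2 assume o: "optimal l p1 p2"
      then have f: "feasible l p1 p2" by (simp add: optimal_def)
      note p = feasibleD[OF f]
      obtain a1 a2 where a: "a1 \<in> B1" "a2 \<in> B2" "dist a1 z1 < e / 3" "dist a2 z2 < e / 3"
        "mass (\<lambda>x. p1 x * indicator (- ball a1 (e / 3)) x) \<le> K / ln l"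
        "mass (\<lambda>x. p2 x * indicator (- ball a2 (e / 3)) x) \<le> K / ln l"
        using elim(1) o by blast
      have diam: "norm (x - a) \<le> 2 * \<delta>" if "x \<in> ball z \<delta>" "a \<in> ball z \<delta>" for x a z :: "real ^ 2"
        using that dist_triangle[of x a z] by (simp add: dist_norm norm_minus_commute)
      have 1: "norm ((1 / \<kappa>1) *\<^sub>R (\<integral>x. p1 x *\<^sub>R x \<partial>lborel) - a1) \<le> e / 3 + 2 * \<delta> * (K / ln l) / \<kappa>1"
        by (rule centre_near_point[OF p(1) bounded_ball p(2) \<kappa>1_pos diam[OF _ a(1)] _ _ a(5)]) (use \<delta>_pos e3 in auto)
      have 2: "norm ((1 / k) *\<^sub>R (\<integral>x. p2 x *\<^sub>R x \<partial>lborel) - a2) \<le> e / 3 + 2 * \<delta> * (K / ln l) / k"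
        by (rule centre_near_point[OF p(3) bounded_ball p(4)[folded k_def] k diam[OF _ a(2)] _ _ a(6)]) (use \<delta>_pos e3 in auto)
      have tri: "norm (v - z) < e" if "norm (v - a) \<le> e / 3 + t" "t < e / 3" "dist a z < e / 3" for v a z :: "real ^ 2" and t
      proof -
        have "norm (v - z) \<le> norm (v - a) + dist a z"
          using norm_triangle_ineq[of "v - a" "a - z"] by (simp add: dist_norm)
        with that show ?thesis by linarith
      qed
      show "norm ((1 / \<kappa>1) *\<^sub>R (\<integral>x. p1 x *\<^sub>R x \<partial>lborel) - z1) < e \<and>
          norm ((1 / (- \<kappa>2)) *\<^sub>R (\<integral>x. p2 x *\<^sub>R x \<partial>lborel) - z2) < e"
        unfolding k_def[symmetric] by (intro conjI tri[OF 1 elim(2) a(3)] tri[OF 2 elim(3) a(4)])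
    qed
  qed
qed

end

section \<open>Transfer of the convergence of centres from density pairs to maximizers\<close>

theorem lemma3p8:
  fixes D :: "(real ^ 2) set"
    and G h :: "real ^ 2 \<Rightarrow> real ^ 2 \<Rightarrow> real"
    and \<kappa>1 \<kappa>2 \<delta> :: real
    and xbar1 xbar2 :: "real ^ 2"
    and \<omega> :: "real \<Rightarrow> real ^ 2 \<Rightarrow> real"
  defines "H \<equiv> kirchhoff_routh G h \<kappa>1 \<kappa>2"
    and "B1 \<equiv> ball xbar1 \<delta>"
    and "B2 \<equiv> ball xbar2 \<delta>"
    and "K \<equiv> (\<lambda>l. admissible D l \<kappa>1 (ball xbar1 \<delta>) \<kappa>2 (ball xbar2 \<delta>))"
  assumes "smooth_planar_domain D"
    and "green_function D G h"
    and "\<kappa>1 > 0" and "\<kappa>2 < 0"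
    and "xbar1 \<in> D" and "xbar2 \<in> D" and "xbar1 \<noteq> xbar2"
    and strict_local_min:
      "\<forall>\<^sub>F p in at (xbar1, xbar2) within {(x1, x2). x1 \<in> D \<and> x2 \<in> D \<and> x1 \<noteq> x2}.
         H (xbar1, xbar2) < H p"
    and "\<delta> > 0"
    and "closure B1 \<subseteq> D" and "closure B2 \<subseteq> D"
    and "closure B1 \<inter> closure B2 = {}"
    and unique_min:
      "\<forall>p \<in> closure B1 \<times> closure B2. p \<noteq> (xbar1, xbar2) \<longrightarrow> H (xbar1, xbar2) < H p"
    and positive_levels:
      "\<forall>\<^sub>F l in at_top. \<forall>w \<mu>. energy_maximizer D G (K l) w \<longrightarrow>
         (patch_level D G l \<kappa>1 B1 w \<mu> \<longrightarrow> \<mu> > 0) \<and> (patch_level D G l \<kappa>2 B2 w \<mu> \<longrightarrow> \<mu> > 0)"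
    and maximizers: "\<forall>\<^sub>F l in at_top. energy_maximizer D G (K l) (\<omega> l)"
  shows "((\<lambda>l. (1 / \<kappa>1) *\<^sub>R (LINT x|lebesgue_on D. (\<omega> l x * indicator B1 x) *\<^sub>R x))
           \<longlongrightarrow> xbar1) at_top \<and>
         ((\<lambda>l. (1 / \<kappa>2) *\<^sub>R (LINT x|lebesgue_on D. (\<omega> l x * indicator B2 x) *\<^sub>R x))
           \<longlongrightarrow> xbar2) at_top"
proof -
  have cl: "closure B1 = cball xbar1 \<delta>" "closure B2 = cball xbar2 \<delta>"
    using \<open>\<delta> > 0\<close> by (simp_all add: B1_def B2_def)
  interpret vortex_pair D G h \<kappa>1 \<kappa>2 \<delta> xbar1 xbar2
  proof
    show "open D" "bounded D" "simply_connected D"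
      using \<open>smooth_planar_domain D\<close> by (auto simp: smooth_planar_domain_def)
    show "cball xbar1 \<delta> \<subseteq> D" "cball xbar2 \<delta> \<subseteq> D" "cball xbar1 \<delta> \<inter> cball xbar2 \<delta> = {}"
      using assms(14-16) by (simp_all only: cl)
    show "kirchhoff_routh G h \<kappa>1 \<kappa>2 (xbar1, xbar2) < kirchhoff_routh G h \<kappa>1 \<kappa>2 p"
      if "p \<in> cball xbar1 \<delta> \<times> cball xbar2 \<delta>" "p \<noteq> (xbar1, xbar2)" for p
      using unique_min that unfolding cl H_def by blast
  qed fact+
  \<comment> \<open>Since the balls are disjoint, restricting the vorticity to one ball leaves
    exactly one density, \<open>p1\<close> or \<open>- p2\<close>, up to a null set.\<close>
  have "\<forall>\<^sub>F l in at_top. \<exists>p1 p2. optimal l p1 p2 \<and>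
      (LINT x|lebesgue_on D. (\<omega> l x * indicator B1 x) *\<^sub>R x) = (\<integral>x. p1 x *\<^sub>R x \<partial>lborel) \<and>
      (LINT x|lebesgue_on D. (\<omega> l x * indicator B2 x) *\<^sub>R x) = - (\<integral>x. p2 x *\<^sub>R x \<partial>lborel)"
    using maximizers eventually_ge_at_top[of 0]
  proof eventually_elim
    case (elim l)
    obtain p1 p2 where p: "optimal l p1 p2" "AE x in lebesgue_on D. \<omega> l x = p1 x - p2 x"
      using maximizer_optimal[OF elim(2)] elim(1) unfolding K_def by metis
    have f: "feasible l p1 p2" using p(1) by (simp add: optimal_def)
    note p12 = feasibleD[OF f]
    have D: "D \<in> sets lebesgue" "D \<in> sets borel" using open_D by auto
    have [measurable]: "p1 \<in> borel_measurable borel" "p2 \<in> borel_measurable borel"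
      using density_onD(1)[OF p12(1)] density_onD(1)[OF p12(3)] by auto
    have m: "(\<lambda>x. p1 x *\<^sub>R x) \<in> borel_measurable borel" "(\<lambda>x. (- p2 x) *\<^sub>R x) \<in> borel_measurable borel"
      by measurable
    have B: "B1 \<subseteq> D" "B2 \<subseteq> D" "B1 \<inter> B2 = {}"
      using assms(14-16) closure_subset[of B1] closure_subset[of B2] by auto
    have p0: "x \<notin> B1 \<Longrightarrow> p1 x = 0" "x \<notin> B2 \<Longrightarrow> p2 x = 0" for x
      using density_onD(4)[OF p12(1)] density_onD(4)[OF p12(3)] by (auto simp: B1_def B2_def)
    then have p0': "x \<in> B2 \<Longrightarrow> p1 x = 0" "x \<in> B1 \<Longrightarrow> p2 x = 0" for x
      using B(3) by blast+
    have "(LINT x|lebesgue_on D. (\<omega> l x * indicator B1 x) *\<^sub>R x) = (LINT x|lebesgue_on D. p1 x *\<^sub>R x)"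
    proof (rule integral_lebesgue_on_cong_AE[OF D(1) borel_measurable_lebesgue_onI[OF m(1)]])
      show "AE x in lebesgue_on D. (\<omega> l x * indicator B1 x) *\<^sub>R x = p1 x *\<^sub>R x"
        using p(2)
      proof eventually_elim
        case (elim x)
        then show ?case using p0[of x] p0'[of x] by (cases "x \<in> B1") auto
      qed
    qed
    also have "\<dots> = (\<integral>x. p1 x *\<^sub>R x \<partial>lborel)"
      using p0 B by (intro lebesgue_on_integral_eq_lborel[OF m(1) D(2)]) auto
    finally have 1: "(LINT x|lebesgue_on D. (\<omega> l x * indicator B1 x) *\<^sub>R x) = (\<integral>x. p1 x *\<^sub>R x \<partial>lborel)" .
    have "(LINT x|lebesgue_on D. (\<omega> l x * indicator B2 x) *\<^sub>R x) = (LINT x|lebesgue_on D. (- p2 x) *\<^sub>R x)"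
    proof (rule integral_lebesgue_on_cong_AE[OF D(1) borel_measurable_lebesgue_onI[OF m(2)]])
      show "AE x in lebesgue_on D. (\<omega> l x * indicator B2 x) *\<^sub>R x = (- p2 x) *\<^sub>R x"
        using p(2)
      proof eventually_elim
        case (elim x)
        then show ?case using p0[of x] p0'[of x] by (cases "x \<in> B2") auto
      qed
    qed
    also have "\<dots> = (\<integral>x. (- p2 x) *\<^sub>R x \<partial>lborel)"
      using p0 B by (intro lebesgue_on_integral_eq_lborel[OF m(2) D(2)]) auto
    finally have 2: "(LINT x|lebesgue_on D. (\<omega> l x * indicator B2 x) *\<^sub>R x) = - (\<integral>x. p2 x *\<^sub>R x \<partial>lborel)"
      by simp
    from p(1) 1 2 show ?case by blast
  qed
  note patches = this
  have "\<forall>\<^sub>F l in at_top. dist ((1 / \<kappa>1) *\<^sub>R (LINT x|lebesgue_on D. (\<omega> l x * indicator B1 x) *\<^sub>R x)) xbar1 < e \<and>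
      dist ((1 / \<kappa>2) *\<^sub>R (LINT x|lebesgue_on D. (\<omega> l x * indicator B2 x) *\<^sub>R x)) xbar2 < e" if "e > 0" for e
    using patches optimal_centres_converge[OF that]
  proof eventually_elim
    case (elim l)
    then obtain p1 p2 where "optimal l p1 p2"
      and 1: "(LINT x|lebesgue_on D. (\<omega> l x * indicator B1 x) *\<^sub>R x) = (\<integral>x. p1 x *\<^sub>R x \<partial>lborel)"
      and 2: "(LINT x|lebesgue_on D. (\<omega> l x * indicator B2 x) *\<^sub>R x) = - (\<integral>x. p2 x *\<^sub>R x \<partial>lborel)"
      by blast
    \<comment> \<open>The minus sign in front of the second moment is absorbed by
      \<open>\<kappa>2 < 0\<close>: the quotient equals the one with \<open>p2\<close> and
      \<open>- \<kappa>2\<close>.\<close>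
    then show ?case
      unfolding 1 2 dist_norm using elim(2) by simp
  qed
  then show ?thesis
    unfolding tendsto_iff by (simp add: eventually_conj_iff)
qed

end
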